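(* There is an algorithm which, given as input a primitive substitution $\alpha$ of constant length $L>1$ with $X_\alpha$ infinite, terminates and outputs a finite list of substitutions that contains, up to renaming of symbols, exactly the injective primitive substitutions $\beta$ of constant length $L$ for which $(X_\beta,\sigma)$ is topologically conjugate to $(X_\alpha,\sigma)$.
   Context: An alphabet is a finite set $A$ with at least two elements. A substitution on $A$ is a map $\alpha:A\to A^*$, extended to finite and infinite words by juxtaposition; it has constant length $L$ if $\alpha(a)\in A^L$ for every $a\in A$. It is injective if $\alpha(a)\ne\alpha(b)$ for distinct letters $a,b$. It is primitive if for some $n>0$ and every $a\in A$ the word $\alpha^n(a)$ contains every letter of $A$. The language $\mathcal{L}_\alpha\subseteq A^*$ is the set of all factors (words of consecutive letters) of words $\alpha^n(a)$, $a\in A$, $n\ge 1$. $X_\alpha\subseteq A^{\mathbb{Z}}$ is the set of bi-infinite sequences all of whose finite factors lie in $\mathcal{L}_\alpha$, and $\sigma$ is the left shift. Two systems are topologically conjugate if there is a homeomorphism between them commuting with $\sigma$. Substitutions differing only by a bijective renaming of the symbols of the alphabet are regarded as the same. *)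

theory Defs
  imports "HOL-Analysis.Function_Topology" "HOL-Library.Sublist" "HOL-Library.Nat_Bijection"
begin

section \<open>Substitutions and their subshifts\<close>

text \<open>
  A substitution is given by its alphabet \<open>A\<close> and a function \<open>\<alpha>\<close> of which only the values
  on \<open>A\<close> matter.
\<close>

definition substitution :: "'a set \<Rightarrow> ('a \<Rightarrow> 'a list) \<Rightarrow> bool" where
  "substitution A \<alpha> \<longleftrightarrow> finite A \<and> card A \<ge> 2 \<and> (\<forall>a\<in>A. \<alpha> a \<in> lists A)"

definition subst_word :: "('a \<Rightarrow> 'a list) \<Rightarrow> 'a list \<Rightarrow> 'a list" where
  "subst_word \<alpha> w = concat (map \<alpha> w)"

definition constant_length :: "'a set \<Rightarrow> ('a \<Rightarrow> 'a list) \<Rightarrow> nat \<Rightarrow> bool" where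
  "constant_length A \<alpha> L \<longleftrightarrow> (\<forall>a\<in>A. length (\<alpha> a) = L)"

definition injective_subst :: "'a set \<Rightarrow> ('a \<Rightarrow> 'a list) \<Rightarrow> bool" where
  "injective_subst A \<alpha> \<longleftrightarrow> inj_on \<alpha> A"

definition primitive_subst :: "'a set \<Rightarrow> ('a \<Rightarrow> 'a list) \<Rightarrow> bool" where
  "primitive_subst A \<alpha> \<longleftrightarrow> (\<exists>n>0. \<forall>a\<in>A. A \<subseteq> set ((subst_word \<alpha> ^^ n) [a]))"

definition language :: "'a set \<Rightarrow> ('a \<Rightarrow> 'a list) \<Rightarrow> 'a list set" where
  "language A \<alpha> = {w. \<exists>a\<in>A. \<exists>n\<ge>1. sublist w ((subst_word \<alpha> ^^ n) [a])}"

definition subshift :: "'a set \<Rightarrow> ('a \<Rightarrow> 'a list) \<Rightarrow> (int \<Rightarrow> 'a) set" where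
  "subshift A \<alpha> =
     {x. range x \<subseteq> A \<and> (\<forall>i n. map (\<lambda>j. x (i + int j)) [0..<n] \<in> language A \<alpha>)}"

definition shift :: "(int \<Rightarrow> 'a) \<Rightarrow> int \<Rightarrow> 'a" where
  "shift x = (\<lambda>i. x (i + 1))"

definition subshift_topology :: "'a set \<Rightarrow> ('a \<Rightarrow> 'a list) \<Rightarrow> (int \<Rightarrow> 'a) topology" where
  "subshift_topology A \<alpha> =
     subtopology (product_topology (\<lambda>_. discrete_topology A) UNIV) (subshift A \<alpha>)"

definition conjugate ::
  "'a set \<Rightarrow> ('a \<Rightarrow> 'a list) \<Rightarrow> 'b set \<Rightarrow> ('b \<Rightarrow> 'b list) \<Rightarrow> bool" where
  "conjugate A \<alpha> B \<beta> \<longleftrightarrow>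
     (\<exists>h. homeomorphic_map (subshift_topology A \<alpha>) (subshift_topology B \<beta>) h \<and>
          (\<forall>x\<in>subshift A \<alpha>. h (shift x) = shift (h x)))"

definition same_up_to_renaming ::
  "'a set \<Rightarrow> ('a \<Rightarrow> 'a list) \<Rightarrow> 'b set \<Rightarrow> ('b \<Rightarrow> 'b list) \<Rightarrow> bool" where
  "same_up_to_renaming A \<alpha> B \<beta> \<longleftrightarrow>
     (\<exists>\<pi>. bij_betw \<pi> A B \<and> (\<forall>a\<in>A. \<beta> (\<pi> a) = map \<pi> (\<alpha> a)))"


section \<open>Algorithms\<close>

text \<open>
  Algorithms are Kleene's partial recursive functions, \<open>None\<close> meaning that the computation
  does not terminate (or that the arity is wrong). \<open>Prec f g\<close> is primitive recursion on the
  first argument. \<open>Mu f\<close> is minimisation, which is defined only if \<open>f\<close> converges at all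
  arguments below the first zero.
\<close>

datatype recf = Zero | Succ | Proj nat | Comp recf "recf list" | Prec recf recf | Mu recf

fun eval :: "recf \<Rightarrow> nat list \<Rightarrow> nat option" where
  "eval Zero xs = Some 0"
| "eval Succ xs = (case xs of [x] \<Rightarrow> Some (Suc x) | _ \<Rightarrow> None)"
| "eval (Proj i) xs = (if i < length xs then Some (xs ! i) else None)"
| "eval (Comp f gs) xs =
     (if \<forall>g\<in>set gs. eval g xs \<noteq> None then eval f (map (\<lambda>g. the (eval g xs)) gs) else None)"
| "eval (Prec f g) xs =
     (case xs of
        [] \<Rightarrow> None
      | n # ys \<Rightarrow>
          rec_nat (eval f ys) (\<lambda>m r. case r of None \<Rightarrow> None | Some y \<Rightarrow> eval g (m # y # ys)) n)"
| "eval (Mu f) xs =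
     (if \<exists>n. eval f (n # xs) = Some 0 \<and> (\<forall>m<n. eval f (m # xs) \<noteq> None)
      then Some (LEAST n. eval f (n # xs) = Some 0) else None)"

text \<open>
  As input and output of algorithms, a substitution on the alphabet \<open>{0, \<dots>, k - 1}\<close> is the
  list of the images of its \<open>k\<close> letters. Up to renaming of symbols, every substitution is of
  this form.
\<close>

type_synonym subst_table = "nat list list"

definition table_alphabet :: "subst_table \<Rightarrow> nat set" where
  "table_alphabet t = {..<length t}"

definition table_map :: "subst_table \<Rightarrow> nat \<Rightarrow> nat list" where
  "table_map t = (\<lambda>a. t ! a)"

definition table_code :: "subst_table \<Rightarrow> nat" where
  "table_code t = list_encode (map list_encode t)"

definition tables_code :: "subst_table list \<Rightarrow> nat" where
  "tables_code ts = list_encode (map table_code ts)"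


section \<open>The substitutions to be listed\<close>

definition injective_primitive_conjugate ::
  "'a set \<Rightarrow> ('a \<Rightarrow> 'a list) \<Rightarrow> nat \<Rightarrow> 'b set \<Rightarrow> ('b \<Rightarrow> 'b list) \<Rightarrow> bool" where
  "injective_primitive_conjugate A \<alpha> L B \<beta> \<longleftrightarrow>
     substitution B \<beta> \<and> injective_subst B \<beta> \<and> primitive_subst B \<beta> \<and>
     constant_length B \<beta> L \<and> conjugate B \<beta> A \<alpha>"

end

theory Submission
  imports Defs "HOL-Analysis.T1_Spaces" "HOL-Library.More_List"
begin

text \<open>
  Letters that some power of \<open>\<alpha>\<close> does not separate can be identified without changing the
  conjugacy class, so let \<open>\<alpha>\<close> be injective. If \<open>F\<close> is a conjugacy from \<open>X\<^sub>\<beta>\<close> to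
  \<open>X\<^sub>\<alpha>\<close>, then by recognizability there is exactly one \<open>k\<close> with \<open>0 \<le> k < L\<close> for which
  \<open>\<sigma>\<^sup>-\<^sup>k F\<close> maps \<open>\<beta>(X\<^sub>\<beta>)\<close> onto \<open>\<alpha>(X\<^sub>\<alpha>)\<close>, and \<open>F' = \<alpha>\<^sup>-\<^sup>1 \<sigma>\<^sup>-\<^sup>k F \<beta>\<close> is again a
  conjugacy. A radius \<open>s\<close> of \<open>F\<close> gives the radius \<open>(s + 2 L - 2) div L\<close> of \<open>F'\<close>, and
  the same holds for the inverses, so that iterating leads to a conjugacy of radius 2 with an
  inverse of radius 2. This bounds the number of letters of \<open>\<beta>\<close> by the number of words of
  length 5, and it leaves finitely many codes to be tested for each \<open>\<beta>\<close>.

  Recognizability: if \<open>\<alpha>(X)\<close> met \<open>\<sigma>\<^sup>k \<alpha>(X)\<close> for some \<open>k\<close> that is not a multiple of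
  \<open>L\<close>, then \<open>\<alpha>\<^sup>n(X)\<close> would be invariant under shifts by some \<open>g\<close> much smaller than
  \<open>L\<^sup>n\<close>. Two occurrences of one word \<open>\<alpha>\<^sup>n(b)\<close> would then overlap almost completely, and its
  small period would spread to all of \<open>X\<close>.
\<close>

section \<open>Computable functions on coded types\<close>

text \<open>The radius 2 is independent of \<open>L\<close>: replacing \<open>s\<close> by
  \<open>(s + 2 * L - 2) div L\<close> decreases every \<open>s\<close> above 2 and keeps 2 fixed.

  The obstacle for the algorithm is to certify a candidate block code by finitely many tests,
  although membership in the subshift is no condition on words of bounded length. Surjectivity is
  free, since the image is a closed invariant subset of a minimal system, and injectivity follows
  from a test on words of length 9. That the image lies in the subshift is obtained by
  desubstituting the code again and again within a finite set of codes: up to a shift, the code of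
  an n-fold image is the n-fold image of a coded point, so that a short window of it is covered by
  the n-fold image of two letters. Hence only the two-letter words of coded points have to be
  tested.

  Computability is kept apart from correctness: the algorithm is an ordinary function in which all
  searches are bounded, and closure rules for \<open>cmp\<close> turn it into a recursive function
  on codes.\<close>

class coded =
  fixes enc :: "'a \<Rightarrow> nat"
  assumes enc_inject: "enc x = enc y \<Longrightarrow> x = y"

lemma enc_eq_iff: "enc x = enc y \<longleftrightarrow> x = y"
  using enc_inject by blast

instantiation nat :: coded
begin
definition enc_nat :: "nat \<Rightarrow> nat" where "enc_nat n = n"
instance by standard (simp add: enc_nat_def)
end

instantiation bool :: coded
begin
definition enc_bool :: "bool \<Rightarrow> nat" where "enc_bool b = (if b then 1 else 0)"
instance by standard (simp add: enc_bool_def split: if_splits)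
end

instantiation prod :: (coded, coded) coded
begin
definition enc_prod :: "'a \<times> 'b \<Rightarrow> nat" where
  "enc_prod p = prod_encode (enc (fst p), enc (snd p))"
instance by standard (auto simp: enc_prod_def enc_eq_iff prod_eq_iff)
end

instantiation list :: (coded) coded
begin
definition enc_list :: "'a list \<Rightarrow> nat" where
  "enc_list xs = list_encode (map enc xs)"
instance
proof
  fix x y :: "'a list"
  assume "enc x = enc y"
  then have "map enc x = map enc y" by (simp add: enc_list_def list_encode_eq)
  then show "x = y" by (rule map_injective) (simp add: inj_def enc_eq_iff)
qed
end

text \<open>A nonempty list is thus coded as the successor of a pair, which reduces building a list
  and taking it apart to arithmetic and pairing.\<close>

lemma enc_Nil: "enc [] = 0" and enc_Cons: "enc (x # xs) = Suc (enc (x, xs))"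
  by (simp_all add: enc_list_def enc_prod_def)

text \<open>The code of a list serves as a computable number of iterations that suffices to traverse
  it; see \<open>cmp_foldl\<close>.\<close>

lemma length_le_enc: "length xs \<le> enc xs"
proof (induction xs)
  case (Cons x xs)
  then show ?case
    using le_prod_encode_2[of "enc xs" "enc x"] by (simp add: enc_Cons enc_prod_def)
qed (simp add: enc_Nil)

text \<open>Several arguments are passed as a pair, so that one arity serves all closure rules.
  Nothing is demanded of the program on numbers that are not codes.\<close>

definition cmp :: "('a::coded \<Rightarrow> 'b::coded) \<Rightarrow> bool" where
  "cmp f \<longleftrightarrow> (\<exists>p. \<forall>x. eval p [enc x] = Some (enc (f x)))"

section \<open>Arithmetic and the pairing function as recursive functions\<close>

definition r_add :: recf where "r_add = Prec (Proj 0) (Comp Succ [Proj 1])"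
definition r_pred :: recf where "r_pred = Comp (Prec Zero (Proj 0)) [Proj 0, Proj 0]"
definition r_sub :: recf where
  "r_sub = Comp (Prec (Proj 0) (Comp r_pred [Proj 1])) [Proj 1, Proj 0]"
definition r_triangle :: recf where
  "r_triangle = Comp (Prec Zero (Comp r_add [Proj 1, Comp Succ [Proj 0]])) [Proj 0, Proj 0]"
definition r_pair :: recf where
  "r_pair = Comp r_add [Comp r_triangle [Comp r_add [Proj 0, Proj 1]], Proj 0]"
text \<open>The least \<open>n\<close> with \<open>z < triangle (Suc n)\<close>, expressed by
  truncated subtraction. For \<open>z = prod_encode (a, b)\<close>, which is
  \<open>triangle (a + b) + a\<close>, this is the diagonal \<open>a + b\<close>.\<close>

definition r_diagonal :: recf where
  "r_diagonal = Mu (Comp r_sub [Comp Succ [Proj 1], Comp r_triangle [Comp Succ [Proj 0]]])"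
definition r_fst :: recf where
  "r_fst = Comp r_sub [Proj 0, Comp r_triangle [r_diagonal]]"
definition r_snd :: recf where
  "r_snd = Comp r_sub [r_diagonal, r_fst]"

lemma eval_add [simp]: "eval r_add [x, y] = Some (x + y)"
  by (induction x) (simp_all add: r_add_def)

lemma eval_pred [simp]: "eval r_pred [x] = Some (x - 1)"
proof -
  have "rec_nat (Some 0) (\<lambda>m r. case r of None \<Rightarrow> None | Some y \<Rightarrow> Some m) n = Some (n - 1)" for n :: nat
    by (induction n) auto
  then show ?thesis by (simp add: r_pred_def)
qed

lemma eval_sub [simp]: "eval r_sub [x, y] = Some (x - y)"
proof -
  have "rec_nat (Some x) (\<lambda>m r. case r of None \<Rightarrow> None | Some y \<Rightarrow> Some (y - Suc 0)) n = Some (x - n)" for n :: nat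
    by (induction n) auto
  then show ?thesis by (simp add: r_sub_def)
qed

lemma eval_triangle [simp]: "eval r_triangle [x] = Some (triangle x)"
proof -
  have "rec_nat (Some 0) (\<lambda>m r. case r of None \<Rightarrow> None | Some y \<Rightarrow> Some (Suc (y + m))) n = Some (triangle n)" for n :: nat
    by (induction n) auto
  then show ?thesis by (simp add: r_triangle_def)
qed

lemma eval_pair [simp]: "eval r_pair [x, y] = Some (prod_encode (x, y))"
  by (simp add: r_pair_def prod_encode_def)

lemma mono_triangle: "m \<le> n \<Longrightarrow> triangle m \<le> triangle n"
  by (induction n) (auto simp: le_Suc_eq)

lemma eval_diagonal [simp]: "eval r_diagonal [prod_encode (a, b)] = Some (a + b)"
proof -
  let ?x = "prod_encode (a, b)"
  have "Suc ?x - triangle (Suc n) = 0 \<longleftrightarrow> a + b \<le> n" for n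
  proof
    assume "Suc ?x - triangle (Suc n) = 0"
    then have "\<not> Suc n \<le> a + b"
      using mono_triangle[of "Suc n" "a + b"] by (auto simp: prod_encode_def)
    then show "a + b \<le> n" by simp
  next
    assume "a + b \<le> n"
    then show "Suc ?x - triangle (Suc n) = 0"
      using mono_triangle[of "a + b" n] by (auto simp: prod_encode_def)
  qed
  then have "(LEAST n. Suc ?x - triangle (Suc n) = 0) = a + b"
    by (intro Least_equality) auto
  moreover have "\<exists>n. Suc ?x - triangle (Suc n) = 0"
    using \<open>\<And>n. (Suc ?x - triangle (Suc n) = 0) = (a + b \<le> n)\<close> by blast
  ultimately show ?thesis by (simp add: r_diagonal_def del: triangle_Suc)
qed

lemma eval_fst [simp]: "eval r_fst [prod_encode (a, b)] = Some a"
  by (simp add: r_fst_def) (simp add: prod_encode_def)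

lemma eval_snd [simp]: "eval r_snd [prod_encode (a, b)] = Some b"
  by (simp add: r_snd_def)

section \<open>Closure properties of computable functions\<close>

named_theorems cmp_intros

lemma cmp_id [cmp_intros]: "cmp (\<lambda>x. x)"
  unfolding cmp_def by (rule exI[of _ "Proj 0"]) simp

lemma cmp_compose:
  assumes "cmp f" "cmp g"
  shows "cmp (\<lambda>x. f (g x))"
proof -
  obtain p q where "\<And>x. eval p [enc x] = Some (enc (f x))" "\<And>x. eval q [enc x] = Some (enc (g x))"
    using assms by (auto simp: cmp_def)
  then show ?thesis unfolding cmp_def by (intro exI[of _ "Comp p [q]"]) simp
qed

lemma eval_numeral_recf: "\<exists>p. \<forall>xs. eval p xs = Some n"
proof (induction n)
  case 0
  show ?case by (rule exI[of _ Zero]) simp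
next
  case (Suc n)
  then obtain p where "\<And>xs. eval p xs = Some n" by blast
  then show ?case by (intro exI[of _ "Comp Succ [p]"]) simp
qed

lemma cmp_const [cmp_intros]: "cmp (\<lambda>x. c)"
  using eval_numeral_recf[of "enc c"] by (auto simp: cmp_def)

text \<open>Encoding is computed by the identity program. This reduces equality on any coded type,
  and branching on a truth value, to natural numbers.\<close>

lemma cmp_enc [cmp_intros]: "cmp f \<Longrightarrow> cmp (\<lambda>x. enc (f x))"
  by (simp add: cmp_def enc_nat_def)

lemma cmp_enc_cong: "cmp f \<Longrightarrow> (\<And>x. enc (g x) = enc (f x)) \<Longrightarrow> cmp g"
  by (simp add: cmp_def)

lemma cmp_Pair [cmp_intros]:
  assumes "cmp f" "cmp g"
  shows "cmp (\<lambda>x. (f x, g x))"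
proof -
  obtain p q where "\<And>x. eval p [enc x] = Some (enc (f x))" "\<And>x. eval q [enc x] = Some (enc (g x))"
    using assms by (auto simp: cmp_def)
  then show ?thesis unfolding cmp_def
    by (intro exI[of _ "Comp r_pair [p, q]"]) (simp add: enc_prod_def)
qed

lemma cmp_fst [cmp_intros]: "cmp f \<Longrightarrow> cmp (\<lambda>x. fst (f x))"
  by (rule cmp_compose[of fst]) (auto simp: cmp_def enc_prod_def intro!: exI[of _ r_fst])

lemma cmp_snd [cmp_intros]: "cmp f \<Longrightarrow> cmp (\<lambda>x. snd (f x))"
  by (rule cmp_compose[of snd]) (auto simp: cmp_def enc_prod_def intro!: exI[of _ r_snd])

lemma cmp_Suc [cmp_intros]: "cmp f \<Longrightarrow> cmp (\<lambda>x. Suc (f x))"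
  by (rule cmp_compose[of Suc]) (auto simp: cmp_def enc_nat_def intro!: exI[of _ Succ])

lemma cmp_compose2:
  assumes "cmp (\<lambda>p. h (fst p) (snd p))" "cmp f" "cmp g"
  shows "cmp (\<lambda>x. h (f x) (g x))"
  using cmp_compose[OF assms(1) cmp_Pair[OF assms(2,3)]] by simp

lemma cmp_compose3:
  assumes "cmp (\<lambda>p. h (fst (fst p)) (snd (fst p)) (snd p))" "cmp f" "cmp g" "cmp k"
  shows "cmp (\<lambda>x. h (f x) (g x) (k x))"
  using cmp_compose[OF assms(1) cmp_Pair[OF cmp_Pair[OF assms(2,3)] assms(4)]] by simp

lemma cmp_binary:
  assumes p: "\<And>a b. eval p [enc a, enc b] = Some (enc (h a b))" and "cmp f" "cmp g"
  shows "cmp (\<lambda>x. h (f x) (g x))"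
proof (rule cmp_compose2[OF _ assms(2,3)])
  show "cmp (\<lambda>p. h (fst p) (snd p))"
    unfolding cmp_def
    by (rule exI[of _ "Comp p [r_fst, r_snd]"]) (simp add: enc_prod_def p)
qed

lemma cmp_add [cmp_intros]: "cmp f \<Longrightarrow> cmp g \<Longrightarrow> cmp (\<lambda>x. f x + g x :: nat)"
  by (rule cmp_binary[of r_add]) (simp_all add: enc_nat_def)

lemma cmp_diff [cmp_intros]: "cmp f \<Longrightarrow> cmp g \<Longrightarrow> cmp (\<lambda>x. f x - g x :: nat)"
  by (rule cmp_binary[of r_sub]) (simp_all add: enc_nat_def)

lemma cmp_rec_nat [cmp_intros]:
  assumes "cmp f" "cmp (\<lambda>p. g (fst (fst p)) (snd (fst p)) (snd p))" "cmp n"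
  shows "cmp (\<lambda>x. rec_nat (f x) (g x) (n x))"
proof -
  obtain pf where pf: "\<And>x. eval pf [enc x] = Some (enc (f x))"
    using assms(1) by (auto simp: cmp_def)
  obtain pn where pn: "\<And>x. eval pn [enc x] = Some (enc (n x))"
    using assms(3) by (auto simp: cmp_def)
  obtain pg where pg: "\<And>x m r. eval pg [enc ((x, m), r)] = Some (enc (g x m r))"
    using assms(2) unfolding cmp_def by (metis fst_conv snd_conv)
  \<comment> \<open>\<open>Prec\<close> hands over the counter, the previous value and the parameter
    in this order; they are repacked as \<open>((x, m), r)\<close>, the argument for which
    \<open>pg\<close> is specified.\<close>
  let ?q = "Prec pf (Comp pg [Comp r_pair [Comp r_pair [Proj 2, Proj 0], Proj 1]])"
  have "eval ?q [k, enc x] = Some (enc (rec_nat (f x) (g x) k))" for x k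
  proof (induction k)
    case (Suc k)
    have *: "prod_encode (prod_encode (enc x, k), enc (rec_nat (f x) (g x) k)) =
      enc ((x, k), rec_nat (f x) (g x) k)"
      by (simp add: enc_prod_def enc_nat_def)
    show ?case using Suc by (simp add: * pg)
  qed (simp add: pf)
  then show ?thesis unfolding cmp_def
    by (intro exI[of _ "Comp ?q [pn, Proj 0]"]) (simp add: pn enc_nat_def del: eval.simps(5))
qed

lemma cmp_if [cmp_intros]:
  assumes "cmp c" "cmp f" "cmp g"
  shows "cmp (\<lambda>x. if c x then f x else g x)"
proof -
  \<comment> \<open>The code of the condition is 0 or 1 and serves as the number of recursion
    steps.\<close>
  have "cmp (\<lambda>x. rec_nat (g x) (\<lambda>_ _. f x) (enc (c x)))"
    by (intro cmp_intros cmp_compose[OF assms(2)] assms)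
  moreover have "rec_nat (g x) (\<lambda>_ _. f x) (enc (c x)) = (if c x then f x else g x)" for x
    by (simp add: enc_bool_def)
  ultimately show ?thesis by simp
qed

lemma cmp_funpow [cmp_intros]:
  fixes f :: "'a::coded \<Rightarrow> 'b::coded \<Rightarrow> 'b"
  assumes "cmp (\<lambda>p. f (fst p) (snd p))" "cmp n" "cmp g"
  shows "cmp (\<lambda>x. (f x ^^ n x) (g x))"
proof -
  have "(h ^^ k) a = rec_nat a (\<lambda>_ r. h r) k" for h :: "'b \<Rightarrow> 'b" and k a
    by (induction k) simp_all
  moreover have "cmp (\<lambda>x. rec_nat (g x) (\<lambda>_ r. f x r) (n x))"
    by (intro cmp_intros assms cmp_compose2[OF assms(1)])
  ultimately show ?thesis by simp
qed

lemma cmp_mult [cmp_intros]: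
  assumes "cmp f" "cmp g"
  shows "cmp (\<lambda>x. f x * g x :: nat)"
proof -
  have "cmp (\<lambda>x. ((\<lambda>r. g x + r) ^^ f x) 0)"
    by (intro cmp_intros assms cmp_compose[OF assms(2)])
  moreover have "((\<lambda>r. b + r) ^^ a) 0 = a * b" for a b :: nat
    by (induction a) simp_all
  ultimately show ?thesis by simp
qed

lemma cmp_power [cmp_intros]:
  assumes "cmp f" "cmp g"
  shows "cmp (\<lambda>x. f x ^ g x :: nat)"
proof -
  have "cmp (\<lambda>x. ((\<lambda>r. f x * r) ^^ g x) 1)"
    by (intro cmp_intros assms cmp_compose[OF assms(1)])
  moreover have "((\<lambda>r. a * r) ^^ b) 1 = a ^ b" for a b :: nat
    by (induction b) simp_all
  ultimately show ?thesis by simp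
qed

lemma cmp_eq_0: "cmp f \<Longrightarrow> cmp (\<lambda>x. f x = (0::nat))"
  by (rule cmp_enc_cong[of "\<lambda>x. 1 - f x"])
    (auto intro!: cmp_intros simp: enc_bool_def enc_nat_def)

lemma cmp_le [cmp_intros]: "cmp f \<Longrightarrow> cmp g \<Longrightarrow> cmp (\<lambda>x. f x \<le> (g x :: nat))"
  using cmp_eq_0[OF cmp_diff, of f g] by simp

lemma cmp_conj [cmp_intros]: "cmp f \<Longrightarrow> cmp g \<Longrightarrow> cmp (\<lambda>x. f x \<and> g x)"
  by (rule cmp_enc_cong[of "\<lambda>x. if f x then g x else False"])
    (simp_all add: cmp_if cmp_const enc_bool_def)

lemma cmp_not [cmp_intros]: "cmp f \<Longrightarrow> cmp (\<lambda>x. \<not> f x)"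
  by (rule cmp_enc_cong[of "\<lambda>x. if f x then False else True"])
    (simp_all add: cmp_if cmp_const enc_bool_def del: if_cancel)

lemma cmp_disj [cmp_intros]: "cmp f \<Longrightarrow> cmp g \<Longrightarrow> cmp (\<lambda>x. f x \<or> g x)"
  using cmp_not[OF cmp_conj[OF cmp_not cmp_not], of f g] by simp

lemma cmp_imp [cmp_intros]: "cmp f \<Longrightarrow> cmp g \<Longrightarrow> cmp (\<lambda>x. f x \<longrightarrow> g x)"
  unfolding imp_conv_disj by (intro cmp_disj cmp_not)

lemma cmp_eq [cmp_intros]:
  assumes "cmp f" "cmp g"
  shows "cmp (\<lambda>x. f x = g x)"
proof -
  have "cmp (\<lambda>x. enc (f x) \<le> enc (g x) \<and> enc (g x) \<le> enc (f x))"
    by (intro cmp_intros assms)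
  then show ?thesis by (simp add: order_eq_iff[symmetric] enc_eq_iff)
qed

section \<open>Computable functions on lists\<close>

lemma cmp_Cons [cmp_intros]:
  assumes "cmp f" "cmp g"
  shows "cmp (\<lambda>x. f x # g x)"
proof (rule cmp_enc_cong)
  show "cmp (\<lambda>x. Suc (enc (f x, g x)))" by (intro cmp_intros assms)
qed (simp add: enc_Cons enc_nat_def)

lemma cmp_case_list [cmp_intros]:
  assumes "cmp n" "cmp (\<lambda>p. c (fst (fst p)) (snd (fst p)) (snd p))" "cmp l"
  shows "cmp (\<lambda>x. case l x of [] \<Rightarrow> n x | a # as \<Rightarrow> c x a as)"
proof -
  obtain pn where pn: "\<And>x. eval pn [enc x] = Some (enc (n x))"
    using assms(1) by (auto simp: cmp_def)
  obtain pl where pl: "\<And>x. eval pl [enc x] = Some (enc (l x))"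
    using assms(3) by (auto simp: cmp_def)
  obtain pc where pc: "\<And>x m r. eval pc [enc ((x, m), r)] = Some (enc (c x m r))"
    using assms(2) unfolding cmp_def by (metis fst_conv snd_conv)
  (* The recursion runs at most once, so that pc is applied only to the code of a nonempty list. *)
  let ?q = "Prec (Comp pn [Proj 0])
    (Comp pc [Comp r_pair [Comp r_pair [Proj 2, Comp r_fst [Proj 3]], Comp r_snd [Proj 3]]])"
  \<comment> \<open>A code minus its predecessor is 0 for the empty list and 1 otherwise. The
    predecessor of the code of a nonempty list is the code of the pair of head and tail.\<close>
  let ?r = "Comp ?q [Comp r_sub [pl, Comp r_pred [pl]], Proj 0, Comp r_pred [pl]]"
  have "eval ?r [enc x] = Some (enc (case l x of [] \<Rightarrow> n x | a # as \<Rightarrow> c x a as))" for x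
  proof (cases "l x")
    case Nil
    then show ?thesis by (simp add: pl pn enc_Nil)
  next
    case (Cons a as)
    have *: "prod_encode (prod_encode (enc x, enc a), enc as) = enc ((x, a), as)"
      by (simp add: enc_prod_def)
    have **: "enc (a, as) = prod_encode (enc a, enc as)" by (simp add: enc_prod_def)
    show ?thesis using pn by (simp add: pl enc_Cons ** Cons * pc)
  qed
  then show ?thesis unfolding cmp_def by blast
qed

text \<open>A step acts on an accumulator together with the rest of the list and does nothing once
  the rest is empty. Too many iterations therefore do no harm, and the code of the list can be taken
  as their number.\<close>

lemma cmp_foldl:
  assumes "cmp (\<lambda>p. f (fst (fst p)) (snd (fst p)) (snd p))" "cmp a" "cmp l"
  shows "cmp (\<lambda>x. foldl (f x) (a x) (l x))"
proof -
  define step where "step x s = (case snd s of [] \<Rightarrow> (fst s, []) | y # ys \<Rightarrow> (f x (fst s) y, ys))"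
    for x s
  have step: "step x (b, []) = (b, [])" "step x (b, y # ys) = (f x b y, ys)" for x b y ys
    by (simp_all add: step_def)
  have "(step x ^^ n) (b, ys) = (foldl (f x) b (take n ys), drop n ys)" for x n b ys
  proof (induction n arbitrary: b ys)
    case (Suc n)
    have "(step x ^^ Suc n) (b, ys) = (step x ^^ n) (step x (b, ys))"
      by (simp add: funpow_swap1)
    also have "\<dots> = (foldl (f x) b (take (Suc n) ys), drop (Suc n) ys)"
      using Suc by (cases ys) (simp_all add: step)
    finally show ?case .
  qed simp
  then have "fst ((step x ^^ enc (l x)) (a x, l x)) = foldl (f x) (a x) (l x)" for x
    by (simp add: length_le_enc)
  moreover have "cmp (\<lambda>x. fst ((step x ^^ enc (l x)) (a x, l x)))"
  proof (intro cmp_intros assms)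
    show "cmp (\<lambda>p. step (fst p) (snd p))"
      unfolding step_def by (intro cmp_intros cmp_compose3[OF assms(1)])
  qed
  ultimately show ?thesis by simp
qed

lemma cmp_rev [cmp_intros]:
  assumes "cmp f"
  shows "cmp (\<lambda>x. rev (f x))"
proof -
  have "foldl (\<lambda>as a. a # as) bs as = rev as @ bs" for as bs :: "'b list"
    by (induction as arbitrary: bs) simp_all
  moreover have "cmp (\<lambda>x. foldl (\<lambda>as a. a # as) [] (f x))"
    by (intro cmp_foldl cmp_intros assms)
  ultimately show ?thesis by simp
qed

lemma cmp_foldr [cmp_intros]:
  assumes "cmp (\<lambda>p. f (fst (fst p)) (snd (fst p)) (snd p))" "cmp l" "cmp a"
  shows "cmp (\<lambda>x. foldr (f x) (l x) (a x))"
  unfolding foldr_conv_foldl by (intro cmp_foldl cmp_intros assms cmp_compose3[OF assms(1)])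

lemma cmp_append [cmp_intros]:
  assumes "cmp f" "cmp g"
  shows "cmp (\<lambda>x. f x @ g x)"
proof -
  have "foldr (#) as bs = as @ bs" for as bs :: "'b list" by (induction as) simp_all
  moreover have "cmp (\<lambda>x. foldr (#) (f x) (g x))" by (intro cmp_intros assms)
  ultimately show ?thesis by simp
qed

lemma foldr_append_conv_concat: "foldr (@) xss [] = concat xss"
  by (induction xss) simp_all

lemma cmp_concat [cmp_intros]:
  assumes "cmp f"
  shows "cmp (\<lambda>x. concat (f x))"
proof -
  have "cmp (\<lambda>x. foldr (@) (f x) [])" by (intro cmp_intros assms)
  then show ?thesis by (simp add: foldr_append_conv_concat)
qed

lemma cmp_map [cmp_intros]:
  assumes "cmp (\<lambda>p. f (fst p) (snd p))" "cmp l"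
  shows "cmp (\<lambda>x. map (f x) (l x))"
proof -
  have "foldr (\<lambda>a r. h a # r) as [] = map h as" for h :: "'b \<Rightarrow> 'c" and as
    by (induction as) simp_all
  moreover have "cmp (\<lambda>x. foldr (\<lambda>a r. f x a # r) (l x) [])"
    by (intro cmp_intros assms cmp_compose2[OF assms(1)])
  ultimately show ?thesis by simp
qed

lemma cmp_filter [cmp_intros]:
  assumes "cmp (\<lambda>p. f (fst p) (snd p))" "cmp l"
  shows "cmp (\<lambda>x. filter (f x) (l x))"
proof -
  have "foldr (\<lambda>a r. if P a then a # r else r) as [] = filter P as" for P :: "'b \<Rightarrow> bool" and as
    by (induction as) simp_all
  moreover have "cmp (\<lambda>x. foldr (\<lambda>a r. if f x a then a # r else r) (l x) [])"
    by (intro cmp_intros assms cmp_compose2[OF assms(1)])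
  ultimately show ?thesis by simp
qed

lemma cmp_list_ex [cmp_intros]:
  assumes "cmp (\<lambda>p. f (fst p) (snd p))" "cmp l"
  shows "cmp (\<lambda>x. list_ex (f x) (l x))"
proof -
  have "cmp (\<lambda>x. filter (f x) (l x) \<noteq> [])"
    by (intro cmp_intros assms)
  then show ?thesis by (simp add: filter_empty_conv list_ex_iff)
qed

lemma cmp_list_all [cmp_intros]:
  assumes "cmp (\<lambda>p. f (fst p) (snd p))" "cmp l"
  shows "cmp (\<lambda>x. list_all (f x) (l x))"
proof -
  have "cmp (\<lambda>x. \<not> list_ex (\<lambda>a. \<not> f x a) (l x))"
    by (intro cmp_intros assms)
  then show ?thesis by (simp add: list_ex_iff list_all_iff)
qed

lemma cmp_mem [cmp_intros]:
  assumes "cmp f" "cmp l"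
  shows "cmp (\<lambda>x. f x \<in> set (l x))"
proof -
  have "cmp (\<lambda>x. list_ex (\<lambda>a. a = f x) (l x))"
    by (intro cmp_intros assms cmp_compose[OF assms(1)])
  then show ?thesis by (simp add: list_ex_iff)
qed

lemma cmp_length [cmp_intros]:
  assumes "cmp l"
  shows "cmp (\<lambda>x. length (l x))"
proof -
  have "foldr (\<lambda>a r. Suc r) as 0 = length as" for as :: "'b list"
    by (induction as) simp_all
  moreover have "cmp (\<lambda>x. foldr (\<lambda>a r. Suc r) (l x) 0)" by (intro cmp_intros assms)
  ultimately show ?thesis by simp
qed

lemma cmp_upt_0 [cmp_intros]:
  assumes "cmp n"
  shows "cmp (\<lambda>x. [0..<n x])"
proof -
  have "rec_nat [] (\<lambda>m r. r @ [m]) n = [0..<n]" for n by (induction n) simp_all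
  moreover have "cmp (\<lambda>x. rec_nat [] (\<lambda>m r. r @ [m]) (n x))" by (intro cmp_intros assms)
  ultimately show ?thesis by simp
qed

lemma cmp_drop [cmp_intros]:
  assumes "cmp n" "cmp l"
  shows "cmp (\<lambda>x. drop (n x) (l x))"
proof -
  have "((\<lambda>as. case as of [] \<Rightarrow> [] | _ # bs \<Rightarrow> bs) ^^ n) as = drop n as" for n and as :: "'b list"
  proof (induction n arbitrary: as)
    case (Suc n)
    show ?case by (cases as) (simp_all add: Suc funpow_Suc_right del: funpow.simps)
  qed simp
  moreover have "cmp (\<lambda>x. ((\<lambda>as. case as of [] \<Rightarrow> [] | _ # bs \<Rightarrow> bs) ^^ n x) (l x))"
    by (intro cmp_intros assms)
  ultimately show ?thesis by simp
qed

lemma cmp_take [cmp_intros]: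
  assumes "cmp n" "cmp l"
  shows "cmp (\<lambda>x. take (n x) (l x))"
proof -
  have "take m as = rev (drop (length as - m) (rev as))" for m and as :: "'b list"
    by (cases "m \<le> length as") (simp_all add: rev_drop)
  moreover have "cmp (\<lambda>x. rev (drop (length (l x) - n x) (rev (l x))))" by (intro cmp_intros assms)
  ultimately show ?thesis by simp
qed

lemma cmp_nth_default [cmp_intros]:
  assumes "cmp d" "cmp l" "cmp n"
  shows "cmp (\<lambda>x. nth_default (d x) (l x) (n x))"
proof -
  have "nth_default d as n = (case drop n as of [] \<Rightarrow> d | b # bs \<Rightarrow> b)" for d and as :: "'b list" and n
    by (cases "n < length as") (simp_all add: nth_default_def Cons_nth_drop_Suc[symmetric])
  moreover have "cmp (\<lambda>x. case drop (n x) (l x) of [] \<Rightarrow> d x | b # bs \<Rightarrow> b)"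
    by (intro cmp_intros assms)
  ultimately show ?thesis by simp
qed

lemma cmp_n_lists [cmp_intros]:
  assumes "cmp n" "cmp l"
  shows "cmp (\<lambda>x. List.n_lists (n x) (l x))"
proof -
  have "List.n_lists n l = ((\<lambda>r. concat (map (\<lambda>ys. map (\<lambda>y. y # ys) l) r)) ^^ n) [[]]"
    for n and l :: "'b list"
    by (induction n) simp_all
  moreover have "cmp (\<lambda>x. ((\<lambda>r. concat (map (\<lambda>ys. map (\<lambda>y. y # ys) (l x)) r)) ^^ n x) [[]])"
    by (intro cmp_intros assms cmp_compose[OF assms(2)])
  ultimately show ?thesis by simp
qed

lemma cmp_subseqs [cmp_intros]:
  assumes "cmp l"
  shows "cmp (\<lambda>x. subseqs (l x))"
proof -
  have "subseqs l = foldr (\<lambda>a r. map ((#) a) r @ r) l [[]]" for l :: "'b list"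
    by (induction l) (simp_all add: Let_def)
  moreover have "cmp (\<lambda>x. foldr (\<lambda>a r. map ((#) a) r @ r) (l x) [[]])"
    by (intro cmp_intros assms)
  ultimately show ?thesis by simp
qed

section \<open>Words, points and powers of a substitution\<close>

lemma subst_word_Nil [simp]: "subst_word \<rho> [] = []"
  and subst_word_Cons [simp]: "subst_word \<rho> (a # w) = \<rho> a @ subst_word \<rho> w"
  and subst_word_append [simp]: "subst_word \<rho> (u @ w) = subst_word \<rho> u @ subst_word \<rho> w"
  by (simp_all add: subst_word_def)

lemma length_subst_word:
  "(\<And>a. a \<in> set w \<Longrightarrow> length (\<rho> a) = M) \<Longrightarrow> length (subst_word \<rho> w) = M * length w"
  by (induction w) auto

lemma nth_subst_word:
  "(\<And>a. a \<in> set w \<Longrightarrow> length (\<rho> a) = M) \<Longrightarrow> i < M * length w \<Longrightarrow>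
    subst_word \<rho> w ! i = \<rho> (w ! (i div M)) ! (i mod M)"
proof (induction w arbitrary: i)
  case (Cons a w)
  show ?case
  proof (cases "i < M")
    case True
    with Cons.prems show ?thesis by (simp add: nth_append)
  next
    case False
    with Cons.prems have "0 < M" by (cases "M = 0") auto
    have "subst_word \<rho> w ! (i - M) = \<rho> (w ! ((i - M) div M)) ! ((i - M) mod M)"
      using Cons False by (intro Cons.IH) auto
    with False Cons.prems \<open>0 < M\<close> show ?thesis
      by (simp add: nth_append le_div_geq le_mod_geq)
  qed
qed simp

lemma sublist_subst_word: "sublist u w \<Longrightarrow> sublist (subst_word \<rho> u) (subst_word \<rho> w)"
  unfolding sublist_def by (metis subst_word_append)

text \<open>The power as a substitution in its own right, so that \<open>subst_word\<close> and
  \<open>subst_pt\<close> apply to it.\<close>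

definition pw :: "('a \<Rightarrow> 'a list) \<Rightarrow> nat \<Rightarrow> 'a \<Rightarrow> 'a list" where
  "pw \<alpha> n a = (subst_word \<alpha> ^^ n) [a]"

lemma funpow_subst_word_append:
  "(subst_word \<alpha> ^^ n) (u @ w) = (subst_word \<alpha> ^^ n) u @ (subst_word \<alpha> ^^ n) w"
  by (induction n) simp_all

lemma funpow_subst_word: "(subst_word \<alpha> ^^ n) w = subst_word (pw \<alpha> n) w"
proof (induction w)
  case Nil
  show ?case by (induction n) simp_all
next
  case (Cons a w)
  then show ?case using funpow_subst_word_append[of n \<alpha> "[a]" w] by (simp add: pw_def)
qed

lemma pw_0 [simp]: "pw \<alpha> 0 a = [a]"
  by (simp add: pw_def)

lemma pw_1 [simp]: "pw \<alpha> (Suc 0) = \<alpha>"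
  by (simp add: pw_def fun_eq_iff)

lemma pw_add: "pw \<alpha> (m + n) a = subst_word (pw \<alpha> m) (pw \<alpha> n a)"
  by (simp add: pw_def funpow_add funpow_subst_word[symmetric])

lemma set_pw:
  assumes "\<And>a. a \<in> A \<Longrightarrow> set (\<alpha> a) \<subseteq> A" "a \<in> A"
  shows "set (pw \<alpha> n a) \<subseteq> A"
proof (induction n)
  case (Suc n)
  have "pw \<alpha> (Suc n) a = subst_word \<alpha> (pw \<alpha> n a)" by (simp add: pw_def)
  then show ?case using Suc assms by (auto simp: subst_word_def)
qed (simp add: assms)

lemma length_pw:
  assumes "\<And>a. a \<in> A \<Longrightarrow> set (\<alpha> a) \<subseteq> A" "\<And>a. a \<in> A \<Longrightarrow> length (\<alpha> a) = L" "a \<in> A"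
  shows "length (pw \<alpha> n a) = L ^ n"
proof (induction n)
  case (Suc n)
  have "length (subst_word \<alpha> (pw \<alpha> n a)) = L * length (pw \<alpha> n a)"
    using set_pw[of A \<alpha> a n] assms by (intro length_subst_word) blast
  then show ?case using Suc by (simp add: pw_def)
qed simp

section \<open>Windows, shifts and images of bi-infinite sequences\<close>

definition window :: "(int \<Rightarrow> 'a) \<Rightarrow> int \<Rightarrow> nat \<Rightarrow> 'a list" where
  "window x i n = map (\<lambda>j. x (i + int j)) [0..<n]"

definition shiftn :: "int \<Rightarrow> (int \<Rightarrow> 'a) \<Rightarrow> int \<Rightarrow> 'a" where
  "shiftn k x = (\<lambda>i. x (i + k))"

text \<open>The image of the letter at 0 begins at 0. As \<open>div\<close> rounds down and
  \<open>mod\<close> is nonnegative, the formula is also right at negative positions.\<close>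

definition subst_pt :: "nat \<Rightarrow> ('a \<Rightarrow> 'b list) \<Rightarrow> (int \<Rightarrow> 'a) \<Rightarrow> int \<Rightarrow> 'b" where
  "subst_pt M \<rho> y = (\<lambda>i. \<rho> (y (i div int M)) ! nat (i mod int M))"

lemma length_window [simp]: "length (window x i n) = n"
  by (simp add: window_def)

lemma nth_window [simp]: "j < n \<Longrightarrow> window x i n ! j = x (i + int j)"
  by (simp add: window_def)

lemma set_window: "set (window x i n) = (\<lambda>j. x (i + int j)) ` {..<n}"
  by (auto simp: window_def)

lemma window_eqI: "(\<And>j. j < n \<Longrightarrow> x (i + int j) = y (i' + int j)) \<Longrightarrow> window x i n = window y i' n"
  by (simp add: window_def)

lemma window_eqD: "window x i n = window y i' n \<Longrightarrow> j < n \<Longrightarrow> x (i + int j) = y (i' + int j)"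
  by (metis nth_window)

lemma window_shiftn [simp]: "window (shiftn k x) i n = window x (i + k) n"
  by (simp add: window_def shiftn_def add_ac)

lemma window_split: "window x i (m + n) = window x i m @ window x (i + int m) n"
  by (rule nth_equalityI) (auto simp: nth_append)

lemma sublist_window:
  assumes "i \<le> j" "j + int m \<le> i + int n"
  shows "sublist (window x j m) (window x i n)"
proof -
  define a b where "a = nat (j - i)" and "b = nat (i + int n - (j + int m))"
  have n: "n = a + (m + b)" and j: "j = i + int a" using assms by (auto simp: a_def b_def)
  show ?thesis unfolding n window_split j by (auto simp: sublist_def)
qed

lemma sublist_windowD:
  assumes "sublist w (window x i n)"
  shows "\<exists>j. j + length w \<le> n \<and> w = window x (i + int j) (length w)"
proof -
  obtain u v where uv: "window x i n = u @ w @ v" using assms by (auto simp: sublist_def)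
  then have len: "n = length u + (length w + length v)" using length_window[of x i n] by simp
  have "w = take (length w) (drop (length u) (window x i n))" using uv by simp
  also have "\<dots> = window x (i + int (length u)) (length w)" unfolding len window_split by simp
  finally show ?thesis using len by (intro exI[of _ "length u"]) simp
qed

lemma shiftn_0 [simp]: "shiftn 0 x = x"
  by (simp add: shiftn_def)

lemma shiftn_shiftn [simp]: "shiftn k (shiftn l x) = shiftn (k + l) x"
  by (simp add: shiftn_def add_ac)

lemma shift_conv_shiftn: "shift x = shiftn 1 x"
  by (simp add: shift_def shiftn_def)

lemma shiftn_app [simp]: "shiftn k x i = x (i + k)"
  by (simp add: shiftn_def)

lemma subst_pt_shiftn:
  "M > 0 \<Longrightarrow> subst_pt M \<rho> (shiftn k y) = shiftn (int M * k) (subst_pt M \<rho> y)"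
  by (simp add: subst_pt_def fun_eq_iff add.commute)

lemma subst_pt_app:
  assumes "t < M"
  shows "subst_pt M \<rho> y (int M * q + int t) = \<rho> (y q) ! t"
  using assms by (simp add: subst_pt_def)

lemma window_subst_pt:
  assumes "M > 0" "\<And>j. length (\<rho> (y j)) = M"
  shows "window (subst_pt M \<rho> y) (int M * i) (M * n) = subst_word \<rho> (window y i n)"
proof (rule nth_equalityI)
  have len: "length (\<rho> a) = M" if "a \<in> set (window y i n)" for a
    using that assms by (auto simp: set_window)
  then show "length (window (subst_pt M \<rho> y) (int M * i) (M * n)) = length (subst_word \<rho> (window y i n))"
    by (simp add: length_subst_word)
  fix j assume "j < length (window (subst_pt M \<rho> y) (int M * i) (M * n))"
  then have j: "j < M * n" by simp
  then have "j div M < n" by (simp add: less_mult_imp_div_less mult.commute)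
  moreover have "subst_pt M \<rho> y (int M * i + int j) = \<rho> (y (i + int (j div M))) ! (j mod M)"
    using assms by (simp add: subst_pt_def zdiv_int nat_mod_distrib flip: of_nat_mod)
  ultimately show "window (subst_pt M \<rho> y) (int M * i) (M * n) ! j = subst_word \<rho> (window y i n) ! j"
    using j nth_subst_word[OF len, where i = j] by simp
qed

text \<open>Rounding down does not leave a symmetric interval, so that agreement of two points on
  such an interval passes to their images on the same interval.\<close>

lemma abs_div_le:
  fixes i :: int
  assumes "\<bar>i\<bar> \<le> R" "M > 0"
  shows "\<bar>i div M\<bar> \<le> R"
proof -
  define q where "q = i div M"
  have q: "M * q \<le> i" "i < M * (q + 1)"
    using assms(2) mult_div_mod_eq[of M i] pos_mod_bound[of M i] pos_mod_sign[of M i]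
      distrib_left[of M q 1] unfolding q_def by linarith+
  have "q \<le> R"
  proof (rule ccontr)
    assume "\<not> q \<le> R"
    then have "1 * q \<le> M * q" using assms by (intro mult_right_mono) auto
    then show False using q assms(1) \<open>\<not> q \<le> R\<close> by linarith
  qed
  moreover have "-R \<le> q"
  proof (rule ccontr)
    assume "\<not> -R \<le> q"
    then have "M * (q + 1) \<le> 1 * (q + 1)" using assms by (intro mult_right_mono_neg) auto
    then have "M * (q + 1) \<le> q + 1" by simp
    moreover have "-R \<le> i" using assms(1) by simp
    ultimately show False using q \<open>\<not> -R \<le> q\<close> by simp
  qed
  ultimately show ?thesis by (simp add: q_def)
qed

lemma subst_pt_cong:
  assumes "\<And>i. \<bar>i\<bar> \<le> R \<Longrightarrow> x i = y i" "\<bar>i\<bar> \<le> R" "M > 0"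
  shows "subst_pt M \<rho> x i = subst_pt M \<rho> y i"
  using assms abs_div_le[of i R "int M"] by (simp add: subst_pt_def)

lemma subst_pt_compose:
  assumes "M > 0" "N > 0" "\<And>j. length (\<tau> (y j)) = N"
    "\<And>a j. a \<in> set (\<tau> (y j)) \<Longrightarrow> length (\<rho> a) = M"
  shows "subst_pt M \<rho> (subst_pt N \<tau> y) = subst_pt (M * N) (\<lambda>a. subst_word \<rho> (\<tau> a)) y"
proof
  fix i
  define q r where "q = i div int (M * N)" and "r = nat (i mod int (M * N))"
  have r: "r < M * N"
    unfolding r_def using assms(1,2) by (simp add: nat_less_iff)
  have i: "i = int M * (int N * q) + int r"
    unfolding q_def r_def using assms(1,2) by (simp add: mult.assoc[symmetric])
  have d: "i div int M = int N * q + int (r div M)" "nat (i mod int M) = r mod M"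
    unfolding i using assms(1) by (simp_all add: zdiv_int nat_mod_distrib flip: of_nat_mod)
  have rM: "r div M < N" using r by (simp add: less_mult_imp_div_less mult.commute)
  have "subst_pt M \<rho> (subst_pt N \<tau> y) i = \<rho> (\<tau> (y q) ! (r div M)) ! (r mod M)"
    using rM by (simp add: subst_pt_def[of M] d subst_pt_app)
  also have "\<dots> = subst_word \<rho> (\<tau> (y q)) ! r"
    using assms(4)[where j = q] r by (subst nth_subst_word[where M = M]) (auto simp: assms(3))
  also have "\<dots> = subst_pt (M * N) (\<lambda>a. subst_word \<rho> (\<tau> a)) y i"
    by (simp add: subst_pt_def q_def r_def)
  finally show "subst_pt M \<rho> (subst_pt N \<tau> y) i = subst_pt (M * N) (\<lambda>a. subst_word \<rho> (\<tau> a)) y i" .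
qed

lemma mem_subshift_iff:
  assumes "language A \<alpha> \<subseteq> lists A"
  shows "x \<in> subshift A \<alpha> \<longleftrightarrow> (\<forall>i n. window x i n \<in> language A \<alpha>)"
proof
  assume "\<forall>i n. window x i n \<in> language A \<alpha>"
  moreover from this have "window x i 1 \<in> lists A" for i using assms by blast
  then have "x i \<in> A" for i by (simp add: window_def)
  ultimately show "x \<in> subshift A \<alpha>" by (auto simp: subshift_def window_def)
qed (simp add: subshift_def window_def)

lemma language_sublist: "w \<in> language A \<alpha> \<Longrightarrow> sublist u w \<Longrightarrow> u \<in> language A \<alpha>"
  unfolding language_def using sublist_order.order.trans by blast

section \<open>Primitive substitutions of constant length\<close>

lemmas sublist_trans = sublist_order.order.trans

lemma sublist_block:
  assumes "sublist w (subst_word \<rho> v)" "\<And>a. a \<in> set v \<Longrightarrow> length (\<rho> a) = M" "M > 0"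
    "2 * M \<le> length w"
  shows "\<exists>a\<in>set v. sublist (\<rho> a) w"
proof -
  let ?z = "subst_word \<rho> v"
  obtain ps ss where z: "?z = ps @ w @ ss" using assms(1) by (auto simp: sublist_def)
  \<comment> \<open>Division rounding up: the first block that does not begin before
    \<open>w\<close>. It begins fewer than \<open>M\<close> letters into \<open>w\<close> and
    therefore ends inside \<open>w\<close>.\<close>
  define q where "q = (length ps + M - 1) div M"
  have lz: "length ?z = M * length v" using assms(2) by (rule length_subst_word)
  have q1: "length ps \<le> M * q" and q2: "M * q < length ps + M"
    using assms(3) mult_div_mod_eq[of M "length ps + M - 1"] mod_less_divisor[of M "length ps + M - 1"]
    unfolding q_def by linarith+
  have le: "M * q + M \<le> length ps + length w" using q2 assms(4) by linarith
  have "length ps + length w \<le> M * length v" using lz unfolding z by simp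
  then have "M * q < M * length v" using le assms(3) by linarith
  then have qv: "q < length v" by simp
  have len: "length (\<rho> (v ! q)) = M" using qv assms(2) by simp
  have "\<rho> (v ! q) = take M (drop (M * q - length ps) w)"
  proof (rule nth_equalityI)
    show "length (\<rho> (v ! q)) = length (take M (drop (M * q - length ps) w))"
      using le q1 len by simp
    fix j assume "j < length (\<rho> (v ! q))"
    then have j: "j < M" using len by simp
    have "M * q + j < M * length v" using le lz z j by simp
    then have "?z ! (M * q + j) = \<rho> (v ! q) ! j"
      using nth_subst_word[of v \<rho> M "M * q + j"] assms(2) j by simp
    moreover have "?z ! (M * q + j) = w ! (M * q - length ps + j)"
    proof -
      have "M * q + j = length ps + (M * q - length ps + j)" "M * q - length ps + j < length w"
        using q1 le j by linarith+
      then show ?thesis unfolding z by (metis nth_append nth_append_length_plus)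
    qed
    ultimately show "\<rho> (v ! q) ! j = take M (drop (M * q - length ps) w) ! j"
      using le q1 j by simp
  qed
  then have "sublist (\<rho> (v ! q)) w"
    by (metis sublist_trans sublist_drop sublist_take)
  then show ?thesis using qv by auto
qed

locale const_length_subst =
  fixes A :: "'a set" and \<alpha> :: "'a \<Rightarrow> 'a list" and L :: nat
  assumes substitution: "substitution A \<alpha>"
    and primitive: "primitive_subst A \<alpha>"
    and constant_length: "constant_length A \<alpha> L"
    and L_gt_1: "L > 1"
begin

abbreviation X where "X \<equiv> subshift A \<alpha>"
abbreviation Lang where "Lang \<equiv> language A \<alpha>"
definition S where "S n = subst_pt (L ^ n) (pw \<alpha> n)"

lemma finite_A: "finite A"
  using substitution by (simp add: substitution_def)

lemma A_nonempty: "A \<noteq> {}"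
  using substitution by (auto simp: substitution_def)

lemma set_\<alpha>: "a \<in> A \<Longrightarrow> set (\<alpha> a) \<subseteq> A"
  using substitution by (auto simp: substitution_def)

lemma length_\<alpha>: "a \<in> A \<Longrightarrow> length (\<alpha> a) = L"
  using constant_length by (simp add: constant_length_def)

lemma set_pw_A: "a \<in> A \<Longrightarrow> set (pw \<alpha> n a) \<subseteq> A"
  by (rule set_pw) (use set_\<alpha> in auto)

lemma length_pw_A: "a \<in> A \<Longrightarrow> length (pw \<alpha> n a) = L ^ n"
  by (rule length_pw) (use set_\<alpha> length_\<alpha> in auto)

lemma Lpow_pos: "0 < L ^ n"
  using L_gt_1 by simp

lemma Lang_lists: "Lang \<subseteq> lists A"
proof
  fix w assume "w \<in> Lang"
  then obtain a n where "a \<in> A" "sublist w (pw \<alpha> n a)" by (auto simp: language_def pw_def)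
  then show "w \<in> lists A" using set_pw_A set_mono_sublist by fastforce
qed

lemma pw_Suc_in_Lang: "a \<in> A \<Longrightarrow> pw \<alpha> (Suc n) a \<in> Lang"
  unfolding language_def pw_def by force

lemma letter_in_all:
  assumes "a \<in> A"
  shows "\<exists>n>0. \<forall>b\<in>A. a \<in> set (pw \<alpha> n b)"
proof -
  obtain n where "n > 0" "\<And>b. b \<in> A \<Longrightarrow> A \<subseteq> set (pw \<alpha> n b)"
    using primitive unfolding primitive_subst_def pw_def by metis
  then show ?thesis using assms by (intro exI[of _ n]) auto
qed

lemma sublist_singleton: "a \<in> set w \<Longrightarrow> sublist [a] w"
  by (metis in_set_conv_decomp sublist_appendI append_Cons append_Nil)

text \<open>The language collects factors of powers with positive exponent. For exponent 0,
  primitivity makes the letter a factor of one of its own higher images.\<close>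

lemma pw_in_Lang: "a \<in> A \<Longrightarrow> pw \<alpha> n a \<in> Lang"
proof (cases n)
  case 0
  assume a: "a \<in> A"
  then obtain m where "m > 0" "a \<in> set (pw \<alpha> m a)" using letter_in_all by blast
  then have "sublist [a] (pw \<alpha> m a)" by (simp add: sublist_singleton)
  then show ?thesis
    using language_sublist[OF pw_Suc_in_Lang[OF a, of "m - 1"]] \<open>m > 0\<close> 0 by simp
qed (simp add: pw_Suc_in_Lang)

lemma LangE:
  assumes "w \<in> Lang"
  obtains a n where "a \<in> A" "n > 0" "sublist w (pw \<alpha> n a)"
proof -
  obtain a n where "a \<in> A" "1 \<le> n" "sublist w ((subst_word \<alpha> ^^ n) [a])"
    using assms unfolding language_def by blast
  then show ?thesis using that[of a n] by (simp add: pw_def)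
qed

lemma sublist_pw_Lang: "a \<in> A \<Longrightarrow> sublist w (pw \<alpha> n a) \<Longrightarrow> w \<in> Lang"
  using language_sublist pw_in_Lang by blast

lemma subst_word_in_Lang:
  assumes "w \<in> Lang"
  shows "subst_word (pw \<alpha> n) w \<in> Lang"
proof -
  obtain a m where a: "a \<in> A" "sublist w (pw \<alpha> m a)" using assms by (rule LangE)
  then have "sublist (subst_word (pw \<alpha> n) w) (pw \<alpha> (n + m) a)"
    unfolding pw_add by (intro sublist_subst_word)
  then show ?thesis using sublist_pw_Lang a by blast
qed

text \<open>Larger exponents are split as \<open>m + k + d\<close>: any letter \<open>c\<close> of
  \<open>pw \<alpha> d b\<close> will do, since \<open>pw \<alpha> k c\<close> contains
  \<open>a\<close> for every \<open>c\<close>, and \<open>pw \<alpha> m a\<close> contains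
  \<open>w\<close>.\<close>

lemma ex_uniform:
  assumes "w \<in> Lang"
  shows "\<exists>n0. \<forall>n\<ge>n0. \<forall>b\<in>A. sublist w (pw \<alpha> n b)"
proof -
  obtain a m where a: "a \<in> A" "sublist w (pw \<alpha> m a)" using assms by (rule LangE)
  obtain k where k: "\<And>b. b \<in> A \<Longrightarrow> a \<in> set (pw \<alpha> k b)" using letter_in_all[OF a(1)] by blast
  have "sublist w (pw \<alpha> n b)" if n: "n \<ge> m + k" and b: "b \<in> A" for n b
  proof -
    define d where "d = n - (m + k)"
    have "length (pw \<alpha> d b) = L ^ d" using b by (rule length_pw_A)
    then obtain c where c: "c \<in> set (pw \<alpha> d b)" using Lpow_pos[of d] by (cases "pw \<alpha> d b") auto
    then have "c \<in> A" using set_pw_A[OF b] by blast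
    have "n = m + (k + d)" using n by (simp add: d_def)
    then have "pw \<alpha> n b = subst_word (pw \<alpha> m) (subst_word (pw \<alpha> k) (pw \<alpha> d b))"
      by (simp add: pw_add)
    moreover have "sublist (pw \<alpha> k c) (subst_word (pw \<alpha> k) (pw \<alpha> d b))"
      using sublist_subst_word[OF sublist_singleton[OF c], of "pw \<alpha> k"] by simp
    moreover have "sublist [a] (pw \<alpha> k c)" using k \<open>c \<in> A\<close> by (simp add: sublist_singleton)
    ultimately have "sublist (subst_word (pw \<alpha> m) [a]) (pw \<alpha> n b)"
      by (metis sublist_subst_word sublist_trans)
    then show ?thesis using sublist_trans[OF a(2)] by simp
  qed
  then show ?thesis by blast
qed

text \<open>Desubstitution of a finite word to any depth \<open>n\<close>. The exponent at which
  \<open>u\<close> first occurs may be smaller than \<open>n\<close>, but by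
  \<open>ex_uniform\<close> it also occurs at an exponent beyond \<open>n\<close>.\<close>

lemma ex_cover_short:
  assumes "u \<in> Lang"
  shows "\<exists>v\<in>Lang. sublist u (subst_word (pw \<alpha> n) v)"
proof -
  obtain n0 where "\<forall>m\<ge>n0. \<forall>b\<in>A. sublist u (pw \<alpha> m b)" using ex_uniform[OF assms] by blast
  moreover obtain b where "b \<in> A" using A_nonempty by blast
  ultimately have "sublist u (pw \<alpha> (n + n0) b)" by simp
  then show ?thesis using pw_in_Lang[OF \<open>b \<in> A\<close>] by (auto simp: pw_add)
qed

text \<open>A word of length \<open>2 * L ^ n\<close> contains a whole block
  \<open>pw \<alpha> n a\<close>, and for suitable \<open>n\<close> each of these blocks contains
  \<open>w\<close>.\<close>

lemma uniform_recurrence: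
  assumes "w \<in> Lang"
  shows "\<exists>N. \<forall>u\<in>Lang. N \<le> length u \<longrightarrow> sublist w u"
proof -
  obtain n where n: "\<And>b. b \<in> A \<Longrightarrow> sublist w (pw \<alpha> n b)" using ex_uniform[OF assms] by blast
  have "sublist w u" if u: "u \<in> Lang" "2 * L ^ n \<le> length u" for u
  proof -
    obtain v where v: "v \<in> Lang" "sublist u (subst_word (pw \<alpha> n) v)" using ex_cover_short u by blast
    then have "set v \<subseteq> A" using Lang_lists by blast
    then obtain a where "a \<in> A" "sublist (pw \<alpha> n a) u"
      using sublist_block[OF v(2) _ Lpow_pos u(2)] length_pw_A by (metis subsetD)
    then show ?thesis using sublist_trans[OF n] by blast
  qed
  then show ?thesis by blast
qed

section \<open>Minimality of the subshift and desubstitution of its points\<close>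

lemma X_iff: "x \<in> X \<longleftrightarrow> (\<forall>i n. window x i n \<in> Lang)"
  using Lang_lists by (rule mem_subshift_iff)

lemma X_range: "x \<in> X \<Longrightarrow> x i \<in> A"
  by (auto simp: subshift_def)

lemma shiftn_X [simp]: "shiftn k x \<in> X \<longleftrightarrow> x \<in> X"
  unfolding X_iff by (metis diff_add_cancel window_shiftn)

lemma minimal:
  assumes "w \<in> Lang" "x \<in> X"
  shows "\<exists>i. window x i (length w) = w"
proof -
  obtain N where "\<forall>u\<in>Lang. N \<le> length u \<longrightarrow> sublist w u" using uniform_recurrence[OF assms(1)] by blast
  then have "sublist w (window x 0 N)" using assms(2) by (simp add: X_iff)
  then show ?thesis using sublist_windowD by metis
qed

lemma orbit_dense:
  assumes "x0 \<in> X" "x \<in> X"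
  shows "\<exists>m. \<forall>i. \<bar>i\<bar> \<le> int R \<longrightarrow> shiftn m x0 i = x i"
proof -
  have "window x (- int R) (2 * R + 1) \<in> Lang" using assms X_iff by blast
  then obtain m where m: "window x0 m (2 * R + 1) = window x (- int R) (2 * R + 1)"
    using minimal[of "window x (- int R) (2 * R + 1)" x0] assms by auto
  have "x0 (i + (m + int R)) = x i" if "\<bar>i\<bar> \<le> int R" for i
  proof -
    define j where "j = nat (i + int R)"
    have j: "int j = i + int R" "j < 2 * R + 1" using that unfolding j_def by auto
    show ?thesis using window_eqD[OF m j(2)] by (simp add: j(1) algebra_simps)
  qed
  then show ?thesis by (intro exI[of _ "m + int R"]) simp
qed

lemma S_shiftn: "S n (shiftn k y) = shiftn (int (L ^ n) * k) (S n y)"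
  unfolding S_def by (rule subst_pt_shiftn[OF Lpow_pos])

lemma window_S:
  assumes "\<And>j. x j \<in> A"
  shows "window (S n x) (int (L ^ n) * i) (L ^ n * m) = subst_word (pw \<alpha> n) (window x i m)"
  unfolding S_def by (rule window_subst_pt[OF Lpow_pos]) (simp add: length_pw_A assms)

lemma S_X:
  assumes "x \<in> X"
  shows "S n x \<in> X"
  unfolding X_iff
proof safe
  fix i m
  define M q where "M = L ^ n" and "q = i div int M"
  have "M > 0" by (use Lpow_pos in \<open>simp add: M_def\<close>)
  then have q: "int M * q \<le> i" "i < int M * q + int M"
    using mult_div_mod_eq[of "int M" i] pos_mod_bound[of "int M" i] pos_mod_sign[of "int M" i]
    unfolding q_def by linarith+
  have "m \<le> M * m" using \<open>M > 0\<close> by simp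
  then have "int m \<le> int (M * m)" by (simp only: of_nat_le_iff)
  moreover have "int (M * (m + 1)) = int (M * m) + int M" by simp
  ultimately have "i + int m \<le> int M * q + int (M * (m + 1))"
    using q(2) by linarith
  then have "sublist (window (S n x) i m) (window (S n x) (int M * q) (M * (m + 1)))"
    using q(1) by (intro sublist_window)
  moreover have "window (S n x) (int M * q) (M * (m + 1)) \<in> Lang"
    unfolding M_def window_S[OF X_range[OF assms]] using assms subst_word_in_Lang X_iff by blast
  ultimately show "window (S n x) i m \<in> Lang" using language_sublist by blast
qed

lemma S_add:
  assumes "\<And>j. x j \<in> A"
  shows "S m (S n x) = S (m + n) x"
proof -
  have "S m (S n x) = subst_pt (L ^ m * L ^ n) (\<lambda>a. subst_word (pw \<alpha> m) (pw \<alpha> n a)) x"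
    unfolding S_def using assms
    by (intro subst_pt_compose Lpow_pos) (auto simp: length_pw_A dest: set_pw_A[OF assms, THEN subsetD])
  also have "(\<lambda>a. subst_word (pw \<alpha> m) (pw \<alpha> n a)) = pw \<alpha> (m + n)"
    by (simp add: fun_eq_iff pw_add)
  finally show ?thesis by (simp add: S_def power_add)
qed

lemma S_1: "S (Suc 0) = subst_pt L \<alpha>"
  by (simp add: S_def)

text \<open>Injectivity on letters makes the local preimages agree, so that no compactness is needed.\<close>

lemma subst_pt_closed:
  fixes \<rho> :: "'a \<Rightarrow> 'a list"
  assumes M: "M > 0" and inj: "inj_on \<rho> A" and len: "\<And>a. a \<in> A \<Longrightarrow> length (\<rho> a) = M"
    and approx: "\<And>N. \<exists>y\<in>X. \<forall>i. \<bar>i\<bar> \<le> int N \<longrightarrow> z i = subst_pt M \<rho> y i"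
  shows "\<exists>y\<in>X. z = subst_pt M \<rho> y"
proof -
  obtain Y where Y: "\<And>N. Y N \<in> X" "\<And>N i. \<bar>i\<bar> \<le> int N \<Longrightarrow> z i = subst_pt M \<rho> (Y N) i"
    using approx by metis
  have letter: "\<rho> (Y N i) = window z (int M * i) M" if "int M * (\<bar>i\<bar> + 1) \<le> int N" for N i
  proof (rule nth_equalityI)
    fix j assume "j < length (\<rho> (Y N i))"
    then have j: "j < M" using len X_range Y(1) by metis
    have "\<bar>int M * i\<bar> = int M * \<bar>i\<bar>" by (simp add: abs_mult)
    then have "\<bar>int M * i + int j\<bar> \<le> int N" using that j by (simp add: distrib_left)
    then have "z (int M * i + int j) = \<rho> (Y N i) ! j" using Y(2) j by (simp add: subst_pt_app)
    then show "\<rho> (Y N i) ! j = window z (int M * i) M ! j" using j by simp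
  qed (simp add: len X_range[OF Y(1)])
  define b where "b i = nat (int M * (\<bar>i\<bar> + 1))" for i :: int
  define y where "y i = Y (b i) i" for i
  have Y_eq: "Y N i = y i" if "b i \<le> N" for N i
  proof -
    have "\<rho> (Y N i) = \<rho> (y i)"
      using letter[of i N] letter[of i "b i"] that unfolding y_def b_def by simp
    then show ?thesis using inj X_range[OF Y(1)] unfolding y_def by (meson inj_onD)
  qed
  have b_mono: "b i \<le> b j" if "\<bar>i\<bar> \<le> \<bar>j\<bar>" for i j
    unfolding b_def using that by (intro nat_mono mult_left_mono) auto
  have "window y i n \<in> Lang" for i n
  proof -
    have "window y i n = window (Y (b (\<bar>i\<bar> + int n))) i n"
      by (intro window_eqI Y_eq[symmetric] b_mono) auto
    then show ?thesis using Y(1) X_iff by metis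
  qed
  moreover have "z = subst_pt M \<rho> y"
  proof
    fix i
    define N where "N = nat \<bar>i\<bar> + b (i div int M)"
    have "z i = subst_pt M \<rho> (Y N) i" using Y(2) by (simp add: N_def)
    also have "\<dots> = subst_pt M \<rho> y i" using Y_eq[of "i div int M" N] by (simp add: subst_pt_def N_def)
    finally show "z i = subst_pt M \<rho> y i" .
  qed
  ultimately show ?thesis using X_iff by blast
qed

text \<open>By \<open>cover\<close> and minimality, each central window of \<open>x\<close> occurs
  in the image of one fixed point \<open>y0\<close>. The offset modulo \<open>M\<close> may depend
  on the window; but there are only \<open>M\<close> offsets, and one that works for a window works
  for all smaller ones, so some offset works for all, and \<open>subst_pt_closed\<close> passes to
  the limit. Here \<open>\<rho>\<close> is arbitrary because the identification of letters
  desubstitutes by words over a different alphabet.\<close>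

lemma ex_desubst:
  fixes \<rho> :: "'a \<Rightarrow> 'a list"
  assumes M: "M > 0" and inj: "inj_on \<rho> A" and len: "\<And>a. a \<in> A \<Longrightarrow> length (\<rho> a) = M"
    and "X \<noteq> {}"
    and cover: "\<And>i n. \<exists>v\<in>Lang. sublist (window x i n) (subst_word \<rho> v)"
  shows "\<exists>k<M. \<exists>y\<in>X. x = shiftn (int k) (subst_pt M \<rho> y)"
proof -
  define P where "P N k \<longleftrightarrow> (\<exists>y\<in>X. \<forall>i. \<bar>i\<bar> \<le> int N \<longrightarrow> x i = subst_pt M \<rho> y (i + int k))" for N k
  obtain y0 where y0: "y0 \<in> X" using \<open>X \<noteq> {}\<close> by blast
  have ex_P: "\<exists>k<M. P N k" for N
  proof -
    obtain v where v: "v \<in> Lang" "sublist (window x (- int N) (2 * N + 1)) (subst_word \<rho> v)"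
      using cover by blast
    obtain j where j: "window y0 j (length v) = v" using minimal[OF v(1) y0] by blast
    have "subst_word \<rho> v = window (subst_pt M \<rho> y0) (int M * j) (M * length v)"
      using window_subst_pt[of M \<rho> y0 j "length v"] M len X_range[OF y0] j by simp
    then obtain t where t: "window x (- int N) (2 * N + 1) =
        window (subst_pt M \<rho> y0) (int M * j + int t) (2 * N + 1)"
      using v(2) sublist_windowD by (metis length_window)
    define c where "c = int N + int M * j + int t"
    have x: "x i = subst_pt M \<rho> y0 (i + c)" if "\<bar>i\<bar> \<le> int N" for i
    proof -
      define l where "l = nat (i + int N)"
      have l: "int l = i + int N" "l < 2 * N + 1" using that unfolding l_def by auto
      show ?thesis using window_eqD[OF t l(2)] by (simp add: l(1) c_def algebra_simps)
    qed
    define k where "k = nat (c mod int M)"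
    have c: "c = int M * (c div int M) + int k" using M by (simp add: k_def)
    have "x i = subst_pt M \<rho> (shiftn (c div int M) y0) (i + int k)" if "\<bar>i\<bar> \<le> int N" for i
      unfolding subst_pt_shiftn[OF M] using x[OF that] c by (simp add: algebra_simps)
    then have "P N k" unfolding P_def using y0 by (intro bexI[of _ "shiftn (c div int M) y0"]) auto
    moreover have "k < M" using M by (simp add: k_def nat_less_iff)
    ultimately show ?thesis by blast
  qed
  have "\<exists>k<M. \<forall>N. P N k"
  proof (rule ccontr)
    assume "\<not> ?thesis"
    then obtain f where f: "\<And>k. k < M \<Longrightarrow> \<not> P (f k) k" by metis
    obtain k where k: "k < M" "P (Max (f ` {..<M})) k" using ex_P by blast
    then have "f k \<le> Max (f ` {..<M})" by simp
    then have "P (f k) k" using k(2) unfolding P_def by (meson of_nat_mono order_trans)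
    then show False using f k by blast
  qed
  then obtain k where k: "k < M" "\<And>N. P N k" by blast
  have "\<exists>y\<in>X. shiftn (- int k) x = subst_pt M \<rho> y"
  proof (rule subst_pt_closed[OF M inj len])
    fix N
    obtain y where y: "y \<in> X" "\<And>i. \<bar>i\<bar> \<le> int (N + M) \<Longrightarrow> x i = subst_pt M \<rho> y (i + int k)"
      using k(2)[of "N + M"] unfolding P_def by blast
    have "shiftn (- int k) x i = subst_pt M \<rho> y i" if "\<bar>i\<bar> \<le> int N" for i
      using y(2)[of "i - int k"] that k(1) by simp
    then show "\<exists>y\<in>X. \<forall>i. \<bar>i\<bar> \<le> int N \<longrightarrow> shiftn (- int k) x i = subst_pt M \<rho> y i"
      using y(1) by blast
  qed
  then obtain y where "y \<in> X" "shiftn (- int k) x = subst_pt M \<rho> y" by blast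
  moreover from this have "x = shiftn (int k) (subst_pt M \<rho> y)" by (metis add.right_inverse shiftn_0 shiftn_shiftn)
  ultimately show ?thesis using k(1) by blast
qed

end

section \<open>Recognizability\<close>

text \<open>Splitting off \<open>gcd c L > 1\<close> makes the divisor smaller and costs one factor
  \<open>L\<close>, so that at most \<open>c\<close> factors are spent. The point is an exponent
  that depends on \<open>c\<close> alone and not on \<open>n\<close>.\<close>

lemma dvd_power_bounded:
  fixes c L :: nat
  assumes "c dvd L ^ n" "c > 0"
  shows "c dvd L ^ c"
  using assms
proof (induction c rule: less_induct)
  case (less c)
  show ?case
  proof (cases "c = 1")
    case False
    define d where "d = gcd c L"
    have "d \<noteq> 1"
    proof
      assume "d = 1"
      then have "coprime c L" by (simp add: d_def coprime_iff_gcd_eq_1)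
      then have "coprime c (L ^ n)" by simp
      then show False using less.prems(1) False by (metis coprime_absorb_left nat_dvd_1_iff_1)
    qed
    moreover have "d > 0" using less.prems(2) by (simp add: d_def)
    ultimately have "d > 1" by simp
    obtain c' where c': "c = d * c'" unfolding d_def by (meson dvdE gcd_dvd1)
    then have "c' > 0" "c' < c" using \<open>d > 1\<close> less.prems(2) by auto
    moreover have "c' dvd L ^ n" using less.prems(1) c' dvd_mult_right by blast
    ultimately have "c' dvd L ^ c'" by (intro less.IH)
    also have "L ^ c' dvd L ^ (c - 1)" using \<open>c' < c\<close> by (intro le_imp_power_dvd) simp
    finally have "d * c' dvd L * L ^ (c - 1)" by (intro mult_dvd_mono) (simp_all add: d_def)
    then show ?thesis using c' less.prems(2) by (simp flip: power_Suc)
  qed simp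
qed

lemma int_subgroup_cyclic:
  fixes T :: "int set"
  assumes diff: "\<And>a b. a \<in> T \<Longrightarrow> b \<in> T \<Longrightarrow> a - b \<in> T" and c: "c \<in> T" "c > 0"
  shows "\<exists>g>0. \<forall>a. a \<in> T \<longleftrightarrow> int g dvd a"
proof -
  define g where "g = (LEAST g. g > 0 \<and> int g \<in> T)"
  have "nat c > 0 \<and> int (nat c) \<in> T" using c by simp
  then have g: "g > 0" "int g \<in> T" unfolding g_def by (metis (mono_tags, lifting) LeastI_ex)+
  have least: "g \<le> h" if "h > 0" "int h \<in> T" for h
    unfolding g_def using that by (simp add: Least_le)
  have 0: "0 \<in> T" using diff[OF c(1) c(1)] by simp
  have minus: "- a \<in> T" if "a \<in> T" for a using diff[OF 0 that] by simp
  have add: "a + b \<in> T" if "a \<in> T" "b \<in> T" for a b using diff[OF that(1) minus[OF that(2)]] by simp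
  have "int g * int k \<in> T" for k
    by (induction k) (simp_all add: 0 add g distrib_left)
  then have mult: "int g * k \<in> T" for k
    using minus by (cases k rule: int_cases2) fastforce+
  have "int g dvd a" if "a \<in> T" for a
  proof -
    have "a mod int g = a - int g * (a div int g)" by (simp add: minus_mult_div_eq_mod)
    then have "a mod int g \<in> T" using diff[OF that mult] by simp
    moreover have "0 \<le> a mod int g" "a mod int g < int g" using g(1) by simp_all
    ultimately have "a mod int g = 0"
      using least[of "nat (a mod int g)"] by (cases "a mod int g = 0") auto
    then show ?thesis by (simp add: dvd_eq_mod_eq_0)
  qed
  then show ?thesis using g(1) mult by (intro exI[of _ g]) (auto elim!: dvdE)
qed

context const_length_subst
begin

text \<open>By minimality any two letters at distance \<open>p\<close> in a point of
  \<open>X\<close> also occur at this distance in \<open>z\<close>. So all points have period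
  \<open>p\<close>, and a point is determined by \<open>p\<close> letters.\<close>

lemma finite_if_periodic:
  assumes "z \<in> X" "p > 0" "\<And>t. z (t + int p) = z t"
  shows "finite X"
proof -
  have per: "x (t + int p) = x t" if x: "x \<in> X" for x t
  proof -
    obtain i where i: "window z i (length (window x t (Suc p))) = window x t (Suc p)"
      using minimal[of "window x t (Suc p)" z] x assms(1) X_iff by blast
    then have "z (i + int j) = x (t + int j)" if "j < Suc p" for j
      using window_eqD[of z i "Suc p" x t j] that by simp
    from this[of 0] this[of p] show ?thesis using assms(3)[of i] by simp
  qed
  have "x \<in> (\<lambda>f i. f (nat (i mod int p))) ` (PiE {..<p} (\<lambda>_. A))" if x: "x \<in> X" for x
  proof
    have "x (t + int p * int k) = x t" for t k
    proof (induction k)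
      case (Suc k)
      then show ?case using per[OF x, of "t + int p * int k"] by (simp add: distrib_left add_ac)
    qed simp
    then have *: "x (t + int p * k) = x t" for t k
      by (cases k rule: int_cases2) (auto, metis add.commute diff_add_cancel uminus_add_conv_diff)
    have "x i = x (i mod int p)" for i
      using *[of "i mod int p" "i div int p"] by simp
    then show "x = (\<lambda>i. restrict (\<lambda>j. x (int j)) {..<p} (nat (i mod int p)))"
      using assms(2) by (auto simp: fun_eq_iff nat_less_iff)
    show "restrict (\<lambda>j. x (int j)) {..<p} \<in> PiE {..<p} (\<lambda>_. A)"
      using X_range[OF x] by auto
  qed
  then show ?thesis
    by (meson finite_surj finite_PiE finite_A finite_lessThan subsetI)
qed

end

locale injective_const_length_subst = const_length_subst +
  assumes inj_\<alpha>: "inj_on \<alpha> A"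
begin

lemma subst_word_inj:
  assumes "inj_on \<rho> A" "\<And>a. a \<in> A \<Longrightarrow> length (\<rho> a) = M" "u \<in> lists A" "w \<in> lists A" "length u = length w"
    "subst_word \<rho> u = subst_word \<rho> w"
  shows "u = w"
  using assms(5,3,4,6)
proof (induction u w rule: list_induct2)
  case (Cons a u b w)
  then have "\<rho> a = \<rho> b \<and> subst_word \<rho> u = subst_word \<rho> w"
    using assms(2) by (intro append_eq_append_conv[THEN iffD1]) auto
  then show ?case using Cons assms(1) by (auto dest: inj_onD)
qed simp

lemma inj_pw: "inj_on (pw \<alpha> n) A"
proof (induction n)
  case 0
  show ?case by (simp add: inj_on_def)
next
  case (Suc n)
  have "pw \<alpha> (Suc n) a = subst_word \<alpha> (pw \<alpha> n a)" for a by (simp add: pw_def)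
  moreover have "pw \<alpha> n a = pw \<alpha> n b"
    if "a \<in> A" "b \<in> A" "subst_word \<alpha> (pw \<alpha> n a) = subst_word \<alpha> (pw \<alpha> n b)" for a b
    by (rule subst_word_inj[OF inj_\<alpha> length_\<alpha> _ _ _ that(3)])
      (use set_pw_A[OF that(1), of n] set_pw_A[OF that(2), of n] that in \<open>auto simp: length_pw_A\<close>)
  ultimately show ?case using Suc by (simp add: inj_on_def)
qed

lemma subst_pt_inj:
  assumes "M > 0" "inj_on \<rho> A" "\<And>a. a \<in> A \<Longrightarrow> length (\<rho> a) = M" "x \<in> X" "y \<in> X"
    "subst_pt M \<rho> x = subst_pt M \<rho> y"
  shows "x = y"
proof
  fix i
  have "\<rho> (x i) = \<rho> (y i)"
  proof (rule nth_equalityI)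
    fix j assume "j < length (\<rho> (x i))"
    then have "j < M" using assms(3)[OF X_range[OF assms(4)]] by simp
    then show "\<rho> (x i) ! j = \<rho> (y i) ! j" using subst_pt_app[of j M \<rho> x i] subst_pt_app[of j M \<rho> y i] assms(6) by simp
  qed (simp add: assms X_range)
  then show "x i = y i" using inj_onD[OF assms(2)] X_range[OF assms(4)] X_range[OF assms(5)] by blast
qed

lemma S_inj: "x \<in> X \<Longrightarrow> y \<in> X \<Longrightarrow> S n x = S n y \<Longrightarrow> x = y"
  unfolding S_def by (rule subst_pt_inj[OF Lpow_pos inj_pw length_pw_A])

lemma S_desubst:
  assumes "x \<in> X"
  shows "\<exists>k<L ^ n. \<exists>y\<in>X. x = shiftn (int k) (S n y)"
  unfolding S_def
  by (rule ex_desubst[OF Lpow_pos inj_pw length_pw_A])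
    (use assms X_iff ex_cover_short in blast)+

lemma S_closed:
  assumes "\<And>N. \<exists>y\<in>X. \<forall>i. \<bar>i\<bar> \<le> int N \<longrightarrow> z i = S n y i"
  shows "\<exists>y\<in>X. z = S n y"
  unfolding S_def
  by (rule subst_pt_closed[OF Lpow_pos inj_pw length_pw_A assms[unfolded S_def]])

text \<open>The shifts that take some point of the n-fold image of \<open>X\<close> into this image
  again. By minimality "some" can be replaced by "every", which makes \<open>T n\<close> a group.
  Recognizability says that \<open>T 1\<close> consists of multiples of \<open>L\<close>.\<close>

definition T where "T n = {g. \<exists>x\<in>X. \<exists>y\<in>X. shiftn g (S n x) = S n y}"

text \<open>The relation between \<open>x0\<close> and \<open>y0\<close> carries over to all shifts
  of \<open>x0\<close>, because \<open>S n\<close> turns a shift by \<open>m\<close> into one by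
  \<open>L ^ n * m\<close>. The orbit of \<open>x0\<close> is dense and the image of
  \<open>S n\<close> is closed.\<close>

lemma T_all:
  assumes "g \<in> T n" "x \<in> X"
  shows "\<exists>y\<in>X. shiftn g (S n x) = S n y"
proof (rule S_closed)
  fix N
  obtain x0 y0 where x0: "x0 \<in> X" "y0 \<in> X" "shiftn g (S n x0) = S n y0"
    using assms(1) by (auto simp: T_def)
  define R where "R = N + nat \<bar>g\<bar>"
  obtain m where m: "\<And>i. \<bar>i\<bar> \<le> int R \<Longrightarrow> shiftn m x0 i = x i"
    using orbit_dense[OF x0(1) assms(2)] by blast
  have "shiftn g (S n x) i = S n (shiftn m y0) i" if "\<bar>i\<bar> \<le> int N" for i
  proof -
    have "\<bar>i + g\<bar> \<le> int R" using that by (simp add: R_def)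
    then have "S n x (i + g) = S n (shiftn m x0) (i + g)"
      unfolding S_def using m by (intro subst_pt_cong[OF _ _ Lpow_pos]) simp_all
    also have "\<dots> = shiftn (int (L ^ n) * m) (shiftn g (S n x0)) i"
      by (simp add: S_shiftn add_ac)
    also have "\<dots> = S n (shiftn m y0) i" by (simp only: x0 S_shiftn)
    finally show ?thesis by simp
  qed
  then show "\<exists>y\<in>X. \<forall>i. \<bar>i\<bar> \<le> int N \<longrightarrow> shiftn g (S n x) i = S n y i"
    using x0(2) by (intro bexI[of _ "shiftn m y0"]) auto
qed

lemma T_diff:
  assumes "a \<in> T n" "b \<in> T n"
  shows "a - b \<in> T n"
proof -
  obtain x y where x: "x \<in> X" "y \<in> X" "shiftn b (S n x) = S n y" using assms(2) by (auto simp: T_def)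
  obtain w where w: "w \<in> X" "shiftn a (S n x) = S n w" using T_all[OF assms(1) x(1)] by blast
  have "shiftn (a - b) (S n y) = shiftn a (S n x)" by (simp flip: x(3))
  then show ?thesis using x w by (auto simp: T_def)
qed

lemma Lpow_in_T: "X \<noteq> {} \<Longrightarrow> int (L ^ n) \<in> T n"
proof -
  assume "X \<noteq> {}"
  then obtain x where "x \<in> X" by blast
  moreover have "shiftn (int (L ^ n)) (S n x) = S n (shiftn 1 x)" by (simp add: S_shiftn)
  ultimately show ?thesis unfolding T_def by (metis (mono_tags, lifting) mem_Collect_eq shiftn_X)
qed

text \<open>Modulo \<open>L\<close>, the shift \<open>k\<close> survives at every level: it takes
  \<open>S (Suc n) x\<close> to \<open>S 1 y\<close>, and desubstituting \<open>y\<close> by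
  \<open>n\<close> levels changes the shift by a multiple of \<open>L\<close>.\<close>

lemma T_descend:
  assumes "k \<in> T 1" "X \<noteq> {}"
  shows "\<exists>j. k - int L * j \<in> T (Suc n)"
proof -
  obtain x where x: "x \<in> X" using assms(2) by blast
  have "S (Suc n) x = S 1 (S n x)" using S_add[OF X_range[OF x], of 1 n] by simp
  then obtain y where y: "y \<in> X" "shiftn k (S (Suc n) x) = S 1 y"
    using T_all[OF assms(1) S_X[OF x]] by metis
  obtain j w where w: "w \<in> X" "y = shiftn (int j) (S n w)" using S_desubst[OF y(1)] by blast
  have "S 1 y = shiftn (int L * int j) (S (Suc n) w)"
    using S_add[OF X_range[OF w(1)], of 1 n] S_shiftn[of 1 "int j" "S n w"] w(2) by simp
  have "shiftn (k - int L * int j) (S (Suc n) x) = shiftn (- (int L * int j)) (shiftn k (S (Suc n) x))"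
    by simp
  also have "\<dots> = S (Suc n) w"
    unfolding y(2) \<open>S 1 y = _\<close> by simp
  finally have "shiftn (k - int L * int j) (S (Suc n) x) = S (Suc n) w" .
  then show ?thesis using x w by (auto simp: T_def)
qed

text \<open>
  \<open>T n\<close> is a subgroup of the integers that contains \<open>L ^ n\<close>. If its index in the multiples
  of its generator stayed bounded, then \<open>L\<close> would divide the generator for large \<open>n\<close>, and
  hence \<open>k\<close>.
\<close>

lemma T_small_generator:
  assumes "k \<in> T 1" "\<not> int L dvd k" "X \<noteq> {}"
  shows "\<exists>n\<ge>C. \<exists>g>0. int g \<in> T n \<and> g * C < L ^ n"
proof -
  \<comment> \<open>Then \<open>L ^ n\<close> is \<open>L * L ^ C\<close>. An index \<open>c\<close>
    that is at most \<open>C\<close> divides \<open>L ^ C\<close>, and cancelling it leaves the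
    factor \<open>L\<close> in the generator.\<close>
  define n where "n = Suc C"
  obtain g where g: "g > 0" "\<And>a. a \<in> T n \<longleftrightarrow> int g dvd a"
    using int_subgroup_cyclic[of "T n" "int (L ^ n)"] T_diff Lpow_in_T[OF assms(3)] Lpow_pos by auto
  have "int g dvd int (L ^ n)" using g(2) Lpow_in_T[OF assms(3)] by blast
  then have "g dvd L ^ n" by (simp only: of_nat_dvd_iff)
  then obtain c where c: "L ^ n = g * c" by (elim dvdE)
  have "c > 0" using c Lpow_pos[of n] by (cases "c = 0") auto
  have "C < c"
  proof (rule ccontr)
    assume "\<not> C < c"
    have "c dvd L ^ c" using dvd_power_bounded[of c L n] c \<open>c > 0\<close> by simp
    also have "L ^ c dvd L ^ C" using \<open>\<not> C < c\<close> by (intro le_imp_power_dvd) simp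
    finally obtain h where "L ^ C = c * h" by (elim dvdE)
    then have "g * c = (L * h) * c" using c by (auto simp: n_def)
    then have "L dvd g" using \<open>c > 0\<close> by simp
    moreover obtain j where "k - int L * j \<in> T n" using T_descend[OF assms(1,3)] n_def by blast
    then have "int g dvd k - int L * j" using g(2) by blast
    ultimately have "int L dvd k - int L * j" by (meson dvd_trans of_nat_dvd_iff)
    then have "int L dvd k" by (metis dvd_diff_left_iff dvd_triv_left diff_add_cancel dvd_add)
    then show False using assms(2) by blast
  qed
  then have "g * C < L ^ n" using c g(1) by simp
  moreover have "int g \<in> T n" using g(2) by simp
  ultimately show ?thesis using g(1) unfolding n_def by (intro exI[of _ "Suc C"]) auto
qed

theorem recognizability:
  assumes "infinite X" "x \<in> X" "y \<in> X" "shiftn k (S 1 x) = S 1 y"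
  shows "int L dvd k"
proof (rule ccontr)
  assume ndvd: "\<not> int L dvd k"
  have "k \<in> T 1" using assms by (auto simp: T_def)
  have "X \<noteq> {}" using assms by blast
  \<comment> \<open>Two positions at a distance below \<open>L ^ m\<close> lie in the m-fold image
    of two adjacent letters, so that a period below \<open>L ^ m\<close> has to be verified only on
    images of words of \<open>W\<close>.\<close>
  define W where "W = {w \<in> Lang. length w = 2}"
  have "finite W"
    by (rule finite_subset[OF _ finite_lists_length_eq[OF finite_A, of 2]])
      (use Lang_lists in \<open>auto simp: W_def\<close>)
  obtain f where f: "\<And>w n b. w \<in> W \<Longrightarrow> n \<ge> f w \<Longrightarrow> b \<in> A \<Longrightarrow> sublist w (pw \<alpha> n b)"
    using ex_uniform unfolding W_def by (metis (mono_tags, lifting) mem_Collect_eq)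
  define r where "r = Max (f ` W)"
  have r: "sublist w (pw \<alpha> r b)" if "w \<in> W" "b \<in> A" for w b
    using f[OF that(1) _ that(2)] that(1) \<open>finite W\<close> by (simp add: r_def)
  \<comment> \<open>The factor \<open>card A\<close> pays for the pigeonhole, which yields a period
    of up to \<open>card A * g\<close>. The factor \<open>L ^ r\<close> pays for the descent from
    level \<open>n\<close> to level \<open>n - r\<close>.\<close>
  define C where "C = card A * L ^ r"
  obtain n g where n: "C \<le> n" "g > 0" "int g \<in> T n" "g * C < L ^ n"
    using T_small_generator[OF \<open>k \<in> T 1\<close> ndvd \<open>X \<noteq> {}\<close>] by blast
  define z where "z = S n x"
  \<comment> \<open>Thus a block of level \<open>n\<close> begins in \<open>z\<close> at every
    position \<open>i * g\<close>. Among the first \<open>card A + 1\<close> of these, two blocks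
    belong to the same letter, and they overlap with displacement \<open>p\<close>.\<close>
  have "\<exists>y\<in>X. shiftn (int (i * g)) z = S n y" for i
  proof (induction i)
    case 0
    then show ?case using assms(2) by (auto simp: z_def)
  next
    case (Suc i)
    then obtain y where y: "y \<in> X" "shiftn (int (i * g)) z = S n y" by blast
    then have "shiftn (int (Suc i * g)) z = shiftn (int g) (S n y)" by (simp flip: y(2))
    then show ?case using T_all[OF n(3) y(1)] by metis
  qed
  then obtain Y where Y: "\<And>i. Y i \<in> X" "\<And>i. shiftn (int (i * g)) z = S n (Y i)" by metis
  have occ: "z (int (i * g) + int t) = pw \<alpha> n (Y i 0) ! t" if "t < L ^ n" for i t
  proof -
    have "z (int (i * g) + int t) = S n (Y i) (int (L ^ n) * 0 + int t)"
      by (simp flip: Y(2) add: add.commute)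
    then show ?thesis unfolding S_def subst_pt_app[OF that] .
  qed
  have "\<not> inj_on (\<lambda>i. Y i 0) {..card A}"
  proof
    assume "inj_on (\<lambda>i. Y i 0) {..card A}"
    then have "card {..card A} \<le> card A"
      by (rule card_inj_on_le) (use finite_A Y(1) X_range in auto)
    then show False by simp
  qed
  then obtain i j where "i \<in> {..card A}" "j \<in> {..card A}" "i \<noteq> j" "Y i 0 = Y j 0"
    by (auto simp: inj_on_def)
  then obtain i j where ij: "i < j" "j \<le> card A" "Y i 0 = Y j 0"
    by (metis atMost_iff linorder_neqE_nat)
  define b p where "b = Y i 0" and "p = (j - i) * g"
  have "b \<in> A" using Y(1) X_range by (simp add: b_def)
  have "p > 0" using ij n(2) by (simp add: p_def)
  have per: "pw \<alpha> n b ! (t + p) = pw \<alpha> n b ! t" if "t + p < L ^ n" for t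
  proof -
    have "i * g + p = j * g" using ij(1) by (simp add: p_def flip: distrib_right)
    then have "int (i * g) + int (t + p) = int (j * g) + int t" by linarith
    moreover have "t < L ^ n" using that by simp
    ultimately show ?thesis
      using occ[OF that, of i] occ[of t j] ij(3) by (metis b_def)
  qed
  have "r < L ^ r" using L_gt_1 by (simp add: power_gt_expt)
  have "card A > 0" using A_nonempty finite_A by (simp add: card_gt_0_iff)
  then have "L ^ r \<le> C" by (simp add: C_def)
  define m where "m = n - r"
  have n_eq: "n = m + r" using n(1) \<open>r < L ^ r\<close> \<open>L ^ r \<le> C\<close> by (simp add: m_def)
  have "p * L ^ r \<le> g * C"
  proof -
    have "j - i \<le> card A" using ij by simp
    then have "p * L ^ r \<le> (card A * g) * L ^ r" unfolding p_def by (intro mult_le_mono) auto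
    then show ?thesis by (simp add: C_def algebra_simps)
  qed
  also have "g * C < L ^ m * L ^ r" using n(4) unfolding n_eq power_add .
  finally have "p * L ^ r < L ^ m * L ^ r" .
  then have pm: "p < L ^ m" by (metis mult_less_cancel2)
  \<comment> \<open>The block \<open>pw \<alpha> n b\<close> contains the m-fold image of every
    two-letter word, because \<open>pw \<alpha> r b\<close> contains the word itself. The period of
    the one block is thereby inherited by all these images.\<close>
  have per2: "subst_word (pw \<alpha> m) w ! (t + p) = subst_word (pw \<alpha> m) w ! t"
    if w: "w \<in> W" and t: "t + p < 2 * L ^ m" for w t
  proof -
    have "sublist (subst_word (pw \<alpha> m) w) (pw \<alpha> n b)"
      unfolding n_eq pw_add using r[OF w \<open>b \<in> A\<close>] by (rule sublist_subst_word)
    then obtain us vs where uv: "pw \<alpha> n b = us @ subst_word (pw \<alpha> m) w @ vs"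
      by (auto simp: sublist_def)
    have "w \<in> lists A" "length w = 2" using w Lang_lists by (auto simp: W_def)
    then have len: "length (subst_word (pw \<alpha> m) w) = 2 * L ^ m"
      using length_subst_word[of w "pw \<alpha> m" "L ^ m"] length_pw_A by auto
    have "length us + t + p < L ^ n"
      using t length_pw_A[OF \<open>b \<in> A\<close>, of n] unfolding uv by (simp add: len)
    then have "pw \<alpha> n b ! (length us + t + p) = pw \<alpha> n b ! (length us + t)" by (rule per)
    then show ?thesis using t unfolding uv by (simp add: nth_append len add.assoc)
  qed
  \<comment> \<open>Since \<open>p < L ^ m\<close>, the positions \<open>t\<close> and
    \<open>t + p\<close> lie in the same block of level \<open>m\<close> or in adjacent
    ones.\<close>
  have "S m x (t + int p) = S m x t" for t
  proof -
    define q where "q = t div int (L ^ m)"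
    define s where "s = nat (t mod int (L ^ m))"
    have M: "int (L ^ m) > 0" using Lpow_pos by simp
    have s: "s < L ^ m" using pos_mod_bound[OF M] pos_mod_sign[OF M] by (simp add: s_def nat_less_iff)
    have t: "t = int (L ^ m) * q + int s"
      using pos_mod_sign[OF M, of t] by (simp add: q_def s_def del: of_nat_power)
    define w where "w = window x q 2"
    have w: "w \<in> W" using assms(2) X_iff by (auto simp: W_def w_def)
    have sw: "window (S m x) (int (L ^ m) * q) (L ^ m * 2) = subst_word (pw \<alpha> m) w"
      unfolding w_def by (rule window_S[OF X_range[OF assms(2)]])
    have *: "S m x (int (L ^ m) * q + int e) = subst_word (pw \<alpha> m) w ! e" if "e < 2 * L ^ m" for e
      using that unfolding sw[symmetric] by (subst nth_window) simp_all
    have "t + int p = int (L ^ m) * q + int (s + p)" using t by simp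
    then show ?thesis
      using per2[OF w, of s] *[of "s + p"] *[of s] s pm t by (simp add: add.assoc)
  qed
  then show False using finite_if_periodic[OF S_X[OF assms(2)] \<open>p > 0\<close>] assms(1) by blast
qed

text \<open>Each level divides the shift by \<open>L\<close>. The letter identification
  desubstitutes \<open>N\<close> levels at once and relies on this form.\<close>

lemma recognizability_pow:
  assumes "infinite X" "x \<in> X" "y \<in> X" "shiftn k (S n x) = S n y"
  shows "int (L ^ n) dvd k"
  using assms(2-4)
proof (induction n arbitrary: k x y)
  case (Suc n)
  have S_Suc: "S (Suc n) w = S 1 (S n w)" if "w \<in> X" for w
    using S_add[OF X_range[OF that], of 1 n] by simp
  have eq: "shiftn k (S 1 (S n x)) = S 1 (S n y)" using Suc.prems by (simp only: S_Suc)
  then have "int L dvd k"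
    using recognizability[OF assms(1) S_X S_X] Suc.prems by blast
  then obtain l where l: "k = int L * l" by (elim dvdE)
  have "S 1 (shiftn l (S n x)) = S 1 (S n y)"
    unfolding S_shiftn using eq by (simp add: l)
  then have "shiftn l (S n x) = S n y"
    using S_inj[of "shiftn l (S n x)" "S n y" 1] S_X Suc.prems by simp
  then have "int (L ^ n) dvd l" using Suc.IH Suc.prems by blast
  then show ?case unfolding l by simp
qed simp

end

section \<open>Conjugacies as sliding block codes\<close>

definition conj_maps ::
  "(int \<Rightarrow> 'a) set \<Rightarrow> (int \<Rightarrow> 'b) set \<Rightarrow> ((int \<Rightarrow> 'a) \<Rightarrow> int \<Rightarrow> 'b) \<Rightarrow> ((int \<Rightarrow> 'b) \<Rightarrow> int \<Rightarrow> 'a) \<Rightarrow> bool" where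
  "conj_maps X Y F G \<longleftrightarrow> (\<forall>x\<in>X. F x \<in> Y \<and> G (F x) = x) \<and> (\<forall>y\<in>Y. G y \<in> X \<and> F (G y) = y) \<and>
     (\<forall>x\<in>X. \<forall>k. F (shiftn k x) = shiftn k (F x))"

text \<open>For maps that commute with the shift, a condition at position 0 governs all positions;
  see \<open>code_local\<close>.\<close>

definition has_radius :: "(int \<Rightarrow> 'a) set \<Rightarrow> ((int \<Rightarrow> 'a) \<Rightarrow> int \<Rightarrow> 'b) \<Rightarrow> nat \<Rightarrow> bool" where
  "has_radius X F r \<longleftrightarrow> (\<forall>x\<in>X. \<forall>y\<in>X. (\<forall>i. \<bar>i\<bar> \<le> int r \<longrightarrow> x i = y i) \<longrightarrow> F x 0 = F y 0)"

lemma conj_maps_shiftn_inv: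
  assumes "conj_maps X Y F G" "\<And>k x. x \<in> X \<Longrightarrow> shiftn k x \<in> X" "y \<in> Y"
  shows "G (shiftn k y) = shiftn k (G y)"
proof -
  have GF: "G (F x) = x" if "x \<in> X" for x using assms(1) that by (simp add: conj_maps_def)
  have G: "G y \<in> X" "F (G y) = y" using assms(1,3) by (simp_all add: conj_maps_def)
  then have "F (shiftn k (G y)) = shiftn k y" using assms(1) by (simp add: conj_maps_def)
  moreover have "G (F (shiftn k (G y))) = shiftn k (G y)"
    by (rule GF[OF assms(2)[OF G(1)]])
  ultimately show ?thesis by simp
qed

lemma has_radius_mono: "has_radius X F r \<Longrightarrow> r \<le> s \<Longrightarrow> has_radius X F s"
  unfolding has_radius_def by (meson of_nat_mono order_trans)

section \<open>Topology of subshifts; continuous maps and block codes\<close>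

abbreviation (input) full_topology :: "'a set \<Rightarrow> (int \<Rightarrow> 'a) topology" where
  "full_topology A \<equiv> product_topology (\<lambda>_. discrete_topology A) UNIV"

lemma topspace_subshift_topology [simp]: "topspace (subshift_topology A \<alpha>) = subshift A \<alpha>"
  by (auto simp: subshift_topology_def topspace_subtopology subshift_def)

lemma Hausdorff_subshift_topology: "Hausdorff_space (subshift_topology A \<alpha>)"
  unfolding subshift_topology_def
  by (intro Hausdorff_space_subtopology)
    (simp add: Hausdorff_space_product_topology Hausdorff_space_discrete_topology)

lemma openin_full_cylinder:
  assumes "range x \<subseteq> A"
  shows "openin (full_topology A) {y. range y \<subseteq> A \<and> (\<forall>i. \<bar>i\<bar> \<le> int N \<longrightarrow> y i = x i)}"
proof -
  let ?U = "\<lambda>i. if \<bar>i\<bar> \<le> int N then {x i} else A"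
  have "{i. ?U i \<noteq> A} \<subseteq> {- int N..int N}" by auto
  then have "finite {i. ?U i \<noteq> A}" by (rule finite_subset) simp
  then have "openin (full_topology A) (PiE UNIV ?U)"
    using assms by (subst openin_PiE_gen) auto
  moreover have "PiE UNIV ?U = {y. range y \<subseteq> A \<and> (\<forall>i. \<bar>i\<bar> \<le> int N \<longrightarrow> y i = x i)}"
  proof (intro set_eqI iffI)
    fix y assume "y \<in> PiE UNIV ?U"
    then have y: "y i \<in> ?U i" for i by blast
    have "y i \<in> A" for i using y[of i] assms by (auto split: if_splits)
    moreover have "y i = x i" if "\<bar>i\<bar> \<le> int N" for i using y[of i] that by simp
    ultimately show "y \<in> {y. range y \<subseteq> A \<and> (\<forall>i. \<bar>i\<bar> \<le> int N \<longrightarrow> y i = x i)}" by blast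
  qed auto
  ultimately show ?thesis by simp
qed

lemma full_nbhd:
  assumes "openin (full_topology A) U" "x \<in> U"
  shows "\<exists>N. \<forall>y. range y \<subseteq> A \<longrightarrow> (\<forall>i. \<bar>i\<bar> \<le> int N \<longrightarrow> y i = x i) \<longrightarrow> y \<in> U"
proof -
  obtain V where V: "finite {i. V i \<noteq> A}" "x \<in> PiE UNIV V" "PiE UNIV V \<subseteq> U"
    using assms unfolding openin_product_topology_alt by auto
  define N where "N = Max (insert 0 ((\<lambda>i. nat \<bar>i\<bar>) ` {i. V i \<noteq> A}))"
  have N: "\<bar>i\<bar> \<le> int N" if "V i \<noteq> A" for i
  proof -
    have "nat \<bar>i\<bar> \<le> N" unfolding N_def using V(1) that by (intro Max_ge) auto
    then show ?thesis by simp
  qed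
  have "y \<in> U" if y: "range y \<subseteq> A" "\<forall>i. \<bar>i\<bar> \<le> int N \<longrightarrow> y i = x i" for y
  proof -
    have "y i \<in> V i" for i
    proof (cases "V i = A")
      case False
      then have "y i = x i" using N y(2) by blast
      then show ?thesis using V(2) by auto
    qed (use y(1) in auto)
    then show ?thesis using V(3) by auto
  qed
  then show ?thesis by blast
qed

lemma subshift_range: "x \<in> subshift A \<alpha> \<Longrightarrow> range x \<subseteq> A"
  by (simp add: subshift_def)

lemma openin_cylinder:
  assumes "x \<in> subshift A \<alpha>"
  shows "openin (subshift_topology A \<alpha>) {y \<in> subshift A \<alpha>. \<forall>i. \<bar>i\<bar> \<le> int N \<longrightarrow> y i = x i}"
proof -
  have eq: "{y \<in> subshift A \<alpha>. \<forall>i. \<bar>i\<bar> \<le> int N \<longrightarrow> y i = x i} =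
      {y. range y \<subseteq> A \<and> (\<forall>i. \<bar>i\<bar> \<le> int N \<longrightarrow> y i = x i)} \<inter> subshift A \<alpha>"
    using subshift_range by blast
  show ?thesis
    unfolding eq subshift_topology_def
    by (rule openin_subtopology_Int[OF openin_full_cylinder[OF subshift_range[OF assms]]])
qed

lemma subshift_nbhd:
  assumes "openin (subshift_topology A \<alpha>) U" "x \<in> U"
  shows "\<exists>N. \<forall>y\<in>subshift A \<alpha>. (\<forall>i. \<bar>i\<bar> \<le> int N \<longrightarrow> y i = x i) \<longrightarrow> y \<in> U"
proof -
  obtain V where V: "openin (full_topology A) V" "U = V \<inter> subshift A \<alpha>"
    using assms(1) unfolding subshift_topology_def openin_subtopology by blast
  obtain N where "\<And>y. range y \<subseteq> A \<Longrightarrow> \<forall>i. \<bar>i\<bar> \<le> int N \<longrightarrow> y i = x i \<Longrightarrow> y \<in> V"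
    using full_nbhd[OF V(1), of x] assms(2) V(2) by blast
  then show ?thesis using V(2) subshift_range by blast
qed

lemma closedin_window_set:
  assumes "finite A"
  shows "closedin (full_topology A) {x. range x \<subseteq> A \<and> window x i n \<in> W}"
proof -
  have "openin (full_topology A) {x. range x \<subseteq> A \<and> window x i n \<notin> W}"
  proof (subst openin_subopen, intro ballI)
    fix x assume x: "x \<in> {x. range x \<subseteq> A \<and> window x i n \<notin> W}"
    define N where "N = nat \<bar>i\<bar> + n"
    have win: "window y i n = window x i n" if "\<forall>i. \<bar>i\<bar> \<le> int N \<longrightarrow> y i = x i" for y
    proof (rule window_eqI)
      fix j assume "j < n"
      then have "\<bar>i + int j\<bar> \<le> int N" by (simp add: N_def)
      then show "y (i + int j) = x (i + int j)" using that by blast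
    qed
    have "{y. range y \<subseteq> A \<and> (\<forall>i. \<bar>i\<bar> \<le> int N \<longrightarrow> y i = x i)} \<subseteq> {x. range x \<subseteq> A \<and> window x i n \<notin> W}"
    proof
      fix y assume "y \<in> {y. range y \<subseteq> A \<and> (\<forall>i. \<bar>i\<bar> \<le> int N \<longrightarrow> y i = x i)}"
      then have "range y \<subseteq> A" "window y i n = window x i n" using win[of y] by simp_all
      then show "y \<in> {x. range x \<subseteq> A \<and> window x i n \<notin> W}" using x by simp
    qed
    then show "\<exists>T. openin (full_topology A) T \<and> x \<in> T \<and> T \<subseteq> {x. range x \<subseteq> A \<and> window x i n \<notin> W}"
      using openin_full_cylinder[of x A N] x by blast
  qed
  moreover have "topspace (full_topology A) - {x. range x \<subseteq> A \<and> window x i n \<in> W} =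
      {x. range x \<subseteq> A \<and> window x i n \<notin> W}" by auto
  ultimately show ?thesis unfolding closedin_def by auto
qed

lemma compact_full_topology: "finite A \<Longrightarrow> compact_space (full_topology A)"
  by (simp add: compact_space_product_topology compact_space_discrete_topology)

lemma subshift_alt:
  "subshift A \<alpha> = (\<Inter>(i, n)\<in>UNIV. {x. range x \<subseteq> A \<and> window x i n \<in> language A \<alpha>})"
  by (auto simp: subshift_def window_def)

lemma compact_subshift_topology:
  assumes "finite A"
  shows "compact_space (subshift_topology A \<alpha>)"
proof -
  have "closedin (full_topology A) (subshift A \<alpha>)"
    unfolding subshift_alt by (rule closedin_INT) (auto intro: closedin_window_set[OF assms])
  then have "compactin (full_topology A) (subshift A \<alpha>)"
    using closedin_compact_space compact_full_topology[OF assms] by blast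
  then show ?thesis unfolding subshift_topology_def by (rule compact_space_subtopology)
qed

lemma continuous_map_if_radius:
  assumes "\<And>x. x \<in> subshift A \<alpha> \<Longrightarrow> F x \<in> subshift B \<beta>"
    "\<And>x k. x \<in> subshift A \<alpha> \<Longrightarrow> shiftn k x \<in> subshift A \<alpha>"
    "\<And>x k. x \<in> subshift A \<alpha> \<Longrightarrow> F (shiftn k x) = shiftn k (F x)" "has_radius (subshift A \<alpha>) F r"
  shows "continuous_map (subshift_topology A \<alpha>) (subshift_topology B \<beta>) F"
  unfolding continuous_map_def
proof (intro conjI allI impI)
  show "F \<in> topspace (subshift_topology A \<alpha>) \<rightarrow> topspace (subshift_topology B \<beta>)"
    using assms(1) by auto
  fix U assume U: "openin (subshift_topology B \<beta>) U"
  show "openin (subshift_topology A \<alpha>) {x \<in> topspace (subshift_topology A \<alpha>). F x \<in> U}"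
  proof (subst openin_subopen, intro ballI)
    fix x assume "x \<in> {x \<in> topspace (subshift_topology A \<alpha>). F x \<in> U}"
    then have x: "x \<in> subshift A \<alpha>" "F x \<in> U" by auto
    obtain N where N: "\<And>y. y \<in> subshift B \<beta> \<Longrightarrow> \<forall>i. \<bar>i\<bar> \<le> int N \<longrightarrow> y i = F x i \<Longrightarrow> y \<in> U"
      using subshift_nbhd[OF U x(2)] by blast
    let ?T = "{y \<in> subshift A \<alpha>. \<forall>i. \<bar>i\<bar> \<le> int (N + r) \<longrightarrow> y i = x i}"
    have "F y \<in> U" if "y \<in> ?T" for y
    proof (rule N)
      have y: "y \<in> subshift A \<alpha>" "\<And>i. \<bar>i\<bar> \<le> int (N + r) \<Longrightarrow> y i = x i" using that by auto
      show "F y \<in> subshift B \<beta>" using assms(1) y(1) .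
      have "F y i = F x i" if i: "\<bar>i\<bar> \<le> int N" for i
      proof -
        have "\<forall>j. \<bar>j\<bar> \<le> int r \<longrightarrow> shiftn i y j = shiftn i x j"
          using i by (auto intro: y(2))
        then have "F (shiftn i y) 0 = F (shiftn i x) 0"
          using assms(4) assms(2)[OF x(1)] assms(2)[OF y(1)] unfolding has_radius_def by blast
        then show ?thesis by (simp add: assms(3) x(1) y(1))
      qed
      then show "\<forall>i. \<bar>i\<bar> \<le> int N \<longrightarrow> F y i = F x i" by blast
    qed
    then show "\<exists>T. openin (subshift_topology A \<alpha>) T \<and> x \<in> T \<and>
        T \<subseteq> {x \<in> topspace (subshift_topology A \<alpha>). F x \<in> U}"
      using openin_cylinder[OF x(1), of "N + r"] x(1) by (intro exI[of _ ?T]) auto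
  qed
qed

text \<open>The Curtis-Hedlund-Lyndon theorem: continuity gives a radius at each point, and
  compactness makes finitely many of the corresponding cylinders, hence their largest radius,
  suffice.\<close>

lemma radius_if_continuous_map:
  assumes "finite A" "continuous_map (subshift_topology A \<alpha>) (subshift_topology B \<beta>) F"
  shows "\<exists>r. has_radius (subshift A \<alpha>) F r"
proof -
  let ?X = "subshift A \<alpha>"
  have FX: "F x \<in> subshift B \<beta>" if "x \<in> ?X" for x
    using assms(2) that by (auto simp: continuous_map_def)
  have "\<exists>N. \<forall>y\<in>?X. (\<forall>i. \<bar>i\<bar> \<le> int N \<longrightarrow> y i = x i) \<longrightarrow> F y 0 = F x 0" if x: "x \<in> ?X" for x
  proof -
    let ?V = "{y \<in> subshift B \<beta>. \<forall>i. \<bar>i\<bar> \<le> int 0 \<longrightarrow> y i = F x i}"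
    have "openin (subshift_topology A \<alpha>) {y \<in> topspace (subshift_topology A \<alpha>). F y \<in> ?V}"
      using assms(2) openin_cylinder[OF FX[OF x], of 0] unfolding continuous_map_def by blast
    moreover have "x \<in> {y \<in> topspace (subshift_topology A \<alpha>). F y \<in> ?V}" using x FX[OF x] by simp
    ultimately obtain N where
      "\<forall>y\<in>?X. (\<forall>i. \<bar>i\<bar> \<le> int N \<longrightarrow> y i = x i) \<longrightarrow> y \<in> {y \<in> topspace (subshift_topology A \<alpha>). F y \<in> ?V}"
      using subshift_nbhd by blast
    then show ?thesis by (intro exI[of _ N]) simp
  qed
  then obtain N where N: "\<And>x y. x \<in> ?X \<Longrightarrow> y \<in> ?X \<Longrightarrow> \<forall>i. \<bar>i\<bar> \<le> int (N x) \<longrightarrow> y i = x i \<Longrightarrow> F y 0 = F x 0"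
    by metis
  define C where "C x = {y \<in> ?X. \<forall>i. \<bar>i\<bar> \<le> int (N x) \<longrightarrow> y i = x i}" for x
  have "\<exists>\<F>. finite \<F> \<and> \<F> \<subseteq> C ` ?X \<and> topspace (subshift_topology A \<alpha>) \<subseteq> \<Union>\<F>"
    using compact_subshift_topology[OF assms(1), of \<alpha>] openin_cylinder
    unfolding compact_space_alt by (elim allE[of _ "C ` ?X"]) (auto simp: C_def)
  then obtain K where K: "finite K" "K \<subseteq> ?X" "?X \<subseteq> (\<Union>x\<in>K. C x)"
    by (metis finite_subset_image topspace_subshift_topology)
  define r where "r = Max (insert 0 (N ` K))"
  have "F x 0 = F y 0" if x: "x \<in> ?X" and y: "y \<in> ?X" and eq: "\<forall>i. \<bar>i\<bar> \<le> int r \<longrightarrow> x i = y i" for x y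
  proof -
    obtain c where c: "c \<in> K" "x \<in> C c" using K(3) x by blast
    have "N c \<le> r" unfolding r_def using K(1) c(1) by (intro Max_ge) auto
    then have "y \<in> C c" using c(2) y eq unfolding C_def by auto
    then show ?thesis using N[of c x] N[of c y] c K(2) x y unfolding C_def by auto
  qed
  then show ?thesis unfolding has_radius_def by blast
qed

context const_length_subst
begin

text \<open>Compactness: legal words of odd length, continued by an arbitrary letter, show that the
  closed sets \<open>W n\<close> are nonempty, and these decrease with \<open>n\<close>.\<close>

lemma X_nonempty: "X \<noteq> {}"
proof -
  obtain a where a: "a \<in> A" using A_nonempty by blast
  define W where "W n = {x. range x \<subseteq> A \<and> window x (- int n) (2 * n + 1) \<in> Lang}" for n
  have W_ne: "W n \<noteq> {}" for n
  proof -
    obtain m where m: "2 * n + 1 < L ^ m" using power_gt_expt[OF L_gt_1[unfolded One_nat_def]] by blast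
    define w where "w = take (2 * n + 1) (pw \<alpha> m a)"
    have w: "length w = 2 * n + 1" using m length_pw_A[OF a] by (simp add: w_def)
    have "w \<in> Lang" unfolding w_def by (rule language_sublist[OF pw_in_Lang[OF a]]) (rule sublist_take)
    define x where "x i = (if \<bar>i\<bar> \<le> int n then w ! nat (i + int n) else a)" for i
    have "window x (- int n) (2 * n + 1) = w"
      by (rule nth_equalityI) (auto simp: w x_def)
    moreover have "w ! j \<in> A" if "j < 2 * n + 1" for j
      using that \<open>w \<in> Lang\<close> Lang_lists w by (metis in_listsD nth_mem subsetD)
    then have "range x \<subseteq> A" using a by (auto simp: x_def)
    ultimately show ?thesis using \<open>w \<in> Lang\<close> by (auto simp: W_def)
  qed
  have W_mono: "W n \<subseteq> W m" if "m \<le> n" for m n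
  proof -
    have "sublist (window x (- int m) (2 * m + 1)) (window x (- int n) (2 * n + 1))" for x :: "int \<Rightarrow> 'a"
      using that by (intro sublist_window) auto
    then show ?thesis unfolding W_def using language_sublist by blast
  qed
  have "(\<Inter>n. W n) \<noteq> {}"
  proof (rule compact_space_imp_nest[OF compact_full_topology[OF finite_A]])
    show "closedin (full_topology A) (W n)" for n
      unfolding W_def by (rule closedin_window_set[OF finite_A])
    show "decseq W" using W_mono by (simp add: decseq_def)
  qed (rule W_ne)
  then obtain x where x: "\<And>n. x \<in> W n" by blast
  have "window x i n \<in> Lang" for i n
  proof -
    define N where "N = nat \<bar>i\<bar> + n"
    have "sublist (window x i n) (window x (- int N) (2 * N + 1))"
      by (rule sublist_window) (auto simp: N_def)
    then show ?thesis using x[of N] language_sublist unfolding W_def by blast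
  qed
  then show ?thesis using X_iff by blast
qed

lemma conjugate_imp_conj_maps:
  assumes "finite B" "conjugate A \<alpha> B \<beta>"
  shows "\<exists>F G r. conj_maps X (subshift B \<beta>) F G \<and> has_radius X F r \<and> has_radius (subshift B \<beta>) G r"
proof -
  let ?TA = "subshift_topology A \<alpha>" and ?TB = "subshift_topology B \<beta>"
  obtain F where F: "homeomorphic_map ?TA ?TB F" "\<And>x. x \<in> X \<Longrightarrow> F (shiftn 1 x) = shiftn 1 (F x)"
    using assms(2) unfolding conjugate_def shift_conv_shiftn by blast
  then obtain G where FG: "homeomorphic_maps ?TA ?TB F G" unfolding homeomorphic_map_maps by blast
  then have cont: "continuous_map ?TA ?TB F" "continuous_map ?TB ?TA G"
    and inv: "\<And>x. x \<in> X \<Longrightarrow> G (F x) = x" "\<And>y. y \<in> subshift B \<beta> \<Longrightarrow> F (G y) = y"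
    by (auto simp: homeomorphic_maps_def)
  have shift_nat: "F (shiftn (int k) x) = shiftn (int k) (F x)" if "x \<in> X" for x k
  proof (induction k)
    case (Suc k)
    have "F (shiftn (int (Suc k)) x) = F (shiftn 1 (shiftn (int k) x))" by simp
    also have "\<dots> = shiftn 1 (F (shiftn (int k) x))" using that by (intro F(2)) simp
    also have "\<dots> = shiftn 1 (shiftn (int k) (F x))" by (simp only: Suc)
    finally show ?case by (simp only: shiftn_shiftn of_nat_Suc)
  qed simp
  have "F (shiftn k x) = shiftn k (F x)" if x: "x \<in> X" for x k
  proof (cases k rule: int_cases2)
    case (nonneg n)
    then show ?thesis using shift_nat[OF x] by simp
  next
    case (nonpos n)
    have "F x = shiftn (int n) (F (shiftn k x))"
      using shift_nat[of "shiftn k x" n] x by (simp add: nonpos)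
    then have "shiftn k (F x) = shiftn k (shiftn (int n) (F (shiftn k x)))" by simp
    then show ?thesis by (simp add: nonpos)
  qed
  then have "conj_maps X (subshift B \<beta>) F G"
    using cont inv unfolding conj_maps_def by (auto simp: continuous_map_def)
  moreover obtain r where "has_radius X F r" using radius_if_continuous_map[OF finite_A cont(1)] by blast
  moreover obtain s where "has_radius (subshift B \<beta>) G s" using radius_if_continuous_map[OF assms(1) cont(2)] by blast
  ultimately show ?thesis by (meson has_radius_mono max.cobounded1 max.cobounded2)
qed

text \<open>The image of a compact set is closed, and it contains a dense orbit.\<close>

lemma conjugate_if_injective_code:
  assumes "finite B" "subshift B \<beta> \<noteq> {}" "\<And>k x. x \<in> subshift B \<beta> \<Longrightarrow> shiftn k x \<in> subshift B \<beta>"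
    and F: "\<And>x. x \<in> subshift B \<beta> \<Longrightarrow> F x \<in> X" "\<And>x k. x \<in> subshift B \<beta> \<Longrightarrow> F (shiftn k x) = shiftn k (F x)"
    "has_radius (subshift B \<beta>) F r" "inj_on F (subshift B \<beta>)"
  shows "conjugate B \<beta> A \<alpha>"
proof -
  let ?TA = "subshift_topology A \<alpha>" and ?TB = "subshift_topology B \<beta>"
  have cont: "continuous_map ?TB ?TA F"
    using F(1) assms(3) F(2,3) by (rule continuous_map_if_radius)
  have compact: "compact_space ?TB" using assms(1) by (rule compact_subshift_topology)
  have "compactin ?TA (F ` subshift B \<beta>)"
    using image_compactin[OF _ cont] compact by (simp add: compact_space_def)
  then have closed: "closedin ?TA (F ` subshift B \<beta>)"
    using compactin_imp_closedin Hausdorff_subshift_topology by blast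
  have "z \<in> F ` subshift B \<beta>" if z: "z \<in> X" for z
  proof (rule ccontr)
    assume "z \<notin> F ` subshift B \<beta>"
    moreover have "openin ?TA (X - F ` subshift B \<beta>)"
      using closed by (metis closedin_def topspace_subshift_topology)
    ultimately obtain N where
      N: "\<forall>y\<in>X. (\<forall>i. \<bar>i\<bar> \<le> int N \<longrightarrow> y i = z i) \<longrightarrow> y \<in> X - F ` subshift B \<beta>"
      using subshift_nbhd[of A \<alpha> "X - F ` subshift B \<beta>" z] z by blast
    obtain x where x: "x \<in> subshift B \<beta>" using assms(2) by blast
    obtain m where "\<forall>i. \<bar>i\<bar> \<le> int N \<longrightarrow> shiftn m (F x) i = z i"
      using orbit_dense[OF F(1)[OF x] z] by blast
    then have "shiftn m (F x) \<in> X - F ` subshift B \<beta>" using N F(1)[OF x] by simp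
    then show False using F(2)[OF x, of m] assms(3)[OF x, of m] by (metis DiffE image_eqI)
  qed
  then have "F ` topspace ?TB = topspace ?TA" using F(1) by auto
  then have "homeomorphic_map ?TB ?TA F"
    using continuous_imp_homeomorphic_map[OF cont compact Hausdorff_subshift_topology] F(4) by simp
  then show ?thesis unfolding conjugate_def shift_conv_shiftn using F(2) by blast
qed

end

lemma conjugate_sym:
  assumes "conjugate A \<alpha> B \<beta>" "\<And>x. x \<in> subshift A \<alpha> \<Longrightarrow> shift x \<in> subshift A \<alpha>"
  shows "conjugate B \<beta> A \<alpha>"
proof -
  let ?TA = "subshift_topology A \<alpha>" and ?TB = "subshift_topology B \<beta>"
  obtain F where F: "homeomorphic_map ?TA ?TB F" "\<And>x. x \<in> subshift A \<alpha> \<Longrightarrow> F (shift x) = shift (F x)"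
    using assms unfolding conjugate_def by blast
  then obtain G where FG: "homeomorphic_maps ?TA ?TB F G" unfolding homeomorphic_map_maps by blast
  then have "homeomorphic_map ?TB ?TA G" by (metis homeomorphic_maps_map)
  moreover have "G (shift y) = shift (G y)" if y: "y \<in> subshift B \<beta>" for y
  proof -
    have inv: "\<And>x. x \<in> subshift A \<alpha> \<Longrightarrow> G (F x) = x" "F (G y) = y" "G y \<in> subshift A \<alpha>"
      using FG y by (auto simp: homeomorphic_maps_def continuous_map_def)
    then show ?thesis by (metis F(2) assms(2))
  qed
  ultimately show ?thesis unfolding conjugate_def by blast
qed

lemma conjugate_trans:
  assumes "conjugate A \<alpha> B \<beta>" "conjugate B \<beta> C \<gamma>"
  shows "conjugate A \<alpha> C \<gamma>"
proof -
  obtain F where F: "homeomorphic_map (subshift_topology A \<alpha>) (subshift_topology B \<beta>) F"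
    "\<And>x. x \<in> subshift A \<alpha> \<Longrightarrow> F (shift x) = shift (F x)" using assms(1) unfolding conjugate_def by blast
  obtain G where G: "homeomorphic_map (subshift_topology B \<beta>) (subshift_topology C \<gamma>) G"
    "\<And>x. x \<in> subshift B \<beta> \<Longrightarrow> G (shift x) = shift (G x)" using assms(2) unfolding conjugate_def by blast
  have "F ` subshift A \<alpha> = subshift B \<beta>"
    using homeomorphic_imp_surjective_map[OF F(1)] by simp
  then have "(G \<circ> F) (shift x) = shift ((G \<circ> F) x)" if "x \<in> subshift A \<alpha>" for x
    using that F(2) G(2) by auto
  then show ?thesis unfolding conjugate_def using homeomorphic_map_compose[OF F(1) G(1)] by blast
qed

section \<open>Desubstituting a conjugacy\<close>

lemma code_local:
  assumes "has_radius X F r" "\<And>k x. x \<in> X \<Longrightarrow> shiftn k x \<in> X"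
    "\<And>k x. x \<in> X \<Longrightarrow> F (shiftn k x) = shiftn k (F x)" "x \<in> X" "y \<in> X"
    "\<And>j. i - int r \<le> j \<Longrightarrow> j \<le> i + int r \<Longrightarrow> x j = y j"
  shows "F x i = F y i"
proof -
  have "\<forall>j. \<bar>j\<bar> \<le> int r \<longrightarrow> shiftn i x j = shiftn i y j" using assms(6) by auto
  then have "F (shiftn i x) 0 = F (shiftn i y) 0"
    using assms(1) assms(2)[OF assms(4)] assms(2)[OF assms(5)] unfolding has_radius_def by blast
  then show ?thesis by (simp add: assms(3-5))
qed

text \<open>The letter \<open>F' x 0\<close> is determined by the \<open>L\<close> letters of
  \<open>F (subst_pt L \<alpha> x)\<close> at the positions \<open>t + k\<close> with
  \<open>0 \<le> t < L\<close>. These lie between \<open>1 - L\<close> and \<open>2 * L - 2\<close>,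
  so that the image of \<open>x\<close> is read between \<open>1 - L - s\<close> and
  \<open>2 * L - 2 + s\<close>. Dividing these bounds by \<open>L\<close> gives minus and plus the
  same number, the new radius. Both signs of \<open>k\<close> are allowed, since a conjugacy and its
  inverse are shifted in opposite directions.\<close>

lemma radius_step:
  assumes L: "L > 1" and X: "\<And>k x. x \<in> X \<Longrightarrow> shiftn k x \<in> X" "\<And>x. x \<in> X \<Longrightarrow> subst_pt L \<alpha> x \<in> X"
    and F: "\<And>k x. x \<in> X \<Longrightarrow> F (shiftn k x) = shiftn k (F x)" "has_radius X F s"
    and k: "\<bar>k\<bar> < int L"
    and F': "\<And>x. x \<in> X \<Longrightarrow> subst_pt L \<beta> (F' x) = shiftn k (F (subst_pt L \<alpha> x))"
    and \<beta>: "inj_on \<beta> B" "\<And>b. b \<in> B \<Longrightarrow> length (\<beta> b) = L" "\<And>x. x \<in> X \<Longrightarrow> F' x 0 \<in> B"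
  shows "has_radius X F' ((s + 2 * L - 2) div L)"
  unfolding has_radius_def
proof (intro ballI impI)
  fix x y assume x: "x \<in> X" and y: "y \<in> X"
  define s' where "s' = (s + 2 * L - 2) div L"
  assume eq: "\<forall>i. \<bar>i\<bar> \<le> int ((s + 2 * L - 2) div L) \<longrightarrow> x i = y i"
  have "s + 2 * L - 2 = L * s' + (s + 2 * L - 2) mod L" by (simp add: s'_def)
  moreover have "(s + 2 * L - 2) mod L < L" using L by simp
  ultimately have s': "s + L \<le> L * s' + 1" "s + 2 * L - 2 < L * s' + L" using L by linarith+
  have agree: "subst_pt L \<alpha> x j = subst_pt L \<alpha> y j" if j: "1 - int L - int s \<le> j" "j \<le> 2 * int L - 2 + int s" for j
  proof -
    define q where "q = j div int L"
    have q: "int L * q \<le> j" "j < int L * (q + 1)"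
      using L mult_div_mod_eq[of "int L" j] pos_mod_bound[of "int L" j] pos_mod_sign[of "int L" j]
        distrib_left[of "int L" q 1] unfolding q_def by linarith+
    have "int (s + L) \<le> int (L * s' + 1)" "int (s + 2 * L) < int (L * s' + L + 2)"
      using s' L by linarith+
    then have s'_int: "int s + int L \<le> int L * int s' + 1" "int s + 2 * int L < int L * (int s' + 1) + 2"
      by (simp_all add: distrib_left)
    have "int L * q < int L * (int s' + 1)" using q(1) j(2) s'_int(2) by linarith
    then have 1: "q \<le> int s'" using L by simp
    have "int L * (- int s') \<le> j" using j(1) s'_int(1) by simp
    then have "int L * (- int s') < int L * (q + 1)" using q(2) by linarith
    then have 2: "- int s' \<le> q" using L by (simp only: mult_less_cancel_left) auto
    show ?thesis using eq 1 2 by (simp add: subst_pt_def s'_def q_def)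
  qed
  have "\<beta> (F' x 0) = \<beta> (F' y 0)"
  proof (rule nth_equalityI)
    fix t assume "t < length (\<beta> (F' x 0))"
    then have t: "t < L" using \<beta> x by simp
    have *: "\<beta> (F' w 0) ! t = F (subst_pt L \<alpha> w) (int t + k)" if w: "w \<in> X" for w
    proof -
      have "\<beta> (F' w 0) ! t = subst_pt L \<beta> (F' w) (int t)"
        using subst_pt_app[OF t, of \<beta> "F' w" 0] by simp
      then show ?thesis by (simp add: F'[OF w])
    qed
    have "F (subst_pt L \<alpha> x) (int t + k) = F (subst_pt L \<alpha> y) (int t + k)"
      by (rule code_local[OF F(2) X(1) F(1) X(2)[OF x] X(2)[OF y]]) (use t k in \<open>auto intro: agree\<close>)
    then show "\<beta> (F' x 0) ! t = \<beta> (F' y 0) ! t" by (simp add: * x y)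
  qed (simp add: \<beta> x y)
  then show "F' x 0 = F' y 0" using \<beta>(1,3) x y by (meson inj_onD)
qed

locale two_substs = A: injective_const_length_subst A \<alpha> L + B: injective_const_length_subst B \<beta> L
  for A :: "'a set" and \<alpha> L and B :: "'b set" and \<beta> +
  assumes infinite_BX: "infinite (subshift B \<beta>)"
begin

text \<open>The offset of a single point is the offset of all. As in \<open>T_all\<close>, it
  carries over to the orbit, since shifting \<open>x0\<close> by \<open>m\<close> shifts its image
  by a multiple of \<open>L\<close>, and then to all points, since the image of \<open>B.S 1\<close>
  is closed.\<close>

lemma ex_offset:
  assumes conj: "conj_maps A.X B.X F G" "has_radius A.X F r"
  shows "\<exists>k<L. \<forall>x\<in>A.X. \<exists>y\<in>B.X. B.S 1 y = shiftn (- int k) (F (A.S 1 x))"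
proof -
  have FX: "F x \<in> B.X" if "x \<in> A.X" for x using conj(1) that by (simp add: conj_maps_def)
  have Fsh: "F (shiftn k x) = shiftn k (F x)" if "x \<in> A.X" for x k
    using conj(1) that by (simp add: conj_maps_def)
  obtain x0 where x0: "x0 \<in> A.X" using A.X_nonempty by blast
  obtain k y0 where k: "k < L" "y0 \<in> B.X" "F (A.S 1 x0) = shiftn (int k) (B.S 1 y0)"
    using B.S_desubst[OF FX[OF A.S_X[OF x0]], where n = 1] unfolding power_one_right by blast
  have "\<exists>y\<in>B.X. shiftn (- int k) (F (A.S 1 x)) = B.S 1 y" if x: "x \<in> A.X" for x
  proof (rule B.S_closed)
    fix N
    define R where "R = N + k + r"
    obtain m where m: "\<And>i. \<bar>i\<bar> \<le> int R \<Longrightarrow> shiftn m x0 i = x i"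
      using A.orbit_dense[OF x0 x] by blast
    have "shiftn (- int k) (F (A.S 1 x)) i = B.S 1 (shiftn m y0) i" if i: "\<bar>i\<bar> \<le> int N" for i
    proof -
      have "F (A.S 1 x) (i - int k) = F (A.S 1 (shiftn m x0)) (i - int k)"
      proof (rule code_local[OF conj(2) _ Fsh])
        fix j assume j: "i - int k - int r \<le> j" "j \<le> i - int k + int r"
        have "\<bar>j\<bar> \<le> int R" using i j by (simp add: R_def)
        then show "A.S 1 x j = A.S 1 (shiftn m x0) j"
          unfolding A.S_def using m by (intro subst_pt_cong[OF _ _ A.Lpow_pos]) simp_all
      qed (use x x0 A.S_X in auto)
      also have "A.S 1 (shiftn m x0) = shiftn (int (L ^ 1) * m) (A.S 1 x0)" by (rule A.S_shiftn)
      also have "F \<dots> = shiftn (int (L ^ 1) * m) (shiftn (int k) (B.S 1 y0))"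
        unfolding Fsh[OF A.S_X[OF x0]] k(3) ..
      also have "\<dots> (i - int k) = B.S 1 (shiftn m y0) i"
        unfolding B.S_shiftn by simp
      finally show ?thesis by simp
    qed
    then show "\<exists>y\<in>B.X. \<forall>i. \<bar>i\<bar> \<le> int N \<longrightarrow> shiftn (- int k) (F (A.S 1 x)) i = B.S 1 y i"
      using k(2) by (intro bexI[of _ "shiftn m y0"]) auto
  qed
  then show ?thesis using k(1) by metis
qed

lemma desubst_conjugacy:
  assumes conj: "conj_maps A.X B.X F G" "has_radius A.X F s" "has_radius B.X G s"
  shows "\<exists>F' G' k. k < L \<and> conj_maps A.X B.X F' G' \<and>
    (\<forall>x\<in>A.X. B.S 1 (F' x) = shiftn (- int k) (F (A.S 1 x))) \<and>
    has_radius A.X F' ((s + 2 * L - 2) div L) \<and> has_radius B.X G' ((s + 2 * L - 2) div L)"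
proof -
  have F: "F x \<in> B.X" "G (F x) = x" "F (shiftn k x) = shiftn k (F x)" if "x \<in> A.X" for x k
    using conj(1) that by (simp_all add: conj_maps_def)
  have G: "G y \<in> A.X" "F (G y) = y" "G (shiftn k y) = shiftn k (G y)" if "y \<in> B.X" for y k
    using conj(1) that conj_maps_shiftn_inv[OF conj(1) _ that] by (simp_all add: conj_maps_def)
  obtain k where k: "k < L" "\<And>x. x \<in> A.X \<Longrightarrow> \<exists>y\<in>B.X. B.S 1 y = shiftn (- int k) (F (A.S 1 x))"
    using ex_offset[OF conj(1,2)] by blast
  obtain F' where F': "\<And>x. x \<in> A.X \<Longrightarrow> F' x \<in> B.X"
    "\<And>x. x \<in> A.X \<Longrightarrow> B.S 1 (F' x) = shiftn (- int k) (F (A.S 1 x))"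
    using k(2) by metis
  have SA: "A.S 1 x \<in> A.X" if "x \<in> A.X" for x using that by (rule A.S_X)
  have SB: "B.S 1 y \<in> B.X" if "y \<in> B.X" for y using that by (rule B.S_X)
  \<comment> \<open>The inverse has exactly the opposite offset. A further offset \<open>j\<close>
    of this point would, after applying \<open>F\<close>, be a shift by \<open>j\<close> between two
    points of the image of \<open>B.S 1\<close>, so that recognizability forces
    \<open>j = 0\<close>.\<close>
  have "\<exists>x\<in>A.X. A.S 1 x = shiftn (int k) (G (B.S 1 y))" if y: "y \<in> B.X" for y
  proof -
    define x' where "x' = shiftn (int k) (G (B.S 1 y))"
    have x': "x' \<in> A.X" using G(1)[OF SB[OF y]] by (simp add: x'_def)
    obtain j u where j: "j < L" "u \<in> A.X" "x' = shiftn (int j) (A.S 1 u)"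
      using A.S_desubst[OF x', where n = 1] unfolding power_one_right by blast
    have "F x' = shiftn (int k) (B.S 1 y)"
      unfolding x'_def F(3)[OF G(1)[OF SB[OF y]]] G(2)[OF SB[OF y]] ..
    moreover have "F x' = shiftn (int j) (F (A.S 1 u))"
      unfolding j(3) F(3)[OF SA[OF j(2)]] ..
    ultimately have "shiftn (- int k) (shiftn (int k) (B.S 1 y)) = shiftn (- int k) (shiftn (int j) (F (A.S 1 u)))"
      by simp
    also have "\<dots> = shiftn (int j) (B.S 1 (F' u))"
      unfolding F'(2)[OF j(2)] shiftn_shiftn by (simp only: add.commute)
    finally have "shiftn (int j) (B.S 1 (F' u)) = B.S 1 y" unfolding shiftn_shiftn by simp
    then have "int L dvd int j"
      using B.recognizability[OF infinite_BX F'(1)[OF j(2)] y] by blast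
    then have "j = 0" using j(1) by (auto dest: dvd_imp_le)
    then show ?thesis using j x'_def by auto
  qed
  then obtain G' where G': "\<And>y. y \<in> B.X \<Longrightarrow> G' y \<in> A.X"
    "\<And>y. y \<in> B.X \<Longrightarrow> A.S 1 (G' y) = shiftn (int k) (G (B.S 1 y))" by metis
  have "G' (F' x) = x" if x: "x \<in> A.X" for x
  proof (rule A.S_inj[OF G'(1)[OF F'(1)[OF x]] x])
    have "A.S 1 (G' (F' x)) = shiftn (int k) (G (shiftn (- int k) (F (A.S 1 x))))"
      unfolding G'(2)[OF F'(1)[OF x]] F'(2)[OF x] ..
    also have "\<dots> = A.S 1 x"
      unfolding G(3)[OF F(1)[OF SA[OF x]]] F(2)[OF SA[OF x]] shiftn_shiftn by simp
    finally show "A.S 1 (G' (F' x)) = A.S 1 x" .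
  qed
  moreover have "F' (G' y) = y" if y: "y \<in> B.X" for y
  proof (rule B.S_inj[OF F'(1)[OF G'(1)[OF y]] y])
    have "B.S 1 (F' (G' y)) = shiftn (- int k) (F (shiftn (int k) (G (B.S 1 y))))"
      unfolding F'(2)[OF G'(1)[OF y]] G'(2)[OF y] ..
    also have "\<dots> = B.S 1 y"
      unfolding F(3)[OF G(1)[OF SB[OF y]]] G(2)[OF SB[OF y]] shiftn_shiftn by simp
    finally show "B.S 1 (F' (G' y)) = B.S 1 y" .
  qed
  moreover have "F' (shiftn m x) = shiftn m (F' x)" if x: "x \<in> A.X" for x m
  proof (rule B.S_inj[of _ _ 1])
    have "B.S 1 (F' (shiftn m x)) = shiftn (- int k) (F (shiftn (int (L ^ 1) * m) (A.S 1 x)))"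
      using F'(2)[of "shiftn m x"] x unfolding A.S_shiftn by simp
    also have "\<dots> = shiftn (int (L ^ 1) * m) (B.S 1 (F' x))"
      unfolding F(3)[OF SA[OF x]] F'(2)[OF x] shiftn_shiftn by (simp only: add.commute)
    finally show "B.S 1 (F' (shiftn m x)) = B.S 1 (shiftn m (F' x))" unfolding B.S_shiftn .
  qed (use F'(1) x in auto)
  ultimately have "conj_maps A.X B.X F' G'" using F'(1) G'(1) unfolding conj_maps_def by simp
  moreover have "has_radius A.X F' ((s + 2 * L - 2) div L)"
    by (rule radius_step[where \<alpha> = \<alpha> and \<beta> = \<beta> and F = F and B = B and k = "- int k"])
      (use A.L_gt_1 A.S_1 B.S_1 SA F F' conj k(1) B.inj_\<alpha> B.length_\<alpha> B.X_range in simp_all)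
  moreover have "has_radius B.X G' ((s + 2 * L - 2) div L)"
    by (rule radius_step[where \<alpha> = \<beta> and \<beta> = \<alpha> and F = G and B = A and k = "int k"])
      (use A.L_gt_1 A.S_1 B.S_1 SB G G' conj k(1) A.inj_\<alpha> A.length_\<alpha> A.X_range in simp_all)
  ultimately show ?thesis using k(1) F'(2) by blast
qed

lemma ex_radius_2:
  assumes "conj_maps A.X B.X F G" "has_radius A.X F s" "has_radius B.X G s"
  shows "\<exists>F G. conj_maps A.X B.X F G \<and> has_radius A.X F 2 \<and> has_radius B.X G 2"
  using assms
proof (induction s arbitrary: F G rule: less_induct)
  case (less s)
  show ?case
  proof (cases "s \<le> 2")
    case True
    then have "has_radius A.X F 2" "has_radius B.X G 2"
      using less.prems(2,3) by (auto intro: has_radius_mono)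
    then show ?thesis using less.prems(1) by blast
  next
    case False
    \<comment> \<open>The inequality below holds because \<open>s * L - (s + 2 * L - 2)\<close>
      equals \<open>(s - 2) * (L - 1)\<close>. The new variables avoid truncated
      subtraction.\<close>
    define L' s' where "L' = L - 2" and "s' = s - 3"
    have L': "L = L' + 2" and s': "s = s' + 3" using A.L_gt_1 False by (simp_all add: L'_def s'_def)
    have "s + 2 * L - 2 < s * L" unfolding L' s' by (simp add: algebra_simps)
    then have "(s + 2 * L - 2) div L < s" by (rule less_mult_imp_div_less)
    moreover obtain F' G' where "conj_maps A.X B.X F' G'"
      "has_radius A.X F' ((s + 2 * L - 2) div L)" "has_radius B.X G' ((s + 2 * L - 2) div L)"
      using desubst_conjugacy[OF less.prems] by blast
    ultimately show ?thesis by (rule less.IH)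
  qed
qed

end

section \<open>Computing the language and testing primitivity\<close>

text \<open>Computable on all inputs: \<open>!\<close> is unspecified outside the list, whereas
  \<open>nth_default\<close> has a value there. On words over the alphabet this is
  \<open>subst_word (table_map t)\<close>.\<close>

definition tsubst :: "subst_table \<Rightarrow> nat list \<Rightarrow> nat list" where
  "tsubst t w = concat (map (\<lambda>a. nth_default [] t a) w)"

definition is_sublist :: "nat list \<Rightarrow> nat list \<Rightarrow> bool" where
  "is_sublist w u = list_ex (\<lambda>i. take (length w) (drop i u) = w) [0..<Suc (length u)]"

definition words_upto :: "nat \<Rightarrow> nat \<Rightarrow> nat list list" where
  "words_upto n k = concat (map (\<lambda>i. List.n_lists i [0..<k]) [0..<Suc n])"

definition lang_step :: "subst_table \<Rightarrow> nat \<Rightarrow> nat list list \<Rightarrow> nat list list" where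
  "lang_step t n W = filter (\<lambda>w. list_ex (\<lambda>a. is_sublist w (tsubst t [a])) [0..<length t] \<or>
     list_ex (\<lambda>v. is_sublist w (tsubst t v)) W) (words_upto n (length t))"

text \<open>The iterates increase and each is determined by the one before it, so that they are
  constant after at most as many steps as there are words to choose from.\<close>

definition lang_words :: "subst_table \<Rightarrow> nat \<Rightarrow> nat list list" where
  "lang_words t n = (lang_step t n ^^ length (words_upto n (length t))) []"

text \<open>With \<open>k\<close> letters, there are \<open>2 ^ (k * k)\<close> maps from letters to
  sets of letters. The map sending each letter to the letters of its n-fold image determines the
  next one, so that exponents beyond this bound only repeat earlier maps.\<close>

definition is_primitive :: "subst_table \<Rightarrow> bool" where
  "is_primitive t = list_ex (\<lambda>n. list_all (\<lambda>a. list_all (\<lambda>b. b \<in> set ((tsubst t ^^ Suc n) [a]))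
     [0..<length t]) [0..<length t]) [0..<2 ^ (length t * length t)]"

lemma tsubst_eq: "set w \<subseteq> {..<length t} \<Longrightarrow> tsubst t w = subst_word (table_map t) w"
  unfolding tsubst_def subst_word_def table_map_def
  by (intro arg_cong[where f = concat] map_cong refl) (auto simp: nth_default_def)

lemma funpow_tsubst_eq:
  assumes "\<And>a. a < length t \<Longrightarrow> set (t ! a) \<subseteq> {..<length t}" "set w \<subseteq> {..<length t}"
  shows "(tsubst t ^^ n) w = (subst_word (table_map t) ^^ n) w \<and>
    set ((subst_word (table_map t) ^^ n) w) \<subseteq> {..<length t}"
proof (induction n)
  case (Suc n)
  then have "tsubst t ((tsubst t ^^ n) w) = subst_word (table_map t) ((subst_word (table_map t) ^^ n) w)"
    by (simp add: tsubst_eq)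
  moreover have "set (subst_word (table_map t) v) \<subseteq> {..<length t}" if "set v \<subseteq> {..<length t}" for v
    using assms(1) that by (fastforce simp: subst_word_def table_map_def)
  ultimately show ?case using Suc by simp
qed (use assms(2) in simp)

lemma is_sublist_iff: "is_sublist w u \<longleftrightarrow> sublist w u"
proof
  assume "is_sublist w u"
  then obtain i where i: "take (length w) (drop i u) = w" by (auto simp: is_sublist_def list_ex_iff)
  have "sublist (take (length w) (drop i u)) u"
    using sublist_trans[OF sublist_take sublist_drop] .
  then show "sublist w u" unfolding i .
next
  assume "sublist w u"
  then obtain ps ss where "u = ps @ w @ ss" by (auto simp: sublist_def)
  then show "is_sublist w u"
    by (auto simp: is_sublist_def list_ex_iff simp del: upt_Suc intro!: bexI[of _ "length ps"])
qed

lemma set_words_upto: "set (words_upto n k) = {w. length w \<le> n \<and> set w \<subseteq> {..<k}}"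
  by (auto simp: words_upto_def set_n_lists subset_eq simp del: upt_Suc)

text \<open>A word of length at most \<open>n\<close> meets at most \<open>n\<close> consecutive
  blocks: it begins in the first of them, and \<open>M - 1 + n \<le> M * n\<close>. Legal words of
  length at most \<open>n\<close> are therefore found in images of legal words of length at most
  \<open>n\<close>, which keeps the iteration in \<open>lang_words\<close> finite.\<close>

lemma short_cover:
  assumes "sublist w (subst_word \<rho> z)" "\<And>a. a \<in> set z \<Longrightarrow> length (\<rho> a) = M" "2 \<le> M"
    "length w \<le> n" "2 \<le> n"
  shows "\<exists>v. sublist v z \<and> length v \<le> n \<and> sublist w (subst_word \<rho> v)"
proof -
  obtain ps ss where z: "subst_word \<rho> z = ps @ w @ ss" using assms(1) by (auto simp: sublist_def)
  define q where "q = length ps div M"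
  define c where "c = min n (length z - q)"
  define v where "v = take c (drop q z)"
  have lz: "length (subst_word \<rho> z) = M * length z" using assms(2) by (rule length_subst_word)
  then have le: "length ps + length w \<le> M * length z" unfolding z by simp
  have q: "M * q \<le> length ps" "length ps < M * q + M"
    using assms(3) mult_div_mod_eq[of M "length ps"] mod_less_divisor[of M "length ps"]
    unfolding q_def by linarith+
  have "M * q \<le> M * length z" using q(1) le by linarith
  then have qz: "q \<le> length z" using assms(3) by simp
  have lv: "length v = c" by (simp add: v_def c_def)
  have len: "length (subst_word \<rho> u) = M * length u" if "set u \<subseteq> set z" for u
    using that assms(2) by (intro length_subst_word) blast
  have sets: "set (take q z) \<subseteq> set z" "set v \<subseteq> set z"
    unfolding v_def by (meson set_take_subset set_drop_subset order_trans)+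
  define P V R where "P = subst_word \<rho> (take q z)" and "V = subst_word \<rho> v"
    and "R = subst_word \<rho> (drop c (drop q z))"
  have "z = take q z @ v @ drop c (drop q z)" unfolding v_def append_take_drop_id ..
  then have PVR: "ps @ w @ ss = P @ V @ R" unfolding z[symmetric] P_def V_def R_def by (metis subst_word_append)
  have lP: "length P = M * q" and lV: "length V = M * c"
    unfolding P_def V_def using len sets qz lv by simp_all
  have bound: "length ps + length w \<le> M * q + M * c"
  proof (cases "c = n")
    case True
    obtain M' n' where "M = M' + 2" "n = n' + 2" using assms(3,5) by (metis add.commute le_Suc_ex)
    then have "M + n \<le> M * c + 1" using True by (simp add: algebra_simps)
    then show ?thesis using q(2) assms(4) by linarith
  next
    case False
    then have "q + c = length z" using qz by (simp add: c_def min_def split: if_splits)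
    then have "M * q + M * c = M * length z" by (simp flip: distrib_left)
    then show ?thesis using le by simp
  qed
  have "w = take (length w) (drop (length ps) (P @ V @ R))" unfolding PVR[symmetric] by simp
  also have "\<dots> = take (length w) (drop (length ps - M * q) V)"
    using q(1) bound by (simp add: lP lV)
  finally have "sublist w V" using sublist_trans[OF sublist_take sublist_drop] by metis
  moreover have "sublist v z" unfolding v_def by (rule sublist_trans[OF sublist_take sublist_drop])
  ultimately show ?thesis using lv by (auto simp: V_def c_def)
qed

lemma funpow_iterate_bounded:
  assumes "finite Q" "\<And>n. s n \<in> Q" "\<And>n. s (Suc n) = \<phi> (s n)"
  shows "\<exists>m<card Q. s m = s n"
proof (induction n rule: less_induct)
  case (less n)
  show ?case
  proof (cases "n < card Q")
    case False
    have "\<not> inj_on s {..card Q}"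
    proof
      assume "inj_on s {..card Q}"
      then have "card {..card Q} \<le> card Q" using assms(1,2) by (intro card_inj_on_le) auto
      then show False by simp
    qed
    then obtain i j where ij: "i \<le> card Q" "j \<le> card Q" "i < j" "s i = s j"
      unfolding inj_on_def by (metis atMost_iff linorder_neqE_nat)
    have "s (i + d) = s (j + d)" for d
      by (induction d) (simp_all add: ij(4) assms(3))
    moreover have "i + (n - j) = n - (j - i)" "j + (n - j) = n" using ij False by simp_all
    ultimately have "s (n - (j - i)) = s n" by metis
    moreover have "n - (j - i) < n" using ij False by simp
    ultimately show ?thesis using less.IH by metis
  qed blast
qed

locale table_subst = const_length_subst "table_alphabet t" "table_map t" L for t L
begin

lemma alphabet: "table_alphabet t = {..<length t}"
  by (simp add: table_alphabet_def)

lemma table_letters: "a < length t \<Longrightarrow> set (t ! a) \<subseteq> {..<length t}"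
  using set_\<alpha>[of a] by (simp add: table_alphabet_def table_map_def)

lemma tsubst_Lang: "w \<in> Lang \<Longrightarrow> tsubst t w = subst_word (table_map t) w"
  using Lang_lists by (intro tsubst_eq) (auto simp: table_alphabet_def)

lemma tsubst_single: "a < length t \<Longrightarrow> tsubst t [a] = table_map t a"
  by (simp add: tsubst_eq)

lemma set_lang_words:
  assumes n: "2 \<le> n"
  shows "set (lang_words t n) = {w \<in> Lang. length w \<le> n}"
proof -
  \<comment> \<open>The factors of powers with exponents from 1 to \<open>m\<close>; this is what
    \<open>m\<close> steps of the iteration produce.\<close>
  define f where "f m = {w. length w \<le> n \<and> (\<exists>a<length t. \<exists>j\<le>m. 1 \<le> j \<and> sublist w (pw (table_map t) j a))}" for m
  define S where "S = set (words_upto n (length t))"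
  have pw_set: "set (pw (table_map t) j a) \<subseteq> {..<length t}" if "a < length t" for j a
    using set_pw_A[of a j] that by (simp add: alphabet)
  have fS: "f m \<subseteq> S" for m
    unfolding f_def S_def set_words_upto using pw_set set_mono_sublist by blast
  define \<Phi> where "\<Phi> W = {w \<in> S. (\<exists>a<length t. sublist w (table_map t a)) \<or> (\<exists>v\<in>W. sublist w (subst_word (table_map t) v))}" for W
  have f_Suc: "f (Suc m) = \<Phi> (f m)" for m
  proof (intro set_eqI iffI)
    fix w assume w: "w \<in> f (Suc m)"
    then obtain a j where aj: "a < length t" "1 \<le> j" "j \<le> Suc m" "sublist w (pw (table_map t) j a)" "length w \<le> n"
      by (auto simp: f_def)
    show "w \<in> \<Phi> (f m)"
    proof (cases "j = 1")
      case True
      then have "sublist w (table_map t a)" using aj by simp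
      then show ?thesis using aj(1) w fS by (auto simp: \<Phi>_def)
    next
      case False
      then obtain j' where j': "j = Suc j'" "1 \<le> j'" using aj(2) by (cases j) auto
      have "pw (table_map t) j a = subst_word (table_map t) (pw (table_map t) j' a)"
        unfolding j' using pw_add[of "table_map t" 1 j' a] by simp
      moreover have "length (table_map t b) = L" if "b \<in> set (pw (table_map t) j' a)" for b
        using that pw_set[OF aj(1), of j'] length_\<alpha>[of b] by (auto simp: alphabet)
      ultimately obtain v where v: "sublist v (pw (table_map t) j' a)" "length v \<le> n"
        "sublist w (subst_word (table_map t) v)"
        using short_cover[of w "table_map t" "pw (table_map t) j' a" L n] aj(4,5) n L_gt_1 by auto
      then have "v \<in> f m" unfolding f_def using aj j' by auto
      then show ?thesis using v(3) w fS by (auto simp: \<Phi>_def)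
    qed
  next
    fix w assume w: "w \<in> \<Phi> (f m)"
    then have "length w \<le> n" by (auto simp: \<Phi>_def S_def set_words_upto)
    from w consider a where "a < length t" "sublist w (table_map t a)"
      | v where "v \<in> f m" "sublist w (subst_word (table_map t) v)" by (auto simp: \<Phi>_def)
    then show "w \<in> f (Suc m)"
    proof cases
      case 1
      then show ?thesis using \<open>length w \<le> n\<close> unfolding f_def
        by (intro CollectI conjI exI[of _ a] exI[of _ 1]) simp_all
    next
      case 2
      then obtain a j where aj: "a < length t" "j \<le> m" "1 \<le> j" "sublist v (pw (table_map t) j a)"
        by (auto simp: f_def)
      have "sublist w (pw (table_map t) (Suc j) a)"
        using sublist_trans[OF 2(2) sublist_subst_word[OF aj(4)]] pw_add[of "table_map t" 1 j a] by simp
      then show ?thesis using \<open>length w \<le> n\<close> aj unfolding f_def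
        by (intro CollectI conjI exI[of _ a] exI[of _ "Suc j"]) simp_all
    qed
  qed
  have step: "set ((lang_step t n ^^ m) []) = f m" for m
  proof (induction m)
    case 0
    show ?case by (simp add: f_def)
  next
    case (Suc m)
    have "tsubst t v = subst_word (table_map t) v" if "v \<in> f m" for v
      using that fS[of m] by (intro tsubst_eq) (auto simp: S_def set_words_upto)
    then have "set (lang_step t n W) = \<Phi> (f m)" if "set W = f m" for W
      unfolding lang_step_def \<Phi>_def S_def using that
      by (auto simp: is_sublist_iff list_ex_iff tsubst_single)
    then show ?case using Suc by (simp add: f_Suc)
  qed
  have mono: "f m \<subseteq> f m'" if "m \<le> m'" for m m'
    unfolding f_def using that order_trans by blast
  have "finite S" by (simp add: S_def)
  have "finite (range f)"
    by (rule finite_subset[of _ "Pow S"]) (use fS \<open>finite S\<close> in auto)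
  then have "\<exists>N. (\<forall>n\<le>N. \<forall>m\<le>N. m < n \<longrightarrow> f m \<subset> f n) \<and> (\<forall>n\<ge>N. f N = f n)"
    using mono by (intro finite_mono_remains_stable_implies_strict_prefix) (auto simp: mono_def f_Suc)
  then have "f (card S) = (\<Union>m. f m)"
    using fS \<open>finite S\<close> by (intro finite_mono_strict_prefix_implies_finite_fixpoint)
  moreover have "card S \<le> length (words_upto n (length t))" by (simp add: S_def card_length)
  ultimately have "f (length (words_upto n (length t))) = (\<Union>m. f m)"
    using mono by blast
  moreover have "(\<Union>m. f m) = {w \<in> Lang. length w \<le> n}"
    by (auto simp: f_def language_def pw_def alphabet)
  ultimately show ?thesis by (simp add: lang_words_def step)
qed

end

lemma is_primitive_iff:
  assumes "\<And>a. a < length t \<Longrightarrow> set (t ! a) \<subseteq> {..<length t}"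
  shows "is_primitive t \<longleftrightarrow> primitive_subst (table_alphabet t) (table_map t)"
proof -
  let ?k = "length t"
  let ?pw = "\<lambda>n a. (subst_word (table_map t) ^^ n) [a]"
  have eq: "(tsubst t ^^ n) [a] = ?pw n a" "set (?pw n a) \<subseteq> {..<?k}" if "a < ?k" for n a
    using funpow_tsubst_eq[of t "[a]" n] assms that by auto
  define s where "s n = (\<lambda>a\<in>{..<?k}. set (?pw (Suc n) a))" for n
  define Q where "Q = PiE {..<?k} (\<lambda>_. Pow {..<?k})"
  define \<phi> where "\<phi> g = (\<lambda>a\<in>{..<?k}. \<Union>b\<in>g a. set (table_map t b))" for g :: "nat \<Rightarrow> nat set"
  have "card Q = 2 ^ (?k * ?k)" by (simp add: Q_def card_PiE card_Pow power_mult)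
  moreover have "finite Q" by (simp add: Q_def finite_PiE)
  moreover have "s n \<in> Q" for n
    unfolding s_def Q_def using eq(2)[of _ "Suc n"] by (auto simp del: funpow.simps)
  moreover have "s (Suc n) = \<phi> (s n)" for n
    by (auto simp: s_def \<phi>_def fun_eq_iff subst_word_def restrict_def)
  ultimately have bounded: "\<exists>m<2 ^ (?k * ?k). s m = s n" for n
    using funpow_iterate_bounded[of Q s \<phi> n] by simp
  have full: "(\<forall>a<?k. {..<?k} \<subseteq> set (?pw (Suc n) a)) \<longleftrightarrow> (\<forall>a<?k. {..<?k} \<subseteq> s n a)" for n
    by (auto simp: s_def)
  have "is_primitive t \<longleftrightarrow> (\<exists>n<2 ^ (?k * ?k). \<forall>a<?k. {..<?k} \<subseteq> set (?pw (Suc n) a))"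
    using eq(1) by (simp add: is_primitive_def list_ex_iff list_all_iff subset_eq del: funpow.simps)
      (meson atLeastLessThan_iff zero_le lessThan_iff)
  also have "\<dots> \<longleftrightarrow> (\<exists>n. \<forall>a<?k. {..<?k} \<subseteq> set (?pw (Suc n) a))"
    unfolding full using bounded by metis
  also have "\<dots> \<longleftrightarrow> primitive_subst (table_alphabet t) (table_map t)"
    unfolding primitive_subst_def table_alphabet_def by (metis Suc_pred zero_less_Suc lessThan_iff)
  finally show ?thesis .
qed

section \<open>Deciding conjugacy of injective substitutions\<close>

definition look :: "(nat list \<times> nat) list \<Rightarrow> nat list \<Rightarrow> nat" where
  "look f u = nth_default 0 (map snd (filter (\<lambda>p. fst p = u) f)) 0"

definition code_word :: "(nat list \<times> nat) list \<Rightarrow> nat list \<Rightarrow> nat list" where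
  "code_word f u = map (\<lambda>i. look f (take 5 (drop i u))) [0..<length u - 4]"

definition five_words :: "subst_table \<Rightarrow> nat list list" where
  "five_words s = filter (\<lambda>u. length u = 5) (lang_words s 9)"

text \<open>A generous superset of the codes: entries are chosen independently, so that a list may
  give a word several values or none. \<open>look\<close> then takes the first one or 0.\<close>

definition block_maps :: "subst_table \<Rightarrow> subst_table \<Rightarrow> (nat list \<times> nat) list list" where
  "block_maps s t = List.n_lists (length (five_words s))
     (concat (map (\<lambda>u. map (\<lambda>a. (u, a)) [0..<length t]) (five_words s)))"

text \<open>Six letters are coded to two. Two-letter words suffice for the reason given in
  \<open>Fc_in_X\<close>.\<close>

definition code_legal :: "subst_table \<Rightarrow> subst_table \<Rightarrow> (nat list \<times> nat) list \<Rightarrow> bool" where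
  "code_legal s t f = list_all (\<lambda>u. length u = 6 \<longrightarrow> code_word f u \<in> set (lang_words t 2)) (lang_words s 9)"

text \<open>Index 4 is the middle of the word: nine letters are coded to five, which an inverse of
  radius 2 reads to recover the middle letter.\<close>

definition code_inj :: "subst_table \<Rightarrow> (nat list \<times> nat) list \<Rightarrow> bool" where
  "code_inj s f = list_all (\<lambda>u. list_all (\<lambda>v. length u = 9 \<and> length v = 9 \<and> code_word f u = code_word f v
     \<longrightarrow> nth_default 0 u 4 = nth_default 0 v 4) (lang_words s 9)) (lang_words s 9)"

text \<open>
  This is \<open>\<alpha> F' = \<sigma>\<^sup>-\<^sup>k F \<beta>\<close> with \<open>0 \<le> k < L\<close> and \<open>e = 2 L - 2 - k\<close>: a word of length 5 covers the
  positions -2 to 2, so that its image begins at position \<open>-2 L\<close>, and coding a word drops its two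
  outermost letters at either end.
\<close>

definition code_step ::
  "subst_table \<Rightarrow> subst_table \<Rightarrow> nat \<Rightarrow> (nat list \<times> nat) list \<Rightarrow> (nat list \<times> nat) list \<Rightarrow> bool" where
  "code_step s t L f f' = list_ex (\<lambda>e. list_all (\<lambda>u. length u = 5 \<longrightarrow>
     tsubst t [look f' u] = take L (drop e (code_word f (tsubst s u)))) (lang_words s 9)) [0..<2 * L - 1]"

text \<open>
  All codes have radius 2 and therefore read words of length 5. A code with an inverse of radius 2
  is injective on words of length 9 in the sense of \<open>code_inj\<close>. That every code of \<open>C\<close>
  desubstitutes to another one of \<open>C\<close> is a finite certificate for its image being in the subshift.
\<close>

definition conj_check :: "subst_table \<Rightarrow> subst_table \<Rightarrow> nat \<Rightarrow> bool" where
  "conj_check s t L = list_ex (\<lambda>C. C \<noteq> [] \<and> list_all (\<lambda>f. code_legal s t f \<and> code_inj s f \<and>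
     list_ex (\<lambda>f'. code_step s t L f f') C) C) (subseqs (block_maps s t))"

section \<open>Soundness of the conjugacy test\<close>

definition Fc :: "(nat list \<times> nat) list \<Rightarrow> (int \<Rightarrow> nat) \<Rightarrow> int \<Rightarrow> nat" where
  "Fc f x = (\<lambda>i. look f (window x (i - 2) 5))"

lemma Fc_shiftn: "Fc f (shiftn k x) = shiftn k (Fc f x)"
  by (simp add: Fc_def fun_eq_iff algebra_simps)

lemma Fc_radius: "has_radius X (Fc f) 2"
  unfolding has_radius_def Fc_def by (auto intro!: arg_cong[where f = "look f"] window_eqI)

lemma window_eqD_int:
  assumes "window x i n = window y i n" "i \<le> j" "j < i + int n"
  shows "x j = y j"
proof -
  have "int (nat (j - i)) = j - i" "nat (j - i) < n" using assms(2,3) by auto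
  then show ?thesis using window_eqD[OF assms(1), of "nat (j - i)"] by simp
qed

lemma take_drop_window:
  assumes "j + m \<le> n"
  shows "take m (drop j (window x i n)) = window x (i + int j) m"
proof -
  have n: "n = j + (m + (n - j - m))" using assms by simp
  show ?thesis by (subst n, subst window_split, subst window_split) simp
qed

lemma code_word_window: "code_word f (window x i (n + 4)) = window (Fc f x) (i + 2) n"
proof (rule nth_equalityI)
  fix j assume "j < length (code_word f (window x i (n + 4)))"
  then have j: "j < n" by (simp add: code_word_def)
  then have "take 5 (drop j (window x i (n + 4))) = window x (i + int j) 5"
    by (intro take_drop_window) simp
  then show "code_word f (window x i (n + 4)) ! j = window (Fc f x) (i + 2) n ! j"
    using j by (simp add: code_word_def Fc_def)
qed (simp add: code_word_def)

locale table_pair = S: table_subst s L + T: table_subst t L for s t L +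
  assumes inj_s: "inj_on (table_map s) (table_alphabet s)"
begin

sublocale SI: injective_const_length_subst "table_alphabet s" "table_map s" L
  by unfold_locales (rule inj_s)

lemma mem_words: "w \<in> set (lang_words s 9) \<longleftrightarrow> w \<in> S.Lang \<and> length w \<le> 9"
  using S.set_lang_words[of 9] by simp

lemma window_words: "x \<in> S.X \<Longrightarrow> n \<le> 9 \<Longrightarrow> window x i n \<in> set (lang_words s 9)"
  unfolding mem_words using S.X_iff by simp

lemma Fc_two_block:
  assumes "code_legal s t f" "x \<in> S.X"
  shows "window (Fc f x) i 2 \<in> T.Lang"
proof -
  have "code_word f (window x (i - 2) (2 + 4)) \<in> set (lang_words t 2)"
    using assms(1) window_words[OF assms(2), of 6 "i - 2"] by (simp add: code_legal_def list_all_iff)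
  then show ?thesis unfolding code_word_window using T.set_lang_words[of 2] by simp
qed

lemma Fc_range:
  assumes "code_legal s t f" "x \<in> S.X"
  shows "Fc f x i \<in> table_alphabet t"
proof -
  have "window (Fc f x) i 2 \<in> lists (table_alphabet t)"
    using Fc_two_block[OF assms] T.Lang_lists by blast
  moreover have "Fc f x i \<in> set (window (Fc f x) i 2)"
    by (auto simp: set_window intro!: image_eqI[of _ _ 0])
  ultimately show ?thesis by (meson in_listsD)
qed

lemma code_word_tsubst:
  assumes "x \<in> S.X"
  shows "take L (drop e (code_word f (tsubst s (window x (i - 2) 5)))) =
    take L (drop e (window (Fc f (S.S 1 x)) (int L * (i - 2) + 2) (5 * L - 4)))"
proof -
  have L: "5 * L - 4 + 4 = L ^ 1 * 5" using S.L_gt_1 by simp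
  have "tsubst s (window x (i - 2) 5) = subst_word (pw (table_map s) 1) (window x (i - 2) 5)"
    using S.tsubst_Lang[of "window x (i - 2) 5"] assms S.X_iff by simp
  also have "\<dots> = window (S.S 1 x) (int (L ^ 1) * (i - 2)) (5 * L - 4 + 4)"
    unfolding L by (rule S.window_S[OF S.X_range[OF assms], symmetric])
  finally have eq: "tsubst s (window x (i - 2) 5) = window (S.S 1 x) (int (L ^ 1) * (i - 2)) (5 * L - 4 + 4)" .
  show ?thesis unfolding eq code_word_window by simp
qed

text \<open>The relation of \<open>code_step\<close> for points; with
  \<open>e = 2 * L - 2 - k\<close> the shift is by \<open>- k\<close>.\<close>

lemma Fc_step:
  assumes f': "code_legal s t f'" and e: "e < 2 * L - 1"
    and step: "\<And>u. u \<in> set (lang_words s 9) \<Longrightarrow> length u = 5 \<Longrightarrow>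
      tsubst t [look f' u] = take L (drop e (code_word f (tsubst s u)))"
    and x: "x \<in> S.X"
  shows "T.S 1 (Fc f' x) = shiftn (int e + 2 - 2 * int L) (Fc f (S.S 1 x))"
proof
  fix p
  define i where "i = p div int L"
  define r where "r = nat (p mod int L)"
  have L: "int L > 0" using S.L_gt_1 by simp
  have r: "r < L" and p: "p = int L * i + int r"
    using pos_mod_bound[OF L] pos_mod_sign[OF L] by (simp_all add: r_def i_def nat_less_iff)
  have a: "look f' (window x (i - 2) 5) = Fc f' x i" by (simp add: Fc_def)
  have "table_map t (Fc f' x i) = tsubst t [look f' (window x (i - 2) 5)]"
    unfolding a using Fc_range[OF f' x, of i] by (simp add: T.tsubst_single T.alphabet)
  also have "\<dots> = take L (drop e (window (Fc f (S.S 1 x)) (int L * (i - 2) + 2) (5 * L - 4)))"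
    using step[OF window_words[OF x], of 5 "i - 2"] unfolding code_word_tsubst[OF x] by simp
  also have "\<dots> = window (Fc f (S.S 1 x)) (int L * (i - 2) + 2 + int e) L"
    using e S.L_gt_1 by (intro take_drop_window) simp
  finally have "table_map t (Fc f' x i) ! r = Fc f (S.S 1 x) (int L * (i - 2) + 2 + int e + int r)"
    using r by simp
  moreover have "T.S 1 (Fc f' x) p = table_map t (Fc f' x i) ! r"
    unfolding p using subst_pt_app[OF r, of "table_map t" "Fc f' x" i] T.S_1 by simp
  ultimately show "T.S 1 (Fc f' x) p = shiftn (int e + 2 - 2 * int L) (Fc f (S.S 1 x)) p"
    by (simp add: p algebra_simps)
qed

text \<open>Iterating the step inside \<open>C\<close> writes \<open>Fc f (S.S m x)\<close>, up to a
  shift, as \<open>T.S m (Fc f' x)\<close>. For a window of length \<open>m\<close> the level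
  \<open>m\<close> is high enough: as \<open>m < L ^ m\<close>, the window meets at most two
  adjacent blocks and lies in the m-fold image of a two-letter word of \<open>Fc f' x\<close>, which
  is legal.\<close>

lemma Fc_in_X:
  assumes C: "\<And>f. f \<in> C \<Longrightarrow> code_legal s t f" "\<And>f. f \<in> C \<Longrightarrow> \<exists>f'\<in>C. code_step s t L f f'"
    and "f \<in> C" "y \<in> S.X"
  shows "Fc f y \<in> T.X"
proof -
  have iterate: "\<exists>f'\<in>C. \<exists>K. Fc f (S.S n x) = shiftn K (T.S n (Fc f' x))" if "f \<in> C" "x \<in> S.X" for f x n
    using that
  proof (induction n arbitrary: f)
    case 0
    have "Fc f (S.S 0 x) = shiftn 0 (T.S 0 (Fc f x))"
      by (simp add: S.S_def T.S_def subst_pt_def fun_eq_iff)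
    then show ?case using 0 by blast
  next
    case (Suc n)
    obtain f1 e where f1: "f1 \<in> C" "e < 2 * L - 1" "\<And>u. u \<in> set (lang_words s 9) \<Longrightarrow> length u = 5 \<Longrightarrow>
      tsubst t [look f1 u] = take L (drop e (code_word f (tsubst s u)))"
      using C(2)[OF Suc.prems(1)] by (auto simp: code_step_def list_ex_iff list_all_iff)
    obtain f' K where f': "f' \<in> C" "Fc f1 (S.S n x) = shiftn K (T.S n (Fc f' x))"
      using Suc.IH[OF f1(1) Suc.prems(2)] by blast
    define k where "k = int e + 2 - 2 * int L"
    have "T.S 1 (Fc f1 (S.S n x)) = shiftn k (Fc f (S.S 1 (S.S n x)))"
      unfolding k_def by (rule Fc_step[OF C(1)[OF f1(1)] f1(2,3) S.S_X[OF Suc.prems(2)]])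
    also have "S.S 1 (S.S n x) = S.S (Suc n) x" using S.S_add[OF S.X_range[OF Suc.prems(2)], of 1 n] by simp
    finally have "shiftn (- k) (T.S 1 (Fc f1 (S.S n x))) = shiftn (- k) (shiftn k (Fc f (S.S (Suc n) x)))"
      by (rule arg_cong)
    then have "Fc f (S.S (Suc n) x) = shiftn (- k) (T.S 1 (shiftn K (T.S n (Fc f' x))))"
      unfolding shiftn_shiftn f'(2) by simp
    also have "\<dots> = shiftn (- k + int (L ^ 1) * K) (T.S 1 (T.S n (Fc f' x)))"
      unfolding T.S_shiftn shiftn_shiftn ..
    also have "T.S 1 (T.S n (Fc f' x)) = T.S (Suc n) (Fc f' x)"
      using T.S_add[OF Fc_range[OF C(1)[OF f'(1)] Suc.prems(2)], of 1 n] by simp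
    finally show ?case using f'(1) by blast
  qed
  have "window (Fc f y) i m \<in> T.Lang" for i m
  proof -
    define M where "M = L ^ m"
    have m: "m < M" unfolding M_def using power_gt_expt S.L_gt_1 by simp
    obtain j x where x: "x \<in> S.X" "y = shiftn (int j) (S.S m x)" using SI.S_desubst[OF assms(4), of m] by blast
    obtain f' K where f': "f' \<in> C" "Fc f (S.S m x) = shiftn K (T.S m (Fc f' x))"
      using iterate[OF assms(3) x(1)] by blast
    have "window (Fc f y) i m = window (T.S m (Fc f' x)) (i + int j + K) m"
      unfolding x(2) Fc_shiftn f'(2) by (simp add: algebra_simps)
    moreover define q where "q = (i + int j + K) div int M"
    have q: "int M * q \<le> i + int j + K" "i + int j + K < int M * q + int M"
      using m mult_div_mod_eq[of "int M" "i + int j + K"] pos_mod_bound[of "int M" "i + int j + K"]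
        pos_mod_sign[of "int M" "i + int j + K"] unfolding q_def by linarith+
    have "sublist (window (T.S m (Fc f' x)) (i + int j + K) m) (window (T.S m (Fc f' x)) (int M * q) (M * 2))"
      using q m by (intro sublist_window) simp_all
    moreover have "window (T.S m (Fc f' x)) (int M * q) (M * 2) \<in> T.Lang"
      unfolding M_def T.window_S[OF Fc_range[OF C(1)[OF f'(1)] x(1)]]
      by (rule T.subst_word_in_Lang[OF Fc_two_block[OF C(1)[OF f'(1)] x(1)]])
    ultimately show ?thesis using language_sublist by simp
  qed
  then show ?thesis using T.X_iff by blast
qed

lemma Fc_inj:
  assumes "code_inj s f"
  shows "inj_on (Fc f) S.X"
proof (rule inj_onI, rule ext)
  fix x y i assume xy: "x \<in> S.X" "y \<in> S.X" "Fc f x = Fc f y"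
  have "code_word f (window x (i - 4) 9) = code_word f (window y (i - 4) 9)"
    using code_word_window[of f x "i - 4" 5] code_word_window[of f y "i - 4" 5] xy(3) by simp
  moreover have "nth_default 0 u 4 = nth_default 0 v 4"
    if "u \<in> set (lang_words s 9)" "v \<in> set (lang_words s 9)" "length u = 9 \<and> length v = 9 \<and> code_word f u = code_word f v"
    for u v using assms that unfolding code_inj_def list_all_iff by blast
  ultimately have "nth_default 0 (window x (i - 4) 9) 4 = nth_default 0 (window y (i - 4) 9) 4"
    using window_words[OF xy(1), of 9 "i - 4"] window_words[OF xy(2), of 9 "i - 4"] length_window order_refl
    by blast
  then show "x i = y i" by (simp add: nth_default_def)
qed

theorem conj_check_sound:
  assumes "conj_check s t L"
  shows "conjugate (table_alphabet s) (table_map s) (table_alphabet t) (table_map t)"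
proof -
  obtain C where C: "C \<noteq> []" "\<And>f. f \<in> set C \<Longrightarrow> code_legal s t f \<and> code_inj s f \<and> (\<exists>f'\<in>set C. code_step s t L f f')"
    using assms by (auto simp: conj_check_def list_ex_iff list_all_iff)
  obtain f where f: "f \<in> set C" using C(1) by (cases C) auto
  show ?thesis
  proof (rule T.conjugate_if_injective_code)
    show "Fc f x \<in> T.X" if "x \<in> S.X" for x
      by (rule Fc_in_X[of "set C"]) (use C(2) f that in auto)
    show "inj_on (Fc f) S.X" using C(2) f Fc_inj by blast
    show "Fc f (shiftn k x) = shiftn k (Fc f x)" for x k by (rule Fc_shiftn)
    show "has_radius S.X (Fc f) 2" by (rule Fc_radius)
  qed (use S.finite_A S.X_nonempty in simp_all)
qed

section \<open>Completeness of the conjugacy test\<close>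

lemma ex_window_zero:
  assumes "u \<in> S.Lang"
  shows "\<exists>x\<in>S.X. window x i (length u) = u"
proof -
  obtain x0 where "x0 \<in> S.X" using S.X_nonempty by blast
  moreover from this obtain j where "window x0 j (length u) = u" using S.minimal[OF assms] by blast
  ultimately show ?thesis by (intro bexI[of _ "shiftn (j - i) x0"]) simp_all
qed

text \<open>For a map of radius 2 the choice of the point does not affect the value. Running through
  \<open>five_words s\<close> places the code among the \<open>block_maps\<close>.\<close>

definition code_of :: "((int \<Rightarrow> nat) \<Rightarrow> int \<Rightarrow> nat) \<Rightarrow> (nat list \<times> nat) list" where
  "code_of F = map (\<lambda>u. (u, F (SOME x. x \<in> S.X \<and> window x (-2) 5 = u) 0)) (five_words s)"

lemma look_code_of:
  assumes F: "has_radius S.X F 2" and x: "x \<in> S.X"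
  shows "look (code_of F) (window x (-2) 5) = F x 0"
proof -
  let ?u = "window x (-2) 5"
  define y where "y = (SOME y. y \<in> S.X \<and> window y (-2) 5 = ?u)"
  have y: "y \<in> S.X \<and> window y (-2) 5 = ?u" unfolding y_def by (rule someI[of _ x]) (simp add: x)
  have "y i = x i" if "\<bar>i\<bar> \<le> int 2" for i
    using window_eqD_int[of y "-2" 5 x i] y that by simp
  then have "F y 0 = F x 0" using F x y unfolding has_radius_def by blast
  have "?u \<in> set (five_words s)" using window_words[OF x] by (simp add: five_words_def)
  then have "filter (\<lambda>p. fst p = ?u) (code_of F) \<noteq> []"
    by (auto simp: code_of_def filter_empty_conv)
  then obtain p ps where p: "filter (\<lambda>p. fst p = ?u) (code_of F) = p # ps"
    by (auto simp: neq_Nil_conv)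
  then have "p \<in> set (filter (\<lambda>p. fst p = ?u) (code_of F))" by simp
  then have "snd p = F y 0" unfolding y_def by (auto simp: code_of_def)
  then show ?thesis using \<open>F y 0 = F x 0\<close> by (simp add: look_def p nth_default_def)
qed

lemma Fc_code_of:
  assumes "has_radius S.X F 2" "\<And>x k. x \<in> S.X \<Longrightarrow> F (shiftn k x) = shiftn k (F x)" "x \<in> S.X"
  shows "Fc (code_of F) x = F x"
proof
  fix i
  have "Fc (code_of F) x i = look (code_of F) (window (shiftn i x) (-2) 5)"
    by (simp add: Fc_def)
  also have "\<dots> = F (shiftn i x) 0" by (rule look_code_of[OF assms(1)]) (simp add: assms(3))
  also have "\<dots> = F x i" by (simp add: assms)
  finally show "Fc (code_of F) x i = F x i" .
qed

theorem conj_check_complete: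
  assumes inj_t: "inj_on (table_map t) (table_alphabet t)" and inf: "infinite T.X"
    and conj: "conjugate (table_alphabet s) (table_map s) (table_alphabet t) (table_map t)"
  shows "conj_check s t L"
proof -
  interpret ST: two_substs "table_alphabet s" "table_map s" L "table_alphabet t" "table_map t"
    by unfold_locales (use inj_t inf in auto)
  define good where "good F G \<longleftrightarrow> conj_maps S.X T.X F G \<and> has_radius S.X F 2 \<and> has_radius T.X G 2" for F G
  obtain F0 G0 r where "conj_maps S.X T.X F0 G0" "has_radius S.X F0 r" "has_radius T.X G0 r"
    using S.conjugate_imp_conj_maps[OF T.finite_A conj] by blast
  then obtain F1 G1 where FG1: "good F1 G1" unfolding good_def using ST.ex_radius_2 by blast
  have goodD: "F x \<in> T.X" "G (F x) = x" "F (shiftn k x) = shiftn k (F x)" "Fc (code_of F) x = F x"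
    if "good F G" "x \<in> S.X" for F G x k
    using that Fc_code_of[of F x] by (simp_all add: good_def conj_maps_def)
  \<comment> \<open>The certificate: the codes of all conjugacies of radius 2 with an inverse of
    radius 2. Desubstitution takes radius 2 to radius 2 and so does not lead out of this
    set.\<close>
  define Cs where "Cs = {code_of F | F. \<exists>G. good F G}"
  have legal: "code_legal s t (code_of F)" if FG: "good F G" for F G
    unfolding code_legal_def list_all_iff
  proof (intro ballI impI)
    fix u assume u: "u \<in> set (lang_words s 9)" "length u = 6"
    then obtain x where x: "x \<in> S.X" "window x 0 6 = u" using ex_window_zero[of u 0] by (auto simp: mem_words)
    have "code_word (code_of F) u = window (F x) 2 2"
      using code_word_window[of "code_of F" x 0 2] goodD(4)[OF FG x(1)] x(2) by simp
    then show "code_word (code_of F) u \<in> set (lang_words t 2)"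
      using T.set_lang_words[of 2] goodD(1)[OF FG x(1)] T.X_iff by simp
  qed
  have inj: "code_inj s (code_of F)" if FG: "good F G" for F G
    unfolding code_inj_def list_all_iff
  proof (intro ballI impI)
    fix u v assume uv: "u \<in> set (lang_words s 9)" "v \<in> set (lang_words s 9)"
      "length u = 9 \<and> length v = 9 \<and> code_word (code_of F) u = code_word (code_of F) v"
    obtain x where x: "x \<in> S.X" "window x (-4) 9 = u" using uv ex_window_zero[of u "-4"] by (auto simp: mem_words)
    obtain y where y: "y \<in> S.X" "window y (-4) 9 = v" using uv ex_window_zero[of v "-4"] by (auto simp: mem_words)
    have "code_word (code_of F) u = window (F x) (-2) 5" "code_word (code_of F) v = window (F y) (-2) 5"
      using code_word_window[of "code_of F" x "-4" 5] goodD(4)[OF FG x(1)] x(2)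
        code_word_window[of "code_of F" y "-4" 5] goodD(4)[OF FG y(1)] y(2) by simp_all
    then have eq: "window (F x) (-2) 5 = window (F y) (-2) 5" using uv(3) by simp
    have "\<forall>i. \<bar>i\<bar> \<le> int 2 \<longrightarrow> F x i = F y i"
    proof (intro allI impI)
      fix i :: int assume "\<bar>i\<bar> \<le> int 2"
      then show "F x i = F y i" using window_eqD_int[OF eq, of i] by simp
    qed
    then have "G (F x) 0 = G (F y) 0"
      using FG goodD(1)[OF FG x(1)] goodD(1)[OF FG y(1)] unfolding good_def has_radius_def by blast
    then have "x 0 = y 0" using goodD(2)[OF FG x(1)] goodD(2)[OF FG y(1)] by simp
    then show "nth_default 0 u 4 = nth_default 0 v 4"
      unfolding x(2)[symmetric] y(2)[symmetric] by (simp add: nth_default_def)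
  qed
  have step: "\<exists>F' G'. good F' G' \<and> code_step s t L (code_of F) (code_of F')" if FG: "good F G" for F G
  proof -
    have "(2 + 2 * L - 2) div L = 2" using S.L_gt_1 by simp
    then obtain F' G' k where F': "k < L" "good F' G'"
      "\<And>x. x \<in> S.X \<Longrightarrow> T.S 1 (F' x) = shiftn (- int k) (F (S.S 1 x))"
      using ST.desubst_conjugacy[of F G 2] FG unfolding good_def by auto
    define e where "e = 2 * L - 2 - k"
    have e: "e \<in> set [0..<2 * L - 1]" "int e = 2 * int L - 2 - int k"
      using F'(1) S.L_gt_1 by (auto simp: e_def of_nat_diff)
    have "tsubst t [look (code_of F') u] = take L (drop e (code_word (code_of F) (tsubst s u)))"
      if u: "u \<in> set (lang_words s 9)" "length u = 5" for u
    proof -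
      obtain x where x: "x \<in> S.X" "window x (0 - 2) 5 = u" using u ex_window_zero[of u "-2"] by (auto simp: mem_words)
      have "look (code_of F') u = F' x 0"
        using look_code_of[of F' x] F'(2) x unfolding good_def by simp
      then have "tsubst t [look (code_of F') u] = table_map t (F' x 0)"
        using T.X_range[OF goodD(1)[OF F'(2) x(1)], of 0] by (simp add: T.tsubst_single T.alphabet)
      also have "\<dots> = window (T.S 1 (F' x)) 0 L"
        using T.window_S[of "F' x" 1 0 1] T.X_range[OF goodD(1)[OF F'(2) x(1)]] by (simp add: window_def)
      also have "\<dots> = window (F (S.S 1 x)) (- int k) L" unfolding F'(3)[OF x(1)] by simp
      also have "\<dots> = take L (drop e (window (F (S.S 1 x)) (int L * (0 - 2) + 2) (5 * L - 4)))"
      proof -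
        have "e + L \<le> 5 * L - 4" using e(2) S.L_gt_1 by linarith
        then show ?thesis by (subst take_drop_window) (simp_all add: e(2))
      qed
      also have "\<dots> = take L (drop e (code_word (code_of F) (tsubst s u)))"
        using code_word_tsubst[OF x(1), of e "code_of F" 0] goodD(4)[OF FG S.S_X[OF x(1), of 1]] x(2) by simp
      finally show ?thesis .
    qed
    then have "code_step s t L (code_of F) (code_of F')"
      unfolding code_step_def list_ex_iff list_all_iff using e(1) by blast
    then show ?thesis using F'(2) by blast
  qed
  have "Cs \<subseteq> set (block_maps s t)"
  proof
    fix f assume "f \<in> Cs"
    then obtain F G where f: "f = code_of F" and FG: "good F G" by (auto simp: Cs_def)
    have "F (SOME x. x \<in> S.X \<and> window x (-2) 5 = u) 0 < length t" if u: "u \<in> set (five_words s)" for u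
    proof -
      have "\<exists>x. x \<in> S.X \<and> window x (-2) 5 = u"
        using u ex_window_zero[of u "-2"] by (auto simp: five_words_def mem_words)
      then have "(SOME x. x \<in> S.X \<and> window x (-2) 5 = u) \<in> S.X" by (rule someI2_ex) simp
      then show ?thesis using T.X_range[OF goodD(1)[OF FG]] by (simp add: T.alphabet)
    qed
    then show "f \<in> set (block_maps s t)"
      unfolding f code_of_def block_maps_def set_n_lists by auto
  qed
  then obtain C where C: "C \<in> set (subseqs (block_maps s t))" "set C = Cs"
    using subset_subseqs by (metis imageE)
  have "C \<noteq> []" using C(2) FG1 by (auto simp: Cs_def)
  moreover have "code_legal s t f \<and> code_inj s f \<and> (\<exists>f'\<in>set C. code_step s t L f f')" if "f \<in> set C" for f
    using that legal inj step unfolding C(2) Cs_def by blast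
  ultimately show ?thesis
    unfolding conj_check_def list_ex_iff list_all_iff using C(1) by blast
qed

end

section \<open>Reduction to injective substitutions\<close>

lemma subst_word_map:
  assumes "\<And>a. a \<in> A \<Longrightarrow> map p (\<alpha> a) = \<alpha>' (p a)" "set w \<subseteq> A"
  shows "map p (subst_word \<alpha> w) = subst_word \<alpha>' (map p w)"
  using assms(2) by (induction w) (simp_all add: assms(1))

context const_length_subst
begin

lemma map_pw:
  assumes "\<And>a. a \<in> A \<Longrightarrow> map p (\<alpha> a) = \<alpha>' (p a)" "a \<in> A"
  shows "map p (pw \<alpha> n a) = pw \<alpha>' n (p a)"
proof (induction n)
  case (Suc n)
  have "map p (subst_word \<alpha> (pw \<alpha> n a)) = subst_word \<alpha>' (map p (pw \<alpha> n a))"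
    using set_pw_A[OF assms(2)] by (intro subst_word_map[of A] assms(1))
  then show ?case using Suc by (simp add: pw_def)
qed simp

lemma map_subst_pt:
  assumes "\<And>a. a \<in> A \<Longrightarrow> map p (\<rho> a) = \<tau> a" "\<And>j. x j \<in> A" "M > 0"
    "\<And>a. a \<in> A \<Longrightarrow> length (\<rho> a) = M"
  shows "(\<lambda>i. p (subst_pt M \<rho> x i)) = subst_pt M \<tau> x"
proof
  fix i
  have "nat (i mod int M) < M" using assms(3) by (simp add: nat_less_iff)
  then have "p (\<rho> (x (i div int M)) ! nat (i mod int M)) = map p (\<rho> (x (i div int M))) ! nat (i mod int M)"
    using assms(2,4) by simp
  then show "p (subst_pt M \<rho> x i) = subst_pt M \<tau> x i"
    using assms(1,2) by (simp add: subst_pt_def)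
qed

lemma map_X:
  assumes "\<And>a. a \<in> A \<Longrightarrow> map p (\<alpha> a) = \<alpha>' (p a)" "p ` A \<subseteq> A'" "x \<in> X"
  shows "(\<lambda>i. p (x i)) \<in> subshift A' \<alpha>'"
proof -
  have "window (\<lambda>i. p (x i)) i n \<in> language A' \<alpha>'" for i n
  proof -
    have "window x i n \<in> Lang" using assms(3) X_iff by blast
    then obtain a m where a: "a \<in> A" "m > 0" "sublist (window x i n) (pw \<alpha> m a)" by (rule LangE)
    have "window (\<lambda>i. p (x i)) i n = map p (window x i n)" by (simp add: window_def)
    also have "sublist \<dots> (map p (pw \<alpha> m a))" using a(3) by (rule map_mono_sublist)
    also have "map p (pw \<alpha> m a) = pw \<alpha>' m (p a)" by (rule map_pw[OF assms(1) a(1)])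
    finally show ?thesis
      using a(1,2) assms(2) unfolding language_def pw_def
      by (intro CollectI bexI[of _ "p a"] exI[of _ m]) auto
  qed
  then show ?thesis using X_range[OF assms(3)] assms(2) by (auto simp: subshift_def window_def)
qed

lemma primitive_image:
  assumes "\<And>a. a \<in> A \<Longrightarrow> map p (\<alpha> a) = \<alpha>' (p a)" "p ` A = A'"
  shows "primitive_subst A' \<alpha>'"
proof -
  obtain n where n: "n > 0" "\<And>b. b \<in> A \<Longrightarrow> A \<subseteq> set (pw \<alpha> n b)"
    using primitive unfolding primitive_subst_def pw_def by blast
  have "A' \<subseteq> set (pw \<alpha>' n (p b))" if "b \<in> A" for b
    using n(2)[OF that] assms(2) map_pw[of p \<alpha>' b n, OF assms(1) that, symmetric] by auto
  then show ?thesis unfolding primitive_subst_def pw_def using n(1) assms(2) by blast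
qed

text \<open>Every point repeats one block of length \<open>L ^ N\<close>. This shows below that
  identifying letters leaves at least two of them.\<close>

lemma finite_if_constant_blocks:
  assumes "\<And>a b. a \<in> A \<Longrightarrow> b \<in> A \<Longrightarrow> pw \<alpha> N a = pw \<alpha> N b"
  shows "finite X"
proof (cases "X = {}")
  case False
  then obtain x where x: "x \<in> X" by blast
  define M where "M = L ^ N"
  have M: "M > 0" unfolding M_def by (rule Lpow_pos)
  obtain c where c: "c \<in> A" using A_nonempty by blast
  have "x (t + int M) = x t" for t
  proof -
    have "window x t (M + 1) \<in> Lang" using x X_iff by blast
    then obtain v where v: "v \<in> Lang" "sublist (window x t (M + 1)) (subst_word (pw \<alpha> N) v)"
      using ex_cover_short by blast
    obtain ps ss where w: "subst_word (pw \<alpha> N) v = ps @ window x t (M + 1) @ ss"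
      using v(2) by (auto simp: sublist_def)
    have vA: "set v \<subseteq> A" using v(1) Lang_lists by blast
    have len: "length (pw \<alpha> N a) = M" if "a \<in> set v" for a using that vA length_pw_A by (auto simp: M_def)
    have lw: "length (subst_word (pw \<alpha> N) v) = M * length v" using len by (rule length_subst_word)
    have nth: "subst_word (pw \<alpha> N) v ! j = pw \<alpha> N c ! (j mod M)" if "j < M * length v" for j
    proof -
      have "j div M < length v" using that by (simp add: less_mult_imp_div_less mult.commute)
      then have "v ! (j div M) \<in> A" using vA nth_mem by blast
      then have "pw \<alpha> N (v ! (j div M)) = pw \<alpha> N c" using c by (rule assms)
      then show ?thesis using nth_subst_word[OF len that] by simp
    qed
    have le: "length ps + M < M * length v" using lw unfolding w by simp
    have "x (t + int j) = pw \<alpha> N c ! ((length ps + j) mod M)" if "j \<le> M" for j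
    proof -
      have "x (t + int j) = window x t (M + 1) ! j" using that by simp
      also have "\<dots> = (ps @ window x t (M + 1) @ ss) ! (length ps + j)"
        using that by (simp add: nth_append)
      also have "\<dots> = pw \<alpha> N c ! ((length ps + j) mod M)"
        unfolding w[symmetric] using that le by (intro nth) simp
      finally show ?thesis .
    qed
    from this[of 0] this[of M] show ?thesis by simp
  qed
  then show ?thesis using finite_if_periodic[OF x M] by blast
qed simp

end

text \<open>By \<open>p_eq\<close>, only letters with the same N-fold image are identified. The
  exponent \<open>N = 0\<close> covers a mere renaming of letters, which is also an
  instance.\<close>

locale letter_identification = const_length_subst +
  fixes A' :: "'a set" and \<alpha>' :: "'a \<Rightarrow> 'a list" and p :: "'a \<Rightarrow> 'a" and N :: nat
  assumes infinite_X: "infinite X"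
    and p_onto: "p ` A = A'"
    and p_\<alpha>: "\<And>a. a \<in> A \<Longrightarrow> map p (\<alpha> a) = \<alpha>' (p a)"
    and inj_\<alpha>': "inj_on \<alpha>' A'"
    and p_eq: "\<And>a b. a \<in> A \<Longrightarrow> b \<in> A \<Longrightarrow> p a = p b \<Longrightarrow> pw \<alpha> N a = pw \<alpha> N b"
begin

lemma injective_image: "injective_const_length_subst A' \<alpha>' L"
proof unfold_locales
  have "card A' \<ge> 2"
  proof (rule ccontr)
    assume "\<not> card A' \<ge> 2"
    then have "card A' \<le> Suc 0" by simp
    moreover have "finite A'" using finite_A p_onto by blast
    ultimately have "\<forall>a'\<in>A'. \<forall>b'\<in>A'. a' = b'" using card_le_Suc0_iff_eq by blast
    then have "finite X" using p_onto p_eq by (intro finite_if_constant_blocks[of N]) blast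
    then show False using infinite_X by blast
  qed
  moreover have "set (\<alpha>' a') \<subseteq> A'" if a': "a' \<in> A'" for a'
  proof -
    obtain a where "a \<in> A" "a' = p a" using a' p_onto by blast
    then show ?thesis using p_\<alpha>[of a] set_\<alpha>[of a] p_onto by (metis image_mono set_map)
  qed
  ultimately show "Defs.substitution A' \<alpha>'"
    using finite_A p_onto unfolding substitution_def in_lists_conv_set by blast
  show "primitive_subst A' \<alpha>'" using p_\<alpha> p_onto by (rule primitive_image)
  show "Defs.constant_length A' \<alpha>' L"
    unfolding constant_length_def
  proof
    fix a' assume "a' \<in> A'"
    then obtain a where "a \<in> A" "a' = p a" using p_onto by blast
    then show "length (\<alpha>' a') = L" using p_\<alpha>[of a] length_\<alpha>[of a] by (metis length_map)
  qed
  show "1 < L" by (rule L_gt_1)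
  show "inj_on \<alpha>' A'" by (rule inj_\<alpha>')
qed

interpretation I: injective_const_length_subst A' \<alpha>' L
  by (rule injective_image)

text \<open>\<open>pw \<alpha> N\<close> factors through \<open>p\<close> as \<open>\<rho>\<close>
  after \<open>p\<close>, while \<open>p\<close> after \<open>\<rho>\<close> is
  \<open>pw \<alpha>' N\<close>. In this way points over the smaller alphabet give back points over
  the larger one.\<close>

definition \<rho> where "\<rho> a' = pw \<alpha> N (SOME a. a \<in> A \<and> p a = a')"

lemma \<rho>_p: "a \<in> A \<Longrightarrow> \<rho> (p a) = pw \<alpha> N a"
proof -
  assume a: "a \<in> A"
  define b where "b = (SOME b. b \<in> A \<and> p b = p a)"
  have "b \<in> A \<and> p b = p a" unfolding b_def by (rule someI[of _ a]) (simp add: a)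
  then have "pw \<alpha> N b = pw \<alpha> N a" using a by (intro p_eq) auto
  then show ?thesis by (simp add: \<rho>_def b_def)
qed

lemma length_\<rho>: "a' \<in> A' \<Longrightarrow> length (\<rho> a') = L ^ N"
  using p_onto \<rho>_p length_pw_A by auto

lemma map_\<rho>: "a' \<in> A' \<Longrightarrow> map p (\<rho> a') = pw \<alpha>' N a'"
  using p_onto \<rho>_p map_pw[of p \<alpha>', OF p_\<alpha>] by auto

lemma inj_\<rho>: "inj_on \<rho> A'"
  using I.inj_pw[of N] map_\<rho> by (metis inj_on_def)

lemma p_X: "x \<in> X \<Longrightarrow> (\<lambda>i. p (x i)) \<in> I.X"
  using map_X[of p \<alpha>' A' x, OF p_\<alpha>] p_onto by simp

lemma desubst_\<rho>:
  assumes "x \<in> X"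
  shows "\<exists>k<L ^ N. \<exists>y\<in>I.X. x = shiftn (int k) (subst_pt (L ^ N) \<rho> y)"
proof (rule I.ex_desubst[OF Lpow_pos inj_\<rho> length_\<rho>])
  show "I.X \<noteq> {}" by (rule I.X_nonempty)
  fix i n
  have "window x i n \<in> Lang" using assms X_iff by blast
  then obtain v where v: "v \<in> Lang" "sublist (window x i n) (subst_word (pw \<alpha> N) v)"
    using ex_cover_short by blast
  have vA: "set v \<subseteq> A" using v(1) Lang_lists by blast
  then have "subst_word (pw \<alpha> N) v = subst_word \<rho> (map p v)"
    by (induction v) (simp_all add: \<rho>_p)
  moreover have "map p v \<in> I.Lang"
  proof -
    obtain a m where a: "a \<in> A" "sublist v (pw \<alpha> m a)" using v(1) by (rule LangE)
    have "sublist (map p v) (pw \<alpha>' m (p a))"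
      using map_mono_sublist[OF a(2), of p] map_pw[of p \<alpha>' a m, OF p_\<alpha> a(1)] by simp
    then show ?thesis using I.sublist_pw_Lang a(1) p_onto by blast
  qed
  ultimately show "\<exists>v\<in>I.Lang. sublist (window x i n) (subst_word \<rho> v)" using v(2) by metis
qed

lemma infinite_image: "infinite I.X"
proof
  assume "finite I.X"
  then have "finite ((\<lambda>(k, y). shiftn (int k) (subst_pt (L ^ N) \<rho> y)) ` ({..<L ^ N} \<times> I.X))"
    by simp
  moreover have "X \<subseteq> (\<lambda>(k, y). shiftn (int k) (subst_pt (L ^ N) \<rho> y)) ` ({..<L ^ N} \<times> I.X)"
    using desubst_\<rho> by fastforce
  ultimately show False using infinite_X finite_subset by blast
qed

lemma map_subst_\<rho>:
  assumes "y \<in> I.X"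
  shows "(\<lambda>i. p (shiftn k (subst_pt (L ^ N) \<rho> y) i)) = shiftn k (I.S N y)"
proof -
  have "(\<lambda>i. p (subst_pt (L ^ N) \<rho> y i)) = subst_pt (L ^ N) (pw \<alpha>' N) y"
    by (rule I.map_subst_pt) (use map_\<rho> length_\<rho> I.X_range[OF assms] Lpow_pos in auto)
  then show ?thesis by (simp add: I.S_def shiftn_def fun_eq_iff)
qed

text \<open>A point of \<open>X\<close> is the image of some \<open>y\<close> under
  \<open>\<rho>\<close>, shifted by some \<open>k < L ^ N\<close>. Applying \<open>p\<close> gives
  \<open>I.S N y\<close> with the same shift, from which recognizability of \<open>\<alpha>'\<close>
  recovers \<open>k\<close>, and injectivity of \<open>I.S N\<close> recovers
  \<open>y\<close>.\<close>

lemma inj_p_X: "inj_on (\<lambda>x i. p (x i)) X"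
proof (rule inj_onI)
  fix x1 x2 assume x: "x1 \<in> X" "x2 \<in> X" "(\<lambda>i. p (x1 i)) = (\<lambda>i. p (x2 i))"
  obtain k1 y1 where 1: "k1 < L ^ N" "y1 \<in> I.X" "x1 = shiftn (int k1) (subst_pt (L ^ N) \<rho> y1)"
    using desubst_\<rho>[OF x(1)] by blast
  obtain k2 y2 where 2: "k2 < L ^ N" "y2 \<in> I.X" "x2 = shiftn (int k2) (subst_pt (L ^ N) \<rho> y2)"
    using desubst_\<rho>[OF x(2)] by blast
  have eq: "shiftn (int k1) (I.S N y1) = shiftn (int k2) (I.S N y2)"
    using x(3) unfolding 1(3) 2(3) map_subst_\<rho>[OF 1(2)] map_subst_\<rho>[OF 2(2)] .
  have "shiftn (int k1 - int k2) (I.S N y1) = shiftn (- int k2) (shiftn (int k1) (I.S N y1))"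
    by simp
  also have "\<dots> = I.S N y2" unfolding eq by simp
  finally have dvd: "int (L ^ N) dvd int k1 - int k2"
    by (rule I.recognizability_pow[OF infinite_image 1(2) 2(2)])
  have small: "\<bar>int k1 - int k2\<bar> < int (L ^ N)" using 1(1) 2(1) by linarith
  have k: "k1 = k2"
  proof (rule ccontr)
    assume "k1 \<noteq> k2"
    then have "\<bar>int (L ^ N)\<bar> \<le> \<bar>int k1 - int k2\<bar>" by (intro dvd_imp_le_int[OF _ dvd]) simp
    then show False using small by linarith
  qed
  have "shiftn (- int k2) (shiftn (int k2) (I.S N y1)) = shiftn (- int k2) (shiftn (int k2) (I.S N y2))"
    using eq unfolding k by (rule arg_cong)
  then have "I.S N y1 = I.S N y2" unfolding shiftn_shiftn by simp
  then have "y1 = y2" using I.S_inj 1(2) 2(2) by blast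
  then show "x1 = x2" using 1(3) 2(3) k by simp
qed

theorem conjugate_image: "conjugate A \<alpha> A' \<alpha>'"
proof (rule I.conjugate_if_injective_code)
  show "has_radius X (\<lambda>x i. p (x i)) 0" by (auto simp: has_radius_def)
  show "(\<lambda>i. p (shiftn k x i)) = shiftn k (\<lambda>i. p (x i))" for x k by (simp add: shiftn_def)
qed (use finite_A X_nonempty p_X inj_p_X in auto)

end

section \<open>The algorithm\<close>

definition tables :: "nat \<Rightarrow> nat \<Rightarrow> subst_table list" where
  "tables k L = List.n_lists k (List.n_lists L [0..<k])"

definition table_inj :: "subst_table \<Rightarrow> bool" where
  "table_inj t = list_all (\<lambda>a. list_all (\<lambda>b. nth_default [] t a = nth_default [] t b \<longrightarrow> a = b)
     [0..<length t]) [0..<length t]"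

text \<open>The exponent is the number of pairs of letters: the set of pairs with equal n-fold
  images grows with \<open>n\<close> and is stable from there on, by
  \<open>kernel_stable\<close>.\<close>

definition is_identification :: "subst_table \<Rightarrow> subst_table \<Rightarrow> nat list \<Rightarrow> bool" where
  "is_identification t t' p \<longleftrightarrow>
     list_all (\<lambda>a. map (\<lambda>b. nth_default 0 p b) (nth_default [] t a) = nth_default [] t' (nth_default 0 p a)) [0..<length t] \<and>
     list_all (\<lambda>j. j \<in> set p) [0..<length t'] \<and> table_inj t' \<and>
     list_all (\<lambda>a. list_all (\<lambda>b. nth_default 0 p a = nth_default 0 p b \<longrightarrow>
       (tsubst t ^^ (length t * length t)) [a] = (tsubst t ^^ (length t * length t)) [b])
       [0..<length t]) [0..<length t]"

text \<open>The pair of \<open>t'\<close> and \<open>p\<close> is searched for rather than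
  constructed: every pair that passes the test gives an injective substitution conjugate to
  \<open>t\<close>, if the subshift of \<open>t\<close> is infinite, and
  \<open>ex_identification\<close> provides one.\<close>

definition conjugate_list :: "subst_table \<Rightarrow> nat \<Rightarrow> subst_table list" where
  "conjugate_list t L = filter (\<lambda>s. 2 \<le> length s \<and> table_inj s \<and> is_primitive s \<and>
     list_ex (\<lambda>t'. list_ex (\<lambda>p. is_identification t t' p \<and> conj_check s t' L)
       (List.n_lists (length t) [0..<length t'])) (concat (map (\<lambda>m. tables m L) [0..<Suc (length t)])))
     (concat (map (\<lambda>m. tables m L) [0..<Suc (length t ^ 5)]))"

text \<open>The length \<open>L\<close> is not part of the input and is read off the image of the
  letter 0.\<close>

lemma cmp_conjugate_list: "cmp (\<lambda>t. conjugate_list t (length (nth_default [] t 0)))"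
  unfolding conjugate_list_def is_identification_def table_inj_def is_primitive_def tables_def
    conj_check_def code_step_def code_inj_def code_legal_def block_maps_def five_words_def
    code_word_def look_def lang_words_def lang_step_def words_upto_def is_sublist_def tsubst_def
  by (intro cmp_intros)

lemma set_tables:
  "t \<in> set (tables k L) \<longleftrightarrow> length t = k \<and> (\<forall>w\<in>set t. length w = L \<and> set w \<subseteq> {..<k})"
  by (auto simp: tables_def set_n_lists subset_eq)

lemma set_all_tables:
  "t \<in> set (concat (map (\<lambda>m. tables m L) [0..<Suc n])) \<longleftrightarrow>
    length t \<le> n \<and> (\<forall>w\<in>set t. length w = L \<and> set w \<subseteq> {..<length t})"
  by (auto simp: set_tables simp del: upt_Suc)

lemma table_inj_iff: "table_inj t \<longleftrightarrow> inj_on (table_map t) (table_alphabet t)"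
  by (auto simp: table_inj_def list_all_iff inj_on_def table_map_def table_alphabet_def nth_default_def)

lemma table_substI:
  assumes "\<forall>w\<in>set t. length w = L \<and> set w \<subseteq> {..<length t}" "2 \<le> length t" "is_primitive t" "1 < L"
  shows "table_subst t L"
proof unfold_locales
  have w: "length (t ! a) = L" "set (t ! a) \<subseteq> {..<length t}" if "a < length t" for a
    using assms(1) that by simp_all
  show "substitution (table_alphabet t) (table_map t)"
    using assms(2) w(2) by (auto simp: substitution_def table_alphabet_def table_map_def)
  show "primitive_subst (table_alphabet t) (table_map t)"
    using assms(3) is_primitive_iff[OF w(2)] by simp
  show "constant_length (table_alphabet t) (table_map t) L"
    using w(1) by (auto simp: constant_length_def table_alphabet_def table_map_def)
qed (rule assms(4))

lemma subst_word_eqD: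
  assumes "length u = length w" "\<And>a. a \<in> set u \<union> set w \<Longrightarrow> length (\<rho> a) = M"
    "subst_word \<rho> u = subst_word \<rho> w"
  shows "map \<rho> u = map \<rho> w"
  using assms by (induction u w rule: list_induct2) auto

lemma map_subst_word_cong: "map \<rho> u = map \<rho> w \<Longrightarrow> subst_word \<rho> u = subst_word \<rho> w"
  by (simp add: subst_word_def)

section \<open>Identifying the letters of a table\<close>

context table_subst
begin

abbreviation "k \<equiv> length t"
abbreviation "P \<equiv> pw (table_map t)"

lemma table_words: "\<forall>w\<in>set t. length w = L \<and> set w \<subseteq> {..<k}"
proof
  fix w assume "w \<in> set t"
  then obtain a where "a < k" "w = t ! a" by (auto simp: in_set_conv_nth)
  then show "length w = L \<and> set w \<subseteq> {..<k}"
    using length_\<alpha>[of a] table_letters[of a] by (simp add: alphabet table_map_def)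
qed

lemma tsubst_pow: "a < k \<Longrightarrow> (tsubst t ^^ n) [a] = P n a"
  using funpow_tsubst_eq[of t "[a]" n] table_letters by (simp add: pw_def)

text \<open>Whether two letters agree at level \<open>n + 1\<close> depends only on which letters of
  their images agree at level \<open>n\<close>. So the kernels \<open>K n\<close> stay constant once
  two consecutive ones are equal, and until then each step adds a pair.\<close>

lemma kernel_stable:
  assumes "a < k" "b < k" "P (Suc (k * k)) a = P (Suc (k * k)) b"
  shows "P (k * k) a = P (k * k) b"
proof -
  define K where "K n = {(a, b). a < k \<and> b < k \<and> P n a = P n b}" for n
  have sub: "K n \<subseteq> {..<k} \<times> {..<k}" for n by (auto simp: K_def)
  have P_Suc: "P (Suc n) a = subst_word (P n) (t ! a)" "P (Suc n) a = subst_word (table_map t) (P n a)" for n a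
    using pw_add[of "table_map t" n 1 a] pw_add[of "table_map t" 1 n a] by (simp_all add: table_map_def)
  have "K n \<subseteq> K (Suc n)" for n unfolding K_def P_Suc(2) by auto
  then have "mono K" by (simp add: mono_iff_le_Suc)
  moreover have "finite (range K)"
    by (rule finite_subset[of _ "Pow ({..<k} \<times> {..<k})"]) (use sub in auto)
  moreover have "K (Suc n) = K (Suc (Suc n))" if eq: "K n = K (Suc n)" for n
  proof
    show "K (Suc n) \<subseteq> K (Suc (Suc n))" using \<open>mono K\<close> by (simp add: mono_def)
    show "K (Suc (Suc n)) \<subseteq> K (Suc n)"
    proof
      fix ab assume "ab \<in> K (Suc (Suc n))"
      then obtain a b where ab: "ab = (a, b)" "a < k" "b < k" "P (Suc (Suc n)) a = P (Suc (Suc n)) b"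
        by (auto simp: K_def)
      have letters: "c < k" if "c \<in> set (t ! a) \<union> set (t ! b)" for c
        using that table_letters ab(2,3) by blast
      have len: "length (t ! a) = length (t ! b)" using table_words ab(2,3) by simp
      have "map (P (Suc n)) (t ! a) = map (P (Suc n)) (t ! b)"
        using ab(4) letters unfolding P_Suc(1)[of "Suc n"]
        by (intro subst_word_eqD[OF len, where M = "L ^ Suc n"]) (auto simp: length_pw_A alphabet)
      then have "(t ! a ! i, t ! b ! i) \<in> K (Suc n)" if "i < L" for i
        using that letters table_words ab(2,3) len unfolding K_def
        by (simp add: list_eq_iff_nth_eq)
      then have "(t ! a ! i, t ! b ! i) \<in> K n" if "i < L" for i using that eq by simp
      then have "map (P n) (t ! a) = map (P n) (t ! b)"
        using table_words ab(2,3) len unfolding K_def by (simp add: list_eq_iff_nth_eq)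
      then have "P (Suc n) a = P (Suc n) b" unfolding P_Suc(1) by (rule map_subst_word_cong)
      then show "ab \<in> K (Suc n)" using ab by (simp add: K_def)
    qed
  qed
  ultimately have "\<exists>N. (\<forall>n\<le>N. \<forall>m\<le>N. m < n \<longrightarrow> K m \<subset> K n) \<and> (\<forall>n\<ge>N. K N = K n)"
    by (intro finite_mono_remains_stable_implies_strict_prefix) auto
  then have "K (card ({..<k} \<times> {..<k})) = (\<Union>n. K n)"
    using sub by (intro finite_mono_strict_prefix_implies_finite_fixpoint) auto
  then have K: "K (k * k) = (\<Union>n. K n)" by (simp add: card_cartesian_product)
  have "(a, b) \<in> K (Suc (k * k))" using assms by (simp add: K_def)
  then have "(a, b) \<in> K (k * k)" unfolding K by blast
  then show ?thesis by (simp add: K_def)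
qed

lemma ex_identification:
  "\<exists>t' p. t' \<in> set (concat (map (\<lambda>m. tables m L) [0..<Suc k])) \<and>
    p \<in> set (List.n_lists k [0..<length t']) \<and> is_identification t t' p"
proof -
  define N where "N = k * k"
  define m where "m = card (P N ` {..<k})"
  have m: "m \<le> k" unfolding m_def using card_image_le[of "{..<k}" "P N"] by simp
  obtain h where h: "bij_betw h (P N ` {..<k}) {0..<m}"
    unfolding m_def using ex_bij_betw_finite_nat[of "P N ` {..<k}"] by blast
  define q where "q a = h (P N a)" for a
  have q_less: "q a < m" if "a < k" for a
    using h that unfolding q_def bij_betw_def by auto
  have q_eq: "q a = q b \<longleftrightarrow> P N a = P N b" if "a < k" "b < k" for a b
    using bij_betw_imp_inj_on[OF h] that unfolding q_def by (auto simp: inj_on_eq_iff)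
  have q_onto: "\<exists>a<k. q a = j" if "j < m" for j
  proof -
    have "j \<in> h ` (P N ` {..<k})" using bij_betw_imp_surj_on[OF h] that by simp
    then show ?thesis unfolding q_def by auto
  qed
  then obtain rep where rep: "\<And>j. j < m \<Longrightarrow> rep j < k" "\<And>j. j < m \<Longrightarrow> q (rep j) = j" by metis
  define t' where "t' = map (\<lambda>j. map q (t ! rep j)) [0..<m]"
  define p where "p = map q [0..<k]"
  have p: "nth_default 0 p a = q a" if "a < k" for a using that by (simp add: p_def nth_default_def)
  have P_Suc: "P (Suc n) a = subst_word (P n) (t ! a)" for n a
    using pw_add[of "table_map t" n 1 a] by (simp add: table_map_def)
  \<comment> \<open>From right to left this makes \<open>t'\<close> independent of the
    representatives \<open>rep\<close>. From left to right, where \<open>kernel_stable\<close> is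
    used, it makes \<open>t'\<close> injective.\<close>
  have image: "map q (t ! a) = map q (t ! b) \<longleftrightarrow> P N a = P N b" if "a < k" "b < k" for a b
  proof -
    have letters: "c < k" if "c \<in> set (t ! a) \<union> set (t ! b)" for c
      using that table_letters \<open>a < k\<close> \<open>b < k\<close> by blast
    have len: "length (t ! a) = length (t ! b)" using table_words that by simp
    have "map q (t ! a) = map q (t ! b) \<longleftrightarrow> map (P N) (t ! a) = map (P N) (t ! b)"
      using len letters by (auto simp: list_eq_iff_nth_eq q_eq)
    also have "\<dots> \<longleftrightarrow> P (Suc N) a = P (Suc N) b"
    proof
      assume "P (Suc N) a = P (Suc N) b"
      then show "map (P N) (t ! a) = map (P N) (t ! b)"
        using letters unfolding P_Suc
        by (intro subst_word_eqD[OF len, where M = "L ^ N"]) (auto simp: length_pw_A alphabet)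
    qed (auto simp: P_Suc intro: map_subst_word_cong)
    also have "\<dots> \<longleftrightarrow> P N a = P N b"
    proof
      assume "P (Suc N) a = P (Suc N) b"
      then show "P N a = P N b" using kernel_stable that unfolding N_def by blast
    next
      assume eq: "P N a = P N b"
      show "P (Suc N) a = P (Suc N) b"
        using pw_add[of "table_map t" 1 N a] pw_add[of "table_map t" 1 N b] eq by simp
    qed
    finally show ?thesis .
  qed
  have lt': "length t' = m" by (simp add: t'_def)
  have t'_nth: "t' ! q a = map q (t ! a)" if a: "a < k" for a
    using image[OF rep(1)[OF q_less[OF a]] a] q_eq[OF rep(1)[OF q_less[OF a]] a] rep(2)[OF q_less[OF a]]
      q_less[OF a] by (simp add: t'_def)
  have "t' \<in> set (concat (map (\<lambda>m. tables m L) [0..<Suc k]))"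
    unfolding set_all_tables lt' using m table_words rep(1) q_less
    by (fastforce simp: t'_def)
  moreover have "p \<in> set (List.n_lists k [0..<length t'])"
    using q_less by (auto simp: p_def set_n_lists lt')
  moreover have "is_identification t t' p"
    unfolding is_identification_def list_all_iff
  proof (intro conjI ballI impI)
    fix a assume "a \<in> set [0..<k]"
    then have a: "a < k" by simp
    have "map (nth_default 0 p) (t ! a) = map q (t ! a)"
      using table_letters[OF a] by (intro map_cong refl p) auto
    then show "map (nth_default 0 p) (nth_default [] t a) = nth_default [] t' (nth_default 0 p a)"
      using a q_less[OF a] by (simp add: nth_default_def p[OF a, unfolded nth_default_def] t'_nth lt')
  next
    fix j assume "j \<in> set [0..<length t']"
    then obtain a where "a < k" "q a = j" using q_onto[of j] by (auto simp: lt')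
    then show "j \<in> set p" by (auto simp: p_def)
  next
    show "table_inj t'"
      unfolding table_inj_def list_all_iff
    proof (intro ballI impI)
      fix i j assume ij: "i \<in> set [0..<length t']" "j \<in> set [0..<length t']"
        "nth_default [] t' i = nth_default [] t' j"
      then have "map q (t ! rep i) = map q (t ! rep j)" by (simp add: nth_default_def t'_def)
      then have "q (rep i) = q (rep j)" using ij image q_eq rep(1) by (simp add: lt')
      then show "i = j" using ij rep(2) by (simp add: lt')
    qed
  next
    fix a b assume "a \<in> set [0..<k]" "b \<in> set [0..<k]" "nth_default 0 p a = nth_default 0 p b"
    then show "(tsubst t ^^ (k * k)) [a] = (tsubst t ^^ (k * k)) [b]"
      using q_eq[of a b] by (simp add: p tsubst_pow N_def)
  qed
  ultimately show ?thesis by blast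
qed

lemma letter_identificationI:
  assumes "infinite X" "is_identification t t' p" "p \<in> set (List.n_lists k [0..<length t'])"
  shows "letter_identification (table_alphabet t) (table_map t) L (table_alphabet t') (table_map t')
    (nth_default 0 p) (k * k)"
proof (intro letter_identification.intro letter_identification_axioms.intro)
  show "const_length_subst (table_alphabet t) (table_map t) L" by unfold_locales
  show "infinite X" by fact
  have p: "length p = k" "set p \<subseteq> {..<length t'}" using assms(3) by (auto simp: set_n_lists)
  then have p_nth: "nth_default 0 p a < length t'" "nth_default 0 p a = p ! a" if "a < k" for a
    using that p(1) subsetD[OF p(2), of "p ! a"] by (simp_all add: nth_default_def)
  show "nth_default 0 p ` table_alphabet t = table_alphabet t'"
  proof
    show "nth_default 0 p ` table_alphabet t \<subseteq> table_alphabet t'"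
      using p_nth(1) by (auto simp: table_alphabet_def)
    show "table_alphabet t' \<subseteq> nth_default 0 p ` table_alphabet t"
    proof
      fix j assume "j \<in> table_alphabet t'"
      then have "j \<in> set p" using assms(2) by (simp add: is_identification_def list_all_iff table_alphabet_def)
      then obtain a where "a < k" "j = p ! a" using p(1) by (auto simp: in_set_conv_nth)
      then show "j \<in> nth_default 0 p ` table_alphabet t"
        using p_nth(2) by (auto simp: table_alphabet_def intro!: image_eqI[of _ _ a])
    qed
  qed
  show "map (nth_default 0 p) (table_map t a) = table_map t' (nth_default 0 p a)" if "a \<in> table_alphabet t" for a
  proof -
    have a: "a < k" using that by (simp add: table_alphabet_def)
    then have "map (nth_default 0 p) (nth_default [] t a) = nth_default [] t' (nth_default 0 p a)"
      using assms(2) by (simp add: is_identification_def list_all_iff)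
    then show ?thesis
      using a p_nth(1)[OF a] nth_default_nth[of a t "[]"] nth_default_nth[of "nth_default 0 p a" t' "[]"]
      by (simp add: table_map_def)
  qed
  show "inj_on (table_map t') (table_alphabet t')"
    using assms(2) by (simp add: is_identification_def table_inj_iff)
  show "P (k * k) a = P (k * k) b"
    if "a \<in> table_alphabet t" "b \<in> table_alphabet t" "nth_default 0 p a = nth_default 0 p b" for a b
  proof -
    have ab: "a < k" "b < k" using that by (simp_all add: table_alphabet_def)
    have "\<forall>a\<in>set [0..<k]. \<forall>b\<in>set [0..<k]. nth_default 0 p a = nth_default 0 p b \<longrightarrow>
        (tsubst t ^^ (k * k)) [a] = (tsubst t ^^ (k * k)) [b]"
      using assms(2) unfolding is_identification_def list_all_iff by blast
    moreover have "a \<in> set [0..<k]" "b \<in> set [0..<k]" using ab by simp_all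
    ultimately have "(tsubst t ^^ (k * k)) [a] = (tsubst t ^^ (k * k)) [b]" using that(3) by blast
    then show ?thesis by (simp add: tsubst_pow ab)
  qed
qed

end

text \<open>Every letter of \<open>B\<close> occurs at position 0 of some point, by minimality, and
  is there the value of \<open>F\<close> at a window of five letters.\<close>

lemma (in two_substs) card_alphabet_le:
  assumes "conj_maps A.X B.X F G" "has_radius A.X F 2"
  shows "card B \<le> card A ^ 5"
proof -
  let ?W = "{w. set w \<subseteq> A \<and> length w = 5}"
  define v where "v w = F (SOME x. x \<in> A.X \<and> window x (-2) 5 = w) 0" for w
  have "B \<subseteq> v ` ?W"
  proof
    fix b assume b: "b \<in> B"
    obtain y0 where "y0 \<in> B.X" using B.X_nonempty by blast
    moreover have "[b] \<in> B.Lang" using B.pw_in_Lang[OF b, of 0] by simp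
    ultimately obtain i where i: "window y0 i 1 = [b]" using B.minimal[of "[b]" y0] by auto
    define y where "y = shiftn i y0"
    have y: "y \<in> B.X" "y 0 = b" using \<open>y0 \<in> B.X\<close> i by (simp_all add: y_def window_def)
    define x where "x = G y"
    have x: "x \<in> A.X" "F x = y" using assms(1) y(1) by (simp_all add: conj_maps_def x_def)
    define x' where "x' = (SOME x'. x' \<in> A.X \<and> window x' (-2) 5 = window x (-2) 5)"
    have x': "x' \<in> A.X \<and> window x' (-2) 5 = window x (-2) 5"
      unfolding x'_def by (rule someI[of _ x]) (simp add: x)
    have "\<forall>i. \<bar>i\<bar> \<le> int 2 \<longrightarrow> x' i = x i"
      using x' by (auto intro!: window_eqD_int[of x' "-2" 5 x])
    then have "F x' 0 = F x 0" using assms(2) x' x(1) unfolding has_radius_def by blast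
    then have "b = v (window x (-2) 5)" using x y by (simp add: v_def x'_def)
    moreover have "window x (-2) 5 \<in> ?W" using A.X_range[OF x(1)] by (auto simp: set_window)
    ultimately show "b \<in> v ` ?W" by blast
  qed
  then have "card B \<le> card ?W" by (rule surj_card_le[OF finite_lists_length_eq[OF A.finite_A]])
  then show ?thesis by (simp add: card_lists_length_eq[OF A.finite_A])
qed

lemma (in const_length_subst) conjugate_symX:
  "conjugate A \<alpha> B \<beta> \<Longrightarrow> conjugate B \<beta> A \<alpha>"
  by (rule conjugate_sym) (simp_all add: shift_conv_shiftn)

lemma infinite_if_conjugate:
  assumes "conjugate A \<alpha> B \<beta>" "infinite (subshift B \<beta>)"
  shows "infinite (subshift A \<alpha>)"
proof -
  obtain F where "homeomorphic_map (subshift_topology A \<alpha>) (subshift_topology B \<beta>) F"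
    using assms(1) unfolding conjugate_def by blast
  then have "F ` subshift A \<alpha> = subshift B \<beta>" using homeomorphic_imp_surjective_map by fastforce
  then show ?thesis using assms(2) by (metis finite_imageI)
qed

section \<open>Soundness and completeness of the list\<close>

lemma conjugate_list_sound:
  assumes t: "table_subst t L" and inf: "infinite (subshift (table_alphabet t) (table_map t))"
    and s: "s \<in> set (conjugate_list t L)"
  shows "injective_primitive_conjugate (table_alphabet t) (table_map t) L (table_alphabet s) (table_map s)"
proof -
  interpret table_subst t L by (rule t)
  obtain t' p where s: "2 \<le> length s" "table_inj s" "is_primitive s"
    "\<forall>w\<in>set s. length w = L \<and> set w \<subseteq> {..<length s}"
    and p: "p \<in> set (List.n_lists (length t) [0..<length t'])" "is_identification t t' p"
    and check: "conj_check s t' L"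
    using s unfolding conjugate_list_def list_ex_iff set_filter set_all_tables by blast
  interpret I: letter_identification "table_alphabet t" "table_map t" L "table_alphabet t'" "table_map t'"
    "nth_default 0 p" "length t * length t"
    by (rule letter_identificationI[OF inf p(2,1)])
  interpret S: table_subst s L by (rule table_substI[OF s(4,1,3) L_gt_1])
  interpret T: injective_const_length_subst "table_alphabet t'" "table_map t'" L
    by (rule I.injective_image)
  interpret ST: table_pair s t' L
    by unfold_locales (use s(2) in \<open>simp add: table_inj_iff\<close>)
  have "conjugate (table_alphabet s) (table_map s) (table_alphabet t) (table_map t)"
    using conjugate_trans[OF ST.conj_check_sound[OF check] conjugate_symX[OF I.conjugate_image]] .
  then show ?thesis
    using S.substitution S.primitive S.constant_length s(2)
    by (simp add: injective_primitive_conjugate_def injective_subst_def table_inj_iff)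
qed

lemma conjugate_list_complete:
  fixes B :: "nat set"
  assumes t: "table_subst t L" and inf: "infinite (subshift (table_alphabet t) (table_map t))"
    and B: "injective_primitive_conjugate (table_alphabet t) (table_map t) L B \<beta>"
  shows "\<exists>s\<in>set (conjugate_list t L). same_up_to_renaming (table_alphabet s) (table_map s) B \<beta>"
proof -
  interpret table_subst t L by (rule t)
  obtain t' p where t': "t' \<in> set (concat (map (\<lambda>m. tables m L) [0..<Suc (length t)]))"
    and p: "p \<in> set (List.n_lists (length t) [0..<length t'])" "is_identification t t' p"
    using ex_identification by blast
  interpret I: letter_identification "table_alphabet t" "table_map t" L "table_alphabet t'" "table_map t'"
    "nth_default 0 p" "length t * length t"
    by (rule letter_identificationI[OF inf p(2,1)])
  interpret T: injective_const_length_subst "table_alphabet t'" "table_map t'" L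
    by (rule I.injective_image)
  interpret B: injective_const_length_subst B \<beta> L
    by unfold_locales (use B L_gt_1 in \<open>simp_all add: injective_primitive_conjugate_def injective_subst_def\<close>)
  have Bt: "conjugate B \<beta> (table_alphabet t) (table_map t)"
    using B by (simp add: injective_primitive_conjugate_def)
  have infB: "infinite B.X" using infinite_if_conjugate[OF Bt inf] .
  have Bt': "conjugate B \<beta> (table_alphabet t') (table_map t')"
    using conjugate_trans[OF Bt I.conjugate_image] .
  interpret TB: two_substs "table_alphabet t'" "table_map t'" L B \<beta>
    by unfold_locales (rule infB)
  obtain F G r where "conj_maps T.X B.X F G" "has_radius T.X F r" "has_radius B.X G r"
    using T.conjugate_imp_conj_maps[OF B.finite_A B.conjugate_symX[OF Bt']] by blast
  then obtain F G where "conj_maps T.X B.X F G" "has_radius T.X F 2" using TB.ex_radius_2 by blast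
  then have "card B \<le> length t' ^ 5" using TB.card_alphabet_le by (simp add: table_alphabet_def)
  also have "\<dots> \<le> length t ^ 5" using t' unfolding set_all_tables by (intro power_mono) auto
  finally have cardB: "card B \<le> length t ^ 5" .
  define m where "m = card B"
  obtain \<pi> where \<pi>: "bij_betw \<pi> {..<m} B"
    unfolding m_def using ex_bij_betw_nat_finite[OF B.finite_A] by (auto simp: atLeast0LessThan)
  define q where "q = inv_into {..<m} \<pi>"
  have q: "bij_betw q B {..<m}" unfolding q_def by (rule bij_betw_inv_into[OF \<pi>])
  have q\<pi>: "q (\<pi> a) = a" if "a < m" for a
    using bij_betw_inv_into_left[OF \<pi>] that by (simp add: q_def)
  have \<pi>q: "\<pi> (q b) = b" if "b \<in> B" for b
    using bij_betw_inv_into_right[OF \<pi> that] by (simp add: q_def)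
  define s where "s = map (\<lambda>a. map q (\<beta> (\<pi> a))) [0..<m]"
  have \<pi>B: "\<pi> a \<in> B" if "a < m" for a using bij_betwE[OF \<pi>] that by simp
  have qB: "q b < m" if "b \<in> B" for b using bij_betwE[OF q] that by simp
  have ls: "length s = m" by (simp add: s_def)
  have q\<beta>: "map q (\<beta> b) = table_map s (q b)" if "b \<in> B" for b
    using that qB[OF that] \<pi>q by (simp add: s_def table_map_def)
  \<comment> \<open>The renaming \<open>q\<close> is an identification with exponent 0, so that its
    conjugacy is an instance of \<open>conjugate_image\<close>.\<close>
  interpret R: letter_identification B \<beta> L "table_alphabet s" "table_map s" q 0
  proof (intro letter_identification.intro letter_identification_axioms.intro)
    show "const_length_subst B \<beta> L" by unfold_locales
    show "q ` B = table_alphabet s" using bij_betw_imp_surj_on[OF q] by (simp add: table_alphabet_def ls)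
    show "inj_on (table_map s) (table_alphabet s)"
    proof (rule inj_onI)
      fix a b assume ab: "a \<in> table_alphabet s" "b \<in> table_alphabet s" "table_map s a = table_map s b"
      then have "a < m" "b < m" by (simp_all add: table_alphabet_def ls)
      then have eq: "map q (\<beta> (\<pi> a)) = map q (\<beta> (\<pi> b))" using ab(3) by (simp add: table_map_def s_def)
      have "inj_on q (set (\<beta> (\<pi> a)) \<union> set (\<beta> (\<pi> b)))"
        by (rule inj_on_subset[OF bij_betw_imp_inj_on[OF q]])
          (use B.set_\<alpha> \<pi>B \<open>a < m\<close> \<open>b < m\<close> in blast)
      then have "\<beta> (\<pi> a) = \<beta> (\<pi> b)" using eq by (simp add: inj_on_map_eq_map)
      then have "\<pi> a = \<pi> b" using B.inj_\<alpha> \<pi>B \<open>a < m\<close> \<open>b < m\<close> by (meson inj_onD)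
      then show "a = b" using q\<pi> \<open>a < m\<close> \<open>b < m\<close> by metis
    qed
    show "pw \<beta> 0 a = pw \<beta> 0 b" if "a \<in> B" "b \<in> B" "q a = q b" for a b
      using inj_onD[OF bij_betw_imp_inj_on[OF q] that(3,1,2)] by simp
  qed (use infB q\<beta> in auto)
  interpret S: injective_const_length_subst "table_alphabet s" "table_map s" L
    by (rule R.injective_image)
  interpret ST: table_pair s t' L by unfold_locales (rule S.inj_\<alpha>)
  have "conjugate (table_alphabet s) (table_map s) (table_alphabet t') (table_map t')"
    using conjugate_trans[OF B.conjugate_symX[OF R.conjugate_image] Bt'] .
  then have check: "conj_check s t' L"
    by (rule ST.conj_check_complete[OF T.inj_\<alpha> I.infinite_image])
  have "is_primitive s" using is_primitive_iff[OF ST.S.table_letters] S.primitive by simp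
  moreover have "2 \<le> length s" using S.substitution by (simp add: substitution_def table_alphabet_def)
  moreover have "table_inj s" using S.inj_\<alpha> by (simp add: table_inj_iff)
  moreover have "s \<in> set (concat (map (\<lambda>m. tables m L) [0..<Suc (length t ^ 5)]))"
    unfolding set_all_tables using ST.S.table_words cardB by (simp add: ls m_def)
  ultimately have "s \<in> set (conjugate_list t L)"
    unfolding conjugate_list_def set_filter list_ex_iff using check t' p by blast
  moreover have "same_up_to_renaming (table_alphabet s) (table_map s) B \<beta>"
    unfolding same_up_to_renaming_def
  proof (intro exI[of _ \<pi>] conjI ballI)
    show "bij_betw \<pi> (table_alphabet s) B" using \<pi> by (simp add: table_alphabet_def ls)
    fix a assume "a \<in> table_alphabet s"
    then have a: "a < m" by (simp add: table_alphabet_def ls)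
    have "map \<pi> (map q (\<beta> (\<pi> a))) = map id (\<beta> (\<pi> a))"
      unfolding map_map using B.set_\<alpha>[OF \<pi>B[OF a]] \<pi>q by (intro map_cong refl) auto
    then show "\<beta> (\<pi> a) = map \<pi> (table_map s a)" using a by (simp add: table_map_def s_def)
  qed
  ultimately show ?thesis by blast
qed

theorem mainTheorem3:
  "\<exists>p :: recf. \<forall>(t :: subst_table) (L :: nat).
     substitution (table_alphabet t) (table_map t) \<longrightarrow>
     primitive_subst (table_alphabet t) (table_map t) \<longrightarrow>
     constant_length (table_alphabet t) (table_map t) L \<longrightarrow>
     L > 1 \<longrightarrow>
     infinite (subshift (table_alphabet t) (table_map t)) \<longrightarrow>
     (\<exists>ts :: subst_table list.
        eval p [table_code t] = Some (tables_code ts) \<and>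
        (\<forall>s\<in>set ts. injective_primitive_conjugate (table_alphabet t) (table_map t) L
                      (table_alphabet s) (table_map s)) \<and>
        (\<forall>(B :: nat set) (\<beta> :: nat \<Rightarrow> nat list).
           injective_primitive_conjugate (table_alphabet t) (table_map t) L B \<beta> \<longrightarrow>
           (\<exists>s\<in>set ts. same_up_to_renaming (table_alphabet s) (table_map s) B \<beta>)))"
proof -
  have code_nat: "(enc :: nat \<Rightarrow> nat) = id" by (rule ext) (simp add: enc_nat_def)
  have code_word: "(enc :: nat list \<Rightarrow> nat) = list_encode"
    by (rule ext) (simp add: enc_list_def code_nat)
  have code_table: "(enc :: subst_table \<Rightarrow> nat) = table_code"
    by (rule ext) (simp add: enc_list_def code_word table_code_def)
  have code_tables: "(enc :: subst_table list \<Rightarrow> nat) = tables_code"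
    by (rule ext) (simp add: enc_list_def code_table tables_code_def)
  obtain p where p: "\<And>t. eval p [table_code t] = Some (tables_code (conjugate_list t (length (nth_default [] t 0))))"
    using cmp_conjugate_list unfolding cmp_def code_table code_tables by blast
  show ?thesis
  proof (intro exI[of _ p] allI impI)
    fix t :: subst_table and L :: nat
    let ?A = "table_alphabet t" and ?\<alpha> = "table_map t"
    assume t: "substitution ?A ?\<alpha>" "primitive_subst ?A ?\<alpha>" "constant_length ?A ?\<alpha> L" "L > 1"
      and inf: "infinite (subshift ?A ?\<alpha>)"
    have ts: "table_subst t L" by unfold_locales (use t in auto)
    have "2 \<le> length t" using t(1) by (simp add: substitution_def table_alphabet_def)
    then have "0 < length t" by linarith
    then have "length (nth_default [] t 0) = L"
      using t(3) by (simp add: constant_length_def table_alphabet_def table_map_def nth_default_def)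
    then have "eval p [table_code t] = Some (tables_code (conjugate_list t L))" using p[of t] by simp
    then show "\<exists>ts. eval p [table_code t] = Some (tables_code ts) \<and>
        (\<forall>s\<in>set ts. injective_primitive_conjugate ?A ?\<alpha> L (table_alphabet s) (table_map s)) \<and>
        (\<forall>(B :: nat set) (\<beta> :: nat \<Rightarrow> nat list). injective_primitive_conjugate ?A ?\<alpha> L B \<beta> \<longrightarrow>
           (\<exists>s\<in>set ts. same_up_to_renaming (table_alphabet s) (table_map s) B \<beta>))"
      using conjugate_list_sound[OF ts inf] conjugate_list_complete[OF ts inf]
      by (intro exI[of _ "conjugate_list t L"]) blast
  qed
qed

end
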